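(* Suppose there is a constant $\gamma\in[0,1/2)$ with $k_u\lesssim p^\gamma$, and that $n\ge c\,k_u\log p$ for a suitable (sufficiently large) constant $c>0$. In the ultra-sparse regime $k_u\lesssim\sqrt n/\log p$, for all $1\le k\le k_u$, $$\tau_{\mathrm{adap}}(k_u,k;\xi)\asymp_{\log}\frac{\nu_1}{\sqrt n}\asymp_{\log}\frac{H(k_u^2\log p;\xi)}{\sqrt n}.$$ If further $k_u^2\log p\lesssim j_1$, where $j_1=\max\{j\in[p]:|\xi_j|\ge\lambda\}$ (and $j_1=0$ if this set is empty), then $$\tau_{\mathrm{adap}}(k_u,k;\xi)\asymp\frac{\nu_1}{\sqrt n}.$$
   Context: Model: one observes $n$ i.i.d. pairs $Z_i=(Y_i,X_{i\cdot})\in\mathbb R\times\mathbb R^p$, with $X_{i\cdot}\sim\mathcal N(0,\Sigma)$, $Y_i=X_{i\cdot}^\top\beta+\varepsilon_i$, $\varepsilon_i\sim\mathcal N(0,\sigma^2)$ independent of the $X$'s. Write $\theta=(\beta,\Sigma,\sigma)$, and $\mathbb E_\theta$ for expectation under the law of the data $\mathcal Z=(Z_1,\dots,Z_n)$. For fixed constants $M_1>1$, $M_2>0$, $$\Theta(k)=\{(\beta,\Sigma,\sigma):\|\beta\|_0\le k,\ 1/M_1\le\lambda_{\min}(\Sigma)\le\lambda_{\max}(\Sigma)\le M_1,\ 0<\sigma\le M_2\}.$$ For $t_0\in\mathbb R$ and $\tau>0$: $\Theta(k;\xi,t_0)=\{\theta\in\Theta(k):\xi^\top\beta=t_0\}$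 and $\Theta_{\pm\tau}(k;\xi,t_0)=\{\theta\in\Theta(k):|\xi^\top\beta-t_0|\ge\tau\}$. $\Psi_\alpha(\Theta)$ is the set of tests $\psi=\psi(\mathcal Z)\in[0,1]$ with $\sup_{\theta\in\Theta}\mathbb E_\theta\psi\le\alpha$. For fixed $\alpha,\eta\in(0,1)$ with $\alpha+\eta<1$, $$\tau_{\mathrm{adap}}(k_u,k;\xi)=\inf\Big\{\tau:\ \sup_{\psi\in\Psi_\alpha(\Theta(k_u;\xi,t_0))}\ \inf_{\theta\in\Theta_{\pm\tau}(k;\xi,t_0)}\mathbb E_\theta\psi\ge1-\eta\Big\}.$$ Loading quantities: $\xi\in\mathbb R^p$ is nonzero, ordered so that $|\xi_1|\ge\dots\ge|\xi_p|$, $k_\xi=\|\xi\|_0$. For $t>0$, $H(t;\xi)=\big(\sum_{j\le\lceil t\rceil\wedge p}\xi_j^2\big)^{1/2}$. Let $\zeta\in\mathbb R$ be the unique solution of $$\frac{\sum_{j=1}^{k_\xi}|\xi_j|\exp(-\zeta/\xi_j^2)}{\sqrt{\sum_{j=1}^{k_\xi}\xi_j^2\exp(-\zeta/\xi_j^2)}}=\frac{k_u}{2},$$ $\lambda=\sqrt{\max(\zeta,0)}$, and $\nu_1=\lambda k_u+\sqrt{\sum_{j=1}^{k_\xi}\xi_j^2\exp(-\lambda^2/\xi_j^2)}$. Asymptotics: $n,p,k_u\to\infty$ along a sequence; $M_1,M_2,\alpha,\eta,\gamma$ are fixed; $k,\xi,t_0$ may vary along the sequence. $a\lesssim b$ means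 $a\le Cb$ for a constant $C>0$ along the sequence (for all sufficiently large $n$); $a\asymp b$ means $a\lesssim b$ and $b\lesssim a$; $a\asymp_{\log}b$ means these hold up to logarithmic factors in $p$ (multiplicative factors that are powers of $\log p$). *)

theory Defs
  imports
    "HOL-Probability.Probability"
    "Jordan_Normal_Form.Gauss_Jordan_Elimination"
    "Jordan_Normal_Form.Spectral_Radius"
begin

unbundle no vec_syntax
unbundle no inner_syntax

(* Vectors and matrices whose dimension p varies along a sequence are those of
   Jordan_Normal_Form, with coordinates indexed by 0, ..., p - 1. A random covariate vector is
   a point of the product space PiM {..<p} borel; "vec p x" is the corresponding vector. *)

section \<open>The model\<close>

(* N(0, Sigma) for a positive definite p x p matrix Sigma, given by its Lebesgue density *)
definition mvn :: "nat \<Rightarrow> real mat \<Rightarrow> (nat \<Rightarrow> real) measure" where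
  "mvn p \<Sigma> = density (PiM {..<p} (\<lambda>_. lborel))
     (\<lambda>x. ennreal (exp (- (vec p x \<bullet> (the (mat_inverse \<Sigma>) *\<^sub>v vec p x)) / 2)
            / sqrt ((2 * pi) ^ p * Determinant.det \<Sigma>)))"

(* (beta, Sigma, sigma) *)
type_synonym param = "real vec \<times> real mat \<times> real"

(* A single observation is a pair (response, covariates). *)
type_synonym obs = "real \<times> (nat \<Rightarrow> real)"

definition obs_space :: "nat \<Rightarrow> obs measure" where
  "obs_space p = borel \<Otimes>\<^sub>M PiM {..<p} (\<lambda>_. borel)"

definition obs_law :: "nat \<Rightarrow> param \<Rightarrow> obs measure" where
  "obs_law p = (\<lambda>(\<beta>, \<Sigma>, \<sigma>).
     distr (mvn p \<Sigma> \<Otimes>\<^sub>M density lborel (normal_density 0 \<sigma>)) (obs_space p)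
       (\<lambda>(x, e). (vec p x \<bullet> \<beta> + e, x)))"

definition data_space :: "nat \<Rightarrow> nat \<Rightarrow> (nat \<Rightarrow> obs) measure" where
  "data_space n p = PiM {..<n} (\<lambda>_. obs_space p)"

definition data_law :: "nat \<Rightarrow> nat \<Rightarrow> param \<Rightarrow> (nat \<Rightarrow> obs) measure" where
  "data_law n p \<theta> = PiM {..<n} (\<lambda>_. obs_law p \<theta>)"

definition expect :: "nat \<Rightarrow> nat \<Rightarrow> param \<Rightarrow> ((nat \<Rightarrow> obs) \<Rightarrow> real) \<Rightarrow> real" where
  "expect n p \<theta> \<psi> = (\<integral>z. \<psi> z \<partial>data_law n p \<theta>)"

section \<open>Parameter spaces and tests\<close>

definition l0 :: "real vec \<Rightarrow> nat" where
  "l0 v = card {j. j < dim_vec v \<and> v $ j \<noteq> 0}"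

definition lambda_min :: "real mat \<Rightarrow> real" where
  "lambda_min A = Min (spectrum A)"

definition lambda_max :: "real mat \<Rightarrow> real" where
  "lambda_max A = Max (spectrum A)"

definition Theta :: "real \<Rightarrow> real \<Rightarrow> nat \<Rightarrow> nat \<Rightarrow> param set" where
  "Theta M1 M2 p k = {(\<beta>, \<Sigma>, \<sigma>).
     \<beta> \<in> carrier_vec p \<and> l0 \<beta> \<le> k \<and>
     \<Sigma> \<in> carrier_mat p p \<and> transpose_mat \<Sigma> = \<Sigma> \<and>
     1 / M1 \<le> lambda_min \<Sigma> \<and> lambda_min \<Sigma> \<le> lambda_max \<Sigma> \<and> lambda_max \<Sigma> \<le> M1 \<and>
     0 < \<sigma> \<and> \<sigma> \<le> M2}"

definition Theta_null ::
    "real \<Rightarrow> real \<Rightarrow> nat \<Rightarrow> nat \<Rightarrow> real vec \<Rightarrow> real \<Rightarrow> param set" where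
  "Theta_null M1 M2 p k \<xi> t0 = {(\<beta>, \<Sigma>, \<sigma>) \<in> Theta M1 M2 p k. \<xi> \<bullet> \<beta> = t0}"

definition Theta_alt ::
    "real \<Rightarrow> real \<Rightarrow> nat \<Rightarrow> nat \<Rightarrow> real vec \<Rightarrow> real \<Rightarrow> real \<Rightarrow> param set" where
  "Theta_alt M1 M2 p k \<xi> t0 \<tau> = {(\<beta>, \<Sigma>, \<sigma>) \<in> Theta M1 M2 p k. \<bar>\<xi> \<bullet> \<beta> - t0\<bar> \<ge> \<tau>}"

definition Tests :: "nat \<Rightarrow> nat \<Rightarrow> real \<Rightarrow> param set \<Rightarrow> ((nat \<Rightarrow> obs) \<Rightarrow> real) set" where
  "Tests n p \<alpha> S = {\<psi> \<in> borel_measurable (data_space n p).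
     (\<forall>z \<in> space (data_space n p). 0 \<le> \<psi> z \<and> \<psi> z \<le> 1) \<and>
     (SUP \<theta>\<in>S. ereal (expect n p \<theta> \<psi>)) \<le> ereal \<alpha>}"

(* Extended reals, so that the infimum over the empty set is infinite rather than arbitrary. *)
definition tau_adap ::
    "real \<Rightarrow> real \<Rightarrow> real \<Rightarrow> real \<Rightarrow> nat \<Rightarrow> nat \<Rightarrow> nat \<Rightarrow> nat \<Rightarrow> real vec \<Rightarrow> real \<Rightarrow> ereal" where
  "tau_adap M1 M2 \<alpha> \<eta> n p ku k \<xi> t0 = Inf {ereal \<tau> | \<tau>. \<tau> > 0 \<and>
     (SUP \<psi> \<in> Tests n p \<alpha> (Theta_null M1 M2 p ku \<xi> t0).
        INF \<theta> \<in> Theta_alt M1 M2 p k \<xi> t0 \<tau>. ereal (expect n p \<theta> \<psi>)) \<ge> ereal (1 - \<eta>)}"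

section \<open>Loading quantities\<close>

(* For a loading that is sorted by decreasing absolute value, the nonzero coordinates are
   those with index below l0 xi. *)

definition loading :: "nat \<Rightarrow> real vec \<Rightarrow> bool" where
  "loading p \<xi> \<longleftrightarrow> \<xi> \<in> carrier_vec p \<and> \<xi> \<noteq> 0\<^sub>v p \<and>
     (\<forall>i j. i \<le> j \<and> j < p \<longrightarrow> \<bar>\<xi> $ j\<bar> \<le> \<bar>\<xi> $ i\<bar>)"

definition H :: "real \<Rightarrow> real vec \<Rightarrow> real" where
  "H t \<xi> = sqrt (\<Sum>j < min (nat \<lceil>t\<rceil>) (dim_vec \<xi>). (\<xi> $ j)\<^sup>2)"

definition zeta :: "nat \<Rightarrow> real vec \<Rightarrow> real" where
  "zeta ku \<xi> = (THE z.
     (\<Sum>j < l0 \<xi>. \<bar>\<xi> $ j\<bar> * exp (- z / (\<xi> $ j)\<^sup>2))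
       / sqrt (\<Sum>j < l0 \<xi>. (\<xi> $ j)\<^sup>2 * exp (- z / (\<xi> $ j)\<^sup>2)) = real ku / 2)"

definition lam :: "nat \<Rightarrow> real vec \<Rightarrow> real" where
  "lam ku \<xi> = sqrt (max (zeta ku \<xi>) 0)"

definition nu1 :: "nat \<Rightarrow> real vec \<Rightarrow> real" where
  "nu1 ku \<xi> = lam ku \<xi> * real ku
     + sqrt (\<Sum>j < l0 \<xi>. (\<xi> $ j)\<^sup>2 * exp (- (lam ku \<xi>)\<^sup>2 / (\<xi> $ j)\<^sup>2))"

(* j ranges over 1, ..., p; inserting 0 gives the value 0 when no coordinate qualifies. *)
definition j1 :: "nat \<Rightarrow> real vec \<Rightarrow> nat" where
  "j1 ku \<xi> = Max (insert 0 {j \<in> {1..dim_vec \<xi>}. \<bar>\<xi> $ (j - 1)\<bar> \<ge> lam ku \<xi>})"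

section \<open>Asymptotic comparison of nonnegative sequences\<close>

definition lesssim :: "(nat \<Rightarrow> ereal) \<Rightarrow> (nat \<Rightarrow> ereal) \<Rightarrow> bool" where
  "lesssim a b \<longleftrightarrow> (\<exists>C>0::real. \<forall>\<^sub>F m in sequentially. a m \<le> ereal C * b m)"

definition same_order :: "(nat \<Rightarrow> ereal) \<Rightarrow> (nat \<Rightarrow> ereal) \<Rightarrow> bool" where
  "same_order a b \<longleftrightarrow> lesssim a b \<and> lesssim b a"

definition same_order_log :: "(nat \<Rightarrow> nat) \<Rightarrow> (nat \<Rightarrow> ereal) \<Rightarrow> (nat \<Rightarrow> ereal) \<Rightarrow> bool" where
  "same_order_log p a b \<longleftrightarrow> (\<exists>r::nat.
     lesssim a (\<lambda>m. ereal (ln (real (p m)) ^ r) * b m) \<and>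
     lesssim b (\<lambda>m. ereal (ln (real (p m)) ^ r) * a m))"

end

theory Submission
  imports Defs
begin

text \<open>With \<open>h = H (ku\<^sup>2)\<close>, \<open>tau_adap\<close> is at least of order \<open>h / sqrt n\<close> and at most of
  order \<open>H (ku\<^sup>2 ln p) / sqrt n\<close>, and \<open>nu1\<close>, \<open>h\<close> and \<open>H (ku\<^sup>2 ln p)\<close> are comparable by
  the equation for \<open>zeta\<close>: always up to logarithms, and up to constants in the dense case.

  Upper bound: the loading is split into its \<open>ku\<^sup>2 ln p\<close> largest coordinates and a remainder,
  whose entries are at most \<open>H / (ku sqrt (ln p))\<close> and which is handled by the \<open>l\<^sub>1\<close> error of a
  sparse vector. On the large coordinates one debiases with a vector \<open>u\<close>, depending on the design
  only, such that the Gram matrix maps \<open>u\<close> nearly to the loading. The test accepts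
  if some rational sparse vector close to the null hypothesis is compatible with the data; this
  needs no estimator, only the estimate that two compatible sparse vectors have close functionals.

  Lower bound: with identity covariance, a point alternative is compared with a mixture of nulls
  that perturbs one random coordinate in each of \<open>ku\<close> blocks of lengths \<open>1, 2, 3, ...\<close>.
  The second moment of the mixture likelihood ratio factorises over the blocks.\<close>

subsection \<open>Quadratic forms and Gaussian integrals\<close>

text \<open>The cutoff \<open>ku^2 ln p\<close> is a balance: the difference of two compatible
  sparse vectors has \<open>l1\<close> norm of order \<open>ku sqrt (ln p / n)\<close>, and times
  the bound on the remaining entries this is exactly \<open>H / sqrt n\<close>. Debiasing the large
  coordinates costs the same \<open>l1\<close> norm times an entrywise Gram error of order
  \<open>h sqrt (ln p / n)\<close>, in all \<open>h (ku ln p) / n\<close>; here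
  \<open>ku ln p <= C sqrt n\<close> enters. The debiasing vector depends on the whole design, so
  the noise is integrated with the design held fixed. Its choice and the decision of the test must
  be measurable: the constraints that involve the data are strict, and all searches run over
  rational vectors. In the lower bound the overlap of two prior draws enters the exponent of the
  second moment at first order, their norms only at second order, as \<open>ku^2 / n\<close>. Two
  draws agree in block \<open>b\<close> with probability \<open>1 / (b + 1)\<close>; under this cost
  the best amplitudes are proportional to \<open>(b + 1) v_b^2\<close>, by Cauchy-Schwarz. Room for
  \<open>ku (ku + 1) / 2\<close> coordinates comes from \<gamma> < 1/2.\<close>

definition ip :: "nat \<Rightarrow> (nat \<Rightarrow> real) \<Rightarrow> (nat \<Rightarrow> real) \<Rightarrow> real" where
  "ip p v w = (\<Sum>i<p. v i * w i)"

text \<open>Vectors are functions read below \<open>p\<close> only: points of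
  \<open>PiM {..<p}\<close> have this type, and induction on the dimension needs no change of
  type.\<close>

definition quad :: "nat \<Rightarrow> (nat \<Rightarrow> nat \<Rightarrow> real) \<Rightarrow> (nat \<Rightarrow> real) \<Rightarrow> real" where
  "quad p a x = (\<Sum>i<p. \<Sum>j<p. a i j * x i * x j)"

definition fmat :: "nat \<Rightarrow> (nat \<Rightarrow> nat \<Rightarrow> real) \<Rightarrow> real mat" where
  "fmat p a = mat p p (\<lambda>(i, j). a i j)"

definition posdef :: "nat \<Rightarrow> (nat \<Rightarrow> nat \<Rightarrow> real) \<Rightarrow> bool" where
  "posdef p a \<longleftrightarrow> (\<forall>i<p. \<forall>j<p. a i j = a j i) \<and> (\<forall>x. (\<exists>i<p. x i \<noteq> 0) \<longrightarrow> 0 < quad p a x)"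

text \<open>The Schur complement of the last pivot: the form left in the first \<open>p\<close>
  variables after completing the square in the variable \<open>p\<close>.\<close>

definition schur :: "nat \<Rightarrow> (nat \<Rightarrow> nat \<Rightarrow> real) \<Rightarrow> nat \<Rightarrow> nat \<Rightarrow> real" where
  "schur p a i j = a i j - a i p * a j p / a p p"

lemma posdef_pos: "posdef p a \<Longrightarrow> \<exists>i<p. x i \<noteq> 0 \<Longrightarrow> 0 < quad p a x"
  by (simp add: posdef_def)

lemma posdef_sym: "posdef p a \<Longrightarrow> i < p \<Longrightarrow> j < p \<Longrightarrow> a i j = a j i"
  by (simp add: posdef_def)

lemma fmat_carrier [simp]: "fmat p a \<in> carrier_mat p p"
  by (simp add: fmat_def)

lemma ip_commute: "ip p v w = ip p w v"
  by (simp add: ip_def mult.commute)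

lemma ip_self_nonneg: "0 \<le> ip p v v"
  by (auto simp: ip_def intro!: sum_nonneg)

lemma ip_add_left: "ip p (\<lambda>i. u i + v i) w = ip p u w + ip p v w"
  and ip_diff_left: "ip p (\<lambda>i. u i - v i) w = ip p u w - ip p v w"
  and ip_scale_left: "ip p (\<lambda>i. c * v i) w = c * ip p v w"
  and ip_add_right: "ip p w (\<lambda>i. u i + v i) = ip p w u + ip p w v"
  and ip_diff_right: "ip p w (\<lambda>i. u i - v i) = ip p w u - ip p w v"
  and ip_scale_right: "ip p w (\<lambda>i. c * v i) = c * ip p w v"
  by (simp_all add: ip_def algebra_simps sum.distrib sum_subtractf sum_distrib_left)

lemma ip_cong: "(\<And>i. i < p \<Longrightarrow> v i = v' i) \<Longrightarrow> (\<And>i. i < p \<Longrightarrow> w i = w' i) \<Longrightarrow> ip p v w = ip p v' w'"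
  by (auto simp: ip_def intro!: sum.cong)

lemma quad_rank_one: "quad p (\<lambda>i j. a i j - c * v i * v j) x = quad p a x - c * (ip p v x)\<^sup>2"
  by (simp add: quad_def ip_def algebra_simps power2_eq_square sum_distrib_left sum_subtractf
      sum_product)

text \<open>Here and below, a solution \<open>w\<close> of \<open>a w = v\<close> stands for the
  inverse applied to \<open>v\<close>; \<open>ip p v w\<close> is then the inverse form at
  \<open>v\<close>.\<close>

lemma quad_eq_ip:
  assumes "\<And>i. i < p \<Longrightarrow> (\<Sum>j<p. a i j * w j) = v i"
  shows "quad p a w = ip p v w"
proof -
  have "quad p a w = (\<Sum>i<p. w i * (\<Sum>j<p. a i j * w j))"
    by (simp add: quad_def sum_distrib_left algebra_simps)
  also have "\<dots> = ip p v w" using assms by (auto simp: ip_def intro!: sum.cong)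
  finally show ?thesis .
qed

lemma quad_minus:
  assumes "\<And>i. i < p \<Longrightarrow> (\<Sum>j<p. a i j * w j) = v i"
    and sym: "\<And>i j. i < p \<Longrightarrow> j < p \<Longrightarrow> a i j = a j i"
  shows "quad p a (\<lambda>i. x i - t * w i) = quad p a x - 2 * t * ip p v x + t\<^sup>2 * ip p v w"
proof -
  have 1: "(\<Sum>i<p. \<Sum>j<p. a i j * x i * w j) = ip p v x"
  proof -
    have "(\<Sum>i<p. \<Sum>j<p. a i j * x i * w j) = (\<Sum>i<p. x i * (\<Sum>j<p. a i j * w j))"
      by (simp add: sum_distrib_left algebra_simps)
    also have "\<dots> = ip p v x" using assms by (auto simp: ip_def intro!: sum.cong)
    finally show ?thesis .
  qed
  have 2: "(\<Sum>i<p. \<Sum>j<p. a i j * w i * x j) = ip p v x"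
    unfolding 1[symmetric] by (subst sum.swap) (auto simp: sym intro!: sum.cong)
  have "quad p a (\<lambda>i. x i - t * w i) = quad p a x - t * (\<Sum>i<p. \<Sum>j<p. a i j * x i * w j)
      - t * (\<Sum>i<p. \<Sum>j<p. a i j * w i * x j) + t\<^sup>2 * quad p a w"
    by (simp add: quad_def algebra_simps sum.distrib sum_subtractf sum_distrib_left power2_eq_square)
  then show ?thesis using 1 2 quad_eq_ip[OF assms(1)] by simp
qed

text \<open>For \<open>c > 0\<close> this is Cauchy-Schwarz in the inner product of
  \<open>a\<close>: \<open>(v . x)^2 <= quad p a x * (v . w)\<close>. For \<open>c <= 0\<close> the
  update only adds a nonnegative form.\<close>

lemma posdef_rank_one:
  assumes pd: "posdef p a" and w: "\<And>i. i < p \<Longrightarrow> (\<Sum>j<p. a i j * w j) = v i"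
    and c: "c * ip p v w < 1"
  shows "posdef p (\<lambda>i j. a i j - c * v i * v j)"
  unfolding posdef_def quad_rank_one
proof (intro conjI allI impI)
  show "a i j - c * v i * v j = a j i - c * v j * v i" if "i < p" "j < p" for i j
    using pd that by (auto simp: posdef_def)
  fix x :: "nat \<Rightarrow> real" assume x: "\<exists>i<p. x i \<noteq> 0"
  then have qx: "0 < quad p a x" using pd by (auto simp: posdef_def)
  show "0 < quad p a x - c * (ip p v x)\<^sup>2"
  proof (cases "c \<le> 0")
    case True
    then have "c * (ip p v x)\<^sup>2 \<le> 0" by (simp add: mult_nonpos_nonneg)
    then show ?thesis using qx by linarith
  next
    case False
    show ?thesis
    proof (cases "\<exists>i<p. w i \<noteq> 0")
      case True
      then have qw: "0 < ip p v w" using pd quad_eq_ip[OF w] by (auto simp: posdef_def)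
      \<comment> \<open>The minimiser of the form at \<open>x - t w\<close>, which turns
        nonnegativity there into the Cauchy-Schwarz inequality.\<close>
      define t where "t = ip p v x / ip p v w"
      have "0 \<le> quad p a (\<lambda>i. x i - t * w i)"
      proof (cases "\<exists>i<p. x i - t * w i \<noteq> 0")
        case True
        then have "0 < quad p a (\<lambda>i. x i - t * w i)"
          by (rule posdef_pos[OF pd])
        then show ?thesis by simp
      next
        case False then show ?thesis by (simp add: quad_def)
      qed
      also have "\<dots> = quad p a x - (ip p v x)\<^sup>2 / ip p v w"
      proof -
        have "quad p a (\<lambda>i. x i - t * w i) = quad p a x - 2 * t * ip p v x + t\<^sup>2 * ip p v w"
          by (rule quad_minus) (use w posdef_sym[OF pd] in auto)
        also have "\<dots> = quad p a x - (ip p v x)\<^sup>2 / ip p v w"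
          using qw by (simp add: t_def power2_eq_square)
        finally show ?thesis .
      qed
      finally have cs: "(ip p v x)\<^sup>2 \<le> quad p a x * ip p v w"
        using qw by (simp add: field_simps)
      have "c * (ip p v x)\<^sup>2 \<le> c * (quad p a x * ip p v w)"
        using False cs by (intro mult_left_mono) auto
      also have "\<dots> = (c * ip p v w) * quad p a x" by simp
      also have "\<dots> < 1 * quad p a x" using c qx by (rule mult_strict_right_mono)
      finally show ?thesis by simp
    next
      case False
      then have "v i = 0" if "i < p" for i using w[OF that] that by simp
      then show ?thesis using qx by (simp add: ip_def)
    qed
  qed
qed

section \<open>Determinants of Schur complements and rank-one updates\<close>

lemma det_one_by_one: "det (mat 1 1 f) = f (0, 0)" for f :: "nat \<times> nat \<Rightarrow> real"
  by (subst det_single) auto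

lemma det_upper_unit:
  fixes f :: "nat \<Rightarrow> nat \<Rightarrow> real"
  assumes "\<And>i j. j < i \<Longrightarrow> i < n \<Longrightarrow> f i j = 0" and "\<And>i. i < n \<Longrightarrow> f i i = 1"
  shows "det (mat n n (\<lambda>(i, j). f i j)) = 1"
proof -
  have "det (mat n n (\<lambda>(i, j). f i j)) = prod_list (diag_mat (mat n n (\<lambda>(i, j). f i j)))"
    by (rule det_upper_triangular[of _ n]) (auto simp: assms upper_triangular_def)
  also have "diag_mat (mat n n (\<lambda>(i, j). f i j)) = map (\<lambda>_. 1) [0..<n]"
    by (auto simp: diag_mat_def assms)
  also have "prod_list \<dots> = 1" by (induction n) auto
  finally show ?thesis .
qed

lemma det_lower_unit:
  fixes f :: "nat \<Rightarrow> nat \<Rightarrow> real"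
  assumes "\<And>i j. i < j \<Longrightarrow> j < n \<Longrightarrow> f i j = 0" and "\<And>i. i < n \<Longrightarrow> f i i = 1"
  shows "det (mat n n (\<lambda>(i, j). f i j)) = 1"
proof -
  have "det (mat n n (\<lambda>(i, j). f i j)) = det (transpose_mat (mat n n (\<lambda>(i, j). f i j)))"
    by (rule det_transpose[symmetric, of _ n]) simp
  also have "transpose_mat (mat n n (\<lambda>(i, j). f i j)) = mat n n (\<lambda>(i, j). f j i)"
    by (intro eq_matI) auto
  also have "det \<dots> = 1" by (rule det_upper_unit) (auto simp: assms)
  finally show ?thesis .
qed

lemma det_last_row_zero:
  fixes f :: "nat \<Rightarrow> nat \<Rightarrow> real"
  assumes "\<And>j. j < p \<Longrightarrow> f p j = 0"
  shows "det (fmat (Suc p) f) = det (fmat p f) * f p p"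
proof -
  have "fmat (Suc p) f = four_block_mat (fmat p f) (mat p 1 (\<lambda>(i, j). f i p)) (0\<^sub>m 1 p)
      (mat 1 1 (\<lambda>_. f p p))"
    unfolding fmat_def using assms by (intro eq_matI) (auto simp: less_Suc_eq)
  also have "det \<dots> = det (fmat p f) * f p p"
    by (subst det_four_block_mat_lower_left_zero[where n = p and m = 1])
      (auto simp: det_one_by_one[of "\<lambda>_. f p p", simplified])
  finally show ?thesis .
qed

lemma det_last_col_zero:
  fixes f :: "nat \<Rightarrow> nat \<Rightarrow> real"
  assumes "\<And>j. j < p \<Longrightarrow> f j p = 0"
  shows "det (fmat (Suc p) f) = det (fmat p f) * f p p"
proof -
  have "fmat (Suc p) f = four_block_mat (fmat p f) (0\<^sub>m p 1) (mat 1 p (\<lambda>(i, j). f p j)) 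
      (mat 1 1 (\<lambda>_. f p p))"
    unfolding fmat_def using assms by (intro eq_matI) (auto simp: less_Suc_eq)
  also have "det \<dots> = det (fmat p f) * f p p"
    by (subst det_four_block_mat_upper_right_zero[where n = p and m = 1])
      (auto simp: det_one_by_one[of "\<lambda>_. f p p", simplified])
  finally show ?thesis .
qed

lemma fmat_mult: "fmat p a * fmat p b = fmat p (\<lambda>i j. \<Sum>k<p. a i k * b k j)"
  by (intro eq_matI) (auto simp: fmat_def scalar_prod_def lessThan_atLeast0 intro!: sum.cong)

lemma fmat_cong: "(\<And>i j. i < p \<Longrightarrow> j < p \<Longrightarrow> a i j = b i j) \<Longrightarrow> fmat p a = fmat p b"
  by (intro eq_matI) (auto simp: fmat_def)

text \<open>One step of Gaussian elimination, written as a product: the last row of \<open>u\<close>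
  is zero up to the pivot, and \<open>w\<close> is unit lower triangular.\<close>

lemma det_schur:
  assumes sym: "\<And>i j. i < Suc p \<Longrightarrow> j < Suc p \<Longrightarrow> a i j = a j i" and d: "a p p \<noteq> 0"
  shows "det (fmat (Suc p) a) = a p p * det (fmat p (schur p a))"
proof -
  define u where "u i j = (if j = p then a i p else if i = p then 0 else schur p a i j)" for i j
  define w where "w i j = (if i = p then a j p / a p p else if i = j then 1 else 0)" for i j
  have "fmat (Suc p) a = fmat (Suc p) u * fmat (Suc p) w"
    unfolding fmat_mult
  proof (rule fmat_cong)
    fix i j assume ij: "i < Suc p" "j < Suc p"
    have "(\<Sum>k<p. u i k * w k j) = (if j = p then 0 else u i j)"
    proof -
      have "(\<Sum>k<p. u i k * w k j) = (\<Sum>k<p. if k = j then u i j else 0)"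
        by (intro sum.cong) (auto simp: w_def)
      then show ?thesis using ij by (auto simp: sum.delta)
    qed
    then show "a i j = (\<Sum>k<Suc p. u i k * w k j)"
      using ij d sym by (auto simp: u_def w_def schur_def)
  qed
  then have "det (fmat (Suc p) a) = det (fmat (Suc p) u) * det (fmat (Suc p) w)"
    by (simp add: det_mult[of _ "Suc p"])
  also have "det (fmat (Suc p) w) = 1"
    unfolding fmat_def by (rule det_lower_unit) (auto simp: w_def d)
  also have "det (fmat (Suc p) u) = det (fmat p u) * u p p"
    by (rule det_last_row_zero) (auto simp: u_def)
  also have "fmat p u = fmat p (schur p a)"
    by (rule fmat_cong) (auto simp: u_def)
  finally show ?thesis by (simp add: u_def)
qed

text \<open>Border \<open>a\<close> by the column \<open>v\<close>, the row \<open>v\<close> and the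
  corner \<open>1 / c\<close>. Eliminating with the corner leaves the updated matrix; subtracting
  from the last column the combination of columns with coefficients \<open>w\<close> leaves
  \<open>a\<close> and the corner \<open>1 / c - v . w\<close>. Both compute the same
  determinant.\<close>

lemma det_rank_one:
  assumes w: "\<And>i. i < p \<Longrightarrow> (\<Sum>j<p. a i j * w j) = v i"
    and sym: "\<And>i j. i < p \<Longrightarrow> j < p \<Longrightarrow> a i j = a j i"
  shows "det (fmat p (\<lambda>i j. a i j - c * v i * v j)) = det (fmat p a) * (1 - c * ip p v w)"
proof (cases "c = 0")
  case False
  define m where "m i j = (if i = p then (if j = p then 1 / c else v j)
    else if j = p then v i else a i j)" for i j
  have "det (fmat (Suc p) m) = m p p * det (fmat p (schur p m))"
    by (rule det_schur) (auto simp: m_def sym False)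
  also have "fmat p (schur p m) = fmat p (\<lambda>i j. a i j - c * v i * v j)"
    by (rule fmat_cong) (auto simp: schur_def m_def False)
  moreover have "m p p = 1 / c" by (simp add: m_def)
  ultimately have 1: "det (fmat (Suc p) m) = det (fmat p (\<lambda>i j. a i j - c * v i * v j)) / c"
    by simp
  define l where "l i j = (if j = p then (if i = p then 1 / c - ip p v w else 0) else m i j)" for i j
  define u where "u i j = (if i = j then 1 else if j = p then w i else 0)" for i j
  have "fmat (Suc p) m = fmat (Suc p) l * fmat (Suc p) u"
    unfolding fmat_mult
  proof (rule fmat_cong)
    fix i j assume ij: "i < Suc p" "j < Suc p"
    have "(\<Sum>k<p. l i k * u k j) = (if j = p then (\<Sum>k<p. m i k * w k) else m i j)"
    proof (cases "j = p")
      case True then show ?thesis by (auto simp: l_def u_def intro!: sum.cong)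
    next
      case False
      then have "(\<Sum>k<p. l i k * u k j) = (\<Sum>k<p. if k = j then m i j else 0)"
        by (intro sum.cong) (auto simp: u_def l_def)
      then show ?thesis using ij False by (auto simp: sum.delta)
    qed
    moreover have "(\<Sum>k<p. m i k * w k) = (if i = p then ip p v w else v i)"
    proof (cases "i = p")
      case True then show ?thesis by (auto simp: m_def ip_def intro!: sum.cong)
    next
      case False
      then have "(\<Sum>k<p. m i k * w k) = (\<Sum>k<p. a i k * w k)"
        by (auto simp: m_def intro!: sum.cong)
      then show ?thesis using w[of i] ij False by simp
    qed
    ultimately show "m i j = (\<Sum>k<Suc p. l i k * u k j)"
      using ij by (auto simp: l_def u_def m_def)
  qed
  then have "det (fmat (Suc p) m) = det (fmat (Suc p) l) * det (fmat (Suc p) u)"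
    by (simp add: det_mult[of _ "Suc p"])
  also have "det (fmat (Suc p) u) = 1"
    unfolding fmat_def by (rule det_upper_unit) (auto simp: u_def)
  also have "det (fmat (Suc p) l) = det (fmat p l) * l p p"
    by (rule det_last_col_zero) (auto simp: l_def)
  also have "fmat p l = fmat p a"
    by (rule fmat_cong) (auto simp: l_def m_def)
  finally have 2: "det (fmat (Suc p) m) = det (fmat p a) * (1 / c - ip p v w)" by (simp add: l_def)
  show ?thesis using 1 2 False by (simp add: field_simps)
qed simp

section \<open>Gaussian integrals by completing the square\<close>

lemma quad_Suc:
  assumes sym: "\<And>i j. i < Suc p \<Longrightarrow> j < Suc p \<Longrightarrow> a i j = a j i" and d: "a p p \<noteq> 0"
  shows "quad (Suc p) a x = quad p (schur p a) x + a p p * (x p + ip p (\<lambda>i. a i p) x / a p p)\<^sup>2"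
proof -
  have "quad p (schur p a) x = quad p a x - (ip p (\<lambda>i. a i p) x)\<^sup>2 / a p p"
    using quad_rank_one[of p a "1 / a p p" "\<lambda>i. a i p" x]
    by (simp add: quad_def schur_def)
  moreover have "(\<Sum>i<p. a i p * x i * x p) = x p * ip p (\<lambda>i. a i p) x"
    by (simp add: ip_def sum_distrib_left algebra_simps)
  moreover have "(\<Sum>i<p. a p i * x p * x i) = x p * ip p (\<lambda>i. a i p) x"
    using sym by (auto simp: ip_def sum_distrib_left algebra_simps intro!: sum.cong)
  moreover have "quad (Suc p) a x = quad p a x + (\<Sum>i<p. a i p * x i * x p)
      + (\<Sum>i<p. a p i * x p * x i) + a p p * (x p)\<^sup>2"
    by (simp add: quad_def sum.distrib power2_eq_square)
  moreover have "a p p * (x p + y / a p p)\<^sup>2 = a p p * (x p)\<^sup>2 + 2 * x p * y + y\<^sup>2 / a p p" for y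
    using d by (simp add: power2_eq_square field_simps)
  ultimately show ?thesis by simp
qed

lemma posdef_schur:
  assumes pd: "posdef (Suc p) a"
  shows "0 < a p p" "posdef p (schur p a)"
proof -
  have sym: "\<And>i j. i < Suc p \<Longrightarrow> j < Suc p \<Longrightarrow> a i j = a j i"
    using pd by (auto simp: posdef_def)
  define e where "e i = (if i = p then 1 else 0 :: real)" for i
  have "0 < quad (Suc p) a e" using pd by (auto simp: posdef_def e_def)
  also have "quad (Suc p) a e = a p p" by (simp add: quad_def e_def)
  finally show d: "0 < a p p" .
  show "posdef p (schur p a)" unfolding posdef_def
  proof (intro conjI allI impI)
    show "schur p a i j = schur p a j i" if "i < p" "j < p" for i j
      using sym that by (auto simp: schur_def)
    fix x :: "nat \<Rightarrow> real" assume "\<exists>i<p. x i \<noteq> 0"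
    \<comment> \<open>The last coordinate minimises the form in that variable, so the square in
      \<open>quad_Suc\<close> vanishes and only the Schur form of \<open>x\<close> is left.\<close>
    define y where "y = x(p := - ip p (\<lambda>i. a i p) x / a p p)"
    have "0 < quad (Suc p) a y"
    proof (rule posdef_pos[OF pd])
      show "\<exists>i<Suc p. y i \<noteq> 0"
      proof -
        obtain i where "i < p" "x i \<noteq> 0" using \<open>\<exists>i<p. x i \<noteq> 0\<close> by auto
        then show ?thesis by (intro exI[of _ i]) (auto simp: y_def)
      qed
    qed
    also have "\<dots> = quad p (schur p a) y + a p p * (y p + ip p (\<lambda>i. a i p) y / a p p)\<^sup>2"
      using sym d by (intro quad_Suc) auto
    also have "ip p (\<lambda>i. a i p) y = ip p (\<lambda>i. a i p) x" by (auto simp: ip_def y_def intro!: sum.cong)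
    also have "quad p (schur p a) y = quad p (schur p a) x"
      by (auto simp: quad_def y_def intro!: sum.cong)
    finally show "0 < quad p (schur p a) x" by (simp add: y_def)
  qed
qed

lemma nn_integral_gaussian_shift:
  assumes d: "0 < d"
  shows "(\<integral>\<^sup>+ y. ennreal (exp (- (d * (y + s)\<^sup>2) / 2)) \<partial>lborel) = ennreal (sqrt (2 * pi / d))"
proof -
  have "(\<integral>\<^sup>+ y. ennreal (exp (- (d * (y + s)\<^sup>2) / 2)) \<partial>lborel)
      = (\<integral>\<^sup>+ y. ennreal (sqrt (2 * pi / d)) * ennreal (normal_density (-s) (1 / sqrt d) y) \<partial>lborel)"
    using d by (intro nn_integral_cong)
      (simp add: normal_density_def ennreal_mult[symmetric] power_divide field_simps real_sqrt_divide)
  also have "\<dots> = ennreal (sqrt (2 * pi / d)) * (\<integral>\<^sup>+ y. ennreal (normal_density (-s) (1 / sqrt d) y) \<partial>lborel)"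
    by (rule nn_integral_cmult) simp
  also have "(\<integral>\<^sup>+ y. ennreal (normal_density (-s) (1 / sqrt d) y) \<partial>lborel) = 1"
    using d by (simp add: nn_integral_eq_integral normal_density_nonneg)
  finally show ?thesis by simp
qed

lemma ip_measurable [measurable]:
  assumes "\<And>i. i < p \<Longrightarrow> sets (M i) = sets borel"
  shows "ip p v \<in> borel_measurable (PiM {..<p} M)"
  unfolding ip_def
proof (intro borel_measurable_sum borel_measurable_times borel_measurable_const)
  fix i assume "i \<in> {..<p}"
  then show "(\<lambda>x. x i) \<in> borel_measurable (PiM {..<p} M)"
    using measurable_component_singleton[of i "{..<p}" M] assms[of i]
    by (subst measurable_cong_sets[OF refl, of _ "M i"]) auto
qed

lemma quad_measurable [measurable]:
  assumes "\<And>i. i < p \<Longrightarrow> sets (M i) = sets borel"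
  shows "quad p a \<in> borel_measurable (PiM {..<p} M)"
proof -
  have "quad p a = (\<lambda>x. \<Sum>i<p. x i * ip p (a i) x)"
    by (auto simp: quad_def ip_def sum_distrib_left algebra_simps)
  moreover have "(\<lambda>x. x i) \<in> borel_measurable (PiM {..<p} M)" if "i < p" for i
    using measurable_component_singleton[of i "{..<p}" M] assms[of i] that
    by (subst measurable_cong_sets[OF refl, of _ "M i"]) auto
  ultimately show ?thesis
    by (auto intro!: borel_measurable_sum borel_measurable_times ip_measurable assms)
qed

text \<open>Integrating out the last variable gives \<open>sqrt (2 pi / a p p)\<close> and leaves
  the Schur form; \<open>det_schur\<close> is the same recursion for the determinant. Positivity of
  the determinant comes from the same induction, since all pivots are positive.\<close>

theorem gaussian_integral:
  assumes "posdef p a"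
  shows "(\<integral>\<^sup>+ x. ennreal (exp (- quad p a x / 2)) \<partial>PiM {..<p} (\<lambda>_. lborel))
      = ennreal (sqrt ((2 * pi) ^ p / det (fmat p a)))"
    and "0 < det (fmat p a)"
proof -
  interpret product_sigma_finite "\<lambda>_::nat. lborel :: real measure" ..
  have "(\<integral>\<^sup>+ x. ennreal (exp (- quad p a x / 2)) \<partial>PiM {..<p} (\<lambda>_. lborel))
      = ennreal (sqrt ((2 * pi) ^ p / det (fmat p a))) \<and> 0 < det (fmat p a)"
    using assms
  proof (induction p arbitrary: a)
    case 0
    have "fmat 0 a = 1\<^sub>m 0" by (intro eq_matI) (auto simp: fmat_def)
    then show ?case by (simp add: quad_def PiM_empty nn_integral_count_space_finite)
  next
    case (Suc p)
    note sc = posdef_schur[OF Suc.prems]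
    have sym: "\<And>i j. i < Suc p \<Longrightarrow> j < Suc p \<Longrightarrow> a i j = a j i"
      using Suc.prems by (auto simp: posdef_def)
    have det: "det (fmat (Suc p) a) = a p p * det (fmat p (schur p a))"
      using sc by (intro det_schur sym) auto
    let ?b = "\<lambda>i. a i p"
    have "(\<integral>\<^sup>+ x. ennreal (exp (- quad (Suc p) a x / 2)) \<partial>PiM {..<Suc p} (\<lambda>_. lborel))
      = (\<integral>\<^sup>+ x. (\<integral>\<^sup>+ y. ennreal (exp (- quad (Suc p) a (x(p := y)) / 2)) \<partial>lborel)
          \<partial>PiM {..<p} (\<lambda>_. lborel))"
      unfolding lessThan_Suc
      by (rule product_nn_integral_insert) (auto simp: lessThan_Suc[symmetric] intro!: measurable_compose[OF _ measurable_ennreal] borel_measurable_exp borel_measurable_divide borel_measurable_uminus quad_measurable)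
    also have "\<dots> = (\<integral>\<^sup>+ x. ennreal (exp (- quad p (schur p a) x / 2)) * ennreal (sqrt (2 * pi / a p p))
          \<partial>PiM {..<p} (\<lambda>_. lborel))"
    proof (rule nn_integral_cong)
      fix x :: "nat \<Rightarrow> real"
      have "(\<integral>\<^sup>+ y. ennreal (exp (- quad (Suc p) a (x(p := y)) / 2)) \<partial>lborel)
        = (\<integral>\<^sup>+ y. ennreal (exp (- quad p (schur p a) x / 2)) *
            ennreal (exp (- (a p p * (y + ip p ?b x / a p p)\<^sup>2) / 2)) \<partial>lborel)"
      proof (rule nn_integral_cong)
        fix y :: real
        define z where "z = x(p := y)"
        have z: "z p = y" "quad p (schur p a) z = quad p (schur p a) x" "ip p ?b z = ip p ?b x"
          by (auto simp: quad_def ip_def z_def intro!: sum.cong)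
        have "quad (Suc p) a z = quad p (schur p a) z + a p p * (z p + ip p ?b z / a p p)\<^sup>2"
          by (rule quad_Suc[OF sym]) (use sc in auto)
        then have "quad (Suc p) a (x(p := y)) = quad p (schur p a) x + a p p * (y + ip p ?b x / a p p)\<^sup>2"
          unfolding z by (simp add: z_def)
        then show "ennreal (exp (- quad (Suc p) a (x(p := y)) / 2)) =
            ennreal (exp (- quad p (schur p a) x / 2)) *
            ennreal (exp (- (a p p * (y + ip p ?b x / a p p)\<^sup>2) / 2))"
          by (simp add: ennreal_mult[symmetric] exp_add[symmetric] field_simps)
      qed
      also have "\<dots> = ennreal (exp (- quad p (schur p a) x / 2)) * ennreal (sqrt (2 * pi / a p p))"
        using sc by (subst nn_integral_cmult) (simp_all only: nn_integral_gaussian_shift, measurable)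
      finally show "(\<integral>\<^sup>+ y. ennreal (exp (- quad (Suc p) a (x(p := y)) / 2)) \<partial>lborel) = \<dots>" .
    qed
    also have "\<dots> = ennreal (sqrt ((2 * pi) ^ p / det (fmat p (schur p a)))) * ennreal (sqrt (2 * pi / a p p))"
      using Suc.IH[OF sc(2)] by (subst nn_integral_multc) auto
    also have "\<dots> = ennreal (sqrt ((2 * pi) ^ Suc p / det (fmat (Suc p) a)))"
      using Suc.IH[OF sc(2)] sc(1)
      by (simp add: ennreal_mult[symmetric] real_sqrt_mult[symmetric] det mult.commute)
    finally show ?case using det sc Suc.IH[OF sc(2)] by simp
  qed
  then show "(\<integral>\<^sup>+ x. ennreal (exp (- quad p a x / 2)) \<partial>PiM {..<p} (\<lambda>_. lborel))
      = ennreal (sqrt ((2 * pi) ^ p / det (fmat p a)))" "0 < det (fmat p a)" by auto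
qed

subsection \<open>The covariance matrix and the normal law\<close>

abbreviation entries :: "real mat \<Rightarrow> nat \<Rightarrow> nat \<Rightarrow> real" where
  "entries A \<equiv> \<lambda>i j. A $$ (i, j)"

lemma fmat_entries: "A \<in> carrier_mat p p \<Longrightarrow> fmat p (entries A) = A"
  by (intro eq_matI) (auto simp: fmat_def)

lemma abs_prod_le_ip:
  assumes "i < p" "j < p" shows "\<bar>x i * x j\<bar> \<le> ip p x x"
proof -
  have "x k * x k \<le> ip p x x" if "k < p" for k
    unfolding ip_def using that by (intro member_le_sum) auto
  from this[of i] this[of j] assms have "x i * x i + x j * x j \<le> 2 * ip p x x" by simp
  moreover have "0 \<le> (\<bar>x i\<bar> - \<bar>x j\<bar>)\<^sup>2" by simp
  then have "2 * (\<bar>x i\<bar> * \<bar>x j\<bar>) \<le> x i * x i + x j * x j"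
    by (simp add: power2_diff power2_eq_square algebra_simps flip: abs_mult)
  ultimately show ?thesis by (simp add: abs_mult)
qed

lemma abs_quad_le: "\<bar>quad p a x\<bar> \<le> (\<Sum>i<p. \<Sum>j<p. \<bar>a i j\<bar>) * ip p x x"
proof -
  have "\<bar>quad p a x\<bar> \<le> (\<Sum>i<p. \<Sum>j<p. \<bar>a i j * x i * x j\<bar>)"
    unfolding quad_def by (rule order_trans[OF sum_abs]) (intro sum_mono sum_abs)
  also have "\<dots> \<le> (\<Sum>i<p. \<Sum>j<p. \<bar>a i j\<bar> * ip p x x)"
  proof (intro sum_mono)
    fix i j assume "i \<in> {..<p}" "j \<in> {..<p}"
    then have "\<bar>a i j\<bar> * \<bar>x i * x j\<bar> \<le> \<bar>a i j\<bar> * ip p x x"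
      by (intro mult_left_mono abs_prod_le_ip) auto
    then show "\<bar>a i j * x i * x j\<bar> \<le> \<bar>a i j\<bar> * ip p x x" by (simp add: abs_mult mult.assoc)
  qed
  finally show ?thesis by (simp add: sum_distrib_right)
qed

lemma ip_self_eq_0: "ip p x x = 0 \<Longrightarrow> i < p \<Longrightarrow> x i = 0"
  using abs_prod_le_ip[of i p i x] by (auto simp: mult_le_0_iff)

lemma quad_diag: "quad p (\<lambda>i j. a i j - (if i = j then c else 0)) x = quad p a x - c * ip p x x"
proof -
  have "quad p (\<lambda>i j. a i j - (if i = j then c else 0)) x
      = (\<Sum>i<p. \<Sum>j<p. a i j * x i * x j - (if i = j then c * x i * x j else 0))"
    unfolding quad_def by (intro sum.cong) (auto simp: algebra_simps)
  also have "\<dots> = quad p a x - (\<Sum>i<p. \<Sum>j<p. if i = j then c * x i * x j else 0)"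
    by (simp add: quad_def sum_subtractf)
  also have "(\<Sum>i<p. \<Sum>j<p. if i = j then c * x i * x j else 0) = c * ip p x x"
    by (simp add: ip_def sum_distrib_left mult.assoc)
  finally show ?thesis .
qed

lemma nonsingular_solve:
  assumes det: "det (fmat p b) \<noteq> 0"
  obtains d where "\<And>x i. i < p \<Longrightarrow> (\<Sum>j<p. b i j * (\<Sum>k<p. d j k * x k)) = x i"
proof -
  obtain D where D: "D \<in> carrier_mat p p" "fmat p b * D = 1\<^sub>m p"
    using det_non_zero_imp_unit[OF fmat_carrier det, of "()"]
    by (auto simp: Units_def ring_mat_simps)
  show ?thesis
  proof
    fix x :: "nat \<Rightarrow> real" and i assume i: "i < p"
    have e: "(\<Sum>j<p. b i j * D $$ (j, k)) = (if i = k then 1 else 0)" if "k < p" for k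
    proof -
      have "(fmat p b * D) $$ (i, k) = (\<Sum>j<p. b i j * D $$ (j, k))"
        using i that D(1) by (auto simp: fmat_def scalar_prod_def lessThan_atLeast0 intro!: sum.cong)
      then show ?thesis using D(2) i that by simp
    qed
    have "(\<Sum>j<p. b i j * (\<Sum>k<p. D $$ (j, k) * x k)) = (\<Sum>k<p. (\<Sum>j<p. b i j * D $$ (j, k)) * x k)"
      unfolding sum_distrib_left sum_distrib_right by (subst sum.swap) (simp add: mult.assoc)
    also have "\<dots> = (\<Sum>k<p. if i = k then x k else 0)"
      by (intro sum.cong) (auto simp: e)
    finally show "(\<Sum>j<p. b i j * (\<Sum>k<p. D $$ (j, k) * x k)) = x i" using i by simp
  qed
qed

text \<open>The largest \<open>c\<close> with \<open>A - c I\<close> positive semidefinite is an eigenvalue: a nonsingular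
  positive semidefinite matrix dominates a positive multiple of the identity.\<close>

lemma spectrum_le_quad:
  assumes A: "A \<in> carrier_mat p p" and sym: "transpose_mat A = A" and p: "0 < p"
  obtains k where "k \<in> spectrum A" "\<And>x. k * ip p x x \<le> quad p (entries A) x"
proof -
  let ?a = "entries A"
  have asym: "A $$ (i, j) = A $$ (j, i)" if "i < p" "j < p" for i j
    using arg_cong[OF sym, of "\<lambda>M. M $$ (j, i)"] A that by auto
  define C where "C = {c. \<forall>x. c * ip p x x \<le> quad p ?a x}"
  have low: "- (\<Sum>i<p. \<Sum>j<p. \<bar>?a i j\<bar>) \<in> C"
    unfolding C_def
  proof (rule CollectI, rule allI)
    fix x show "- (\<Sum>i<p. \<Sum>j<p. \<bar>?a i j\<bar>) * ip p x x \<le> quad p ?a x"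
      using abs_quad_le[of p ?a x] by linarith
  qed
  define e where "e i = (if i = 0 then 1 else 0 :: real)" for i :: nat
  have "ip p e e = 1" using p by (simp add: ip_def e_def sum.delta if_distrib cong: if_cong)
  then have "c \<le> quad p ?a e" if "c \<in> C" for c
    using that unfolding C_def by (metis (mono_tags, lifting) mem_Collect_eq mult.right_neutral)
  then have bdd: "bdd_above C" by (auto simp: bdd_above_def)
  define c0 where "c0 = Sup C"
  have c0: "c0 * ip p x x \<le> quad p ?a x" for x
  proof (cases "ip p x x = 0")
    case True
    then have "0 \<le> quad p ?a x" using low unfolding C_def mem_Collect_eq by (metis True mult_zero_right)
    then show ?thesis using True by simp
  next
    case False
    then have pos: "0 < ip p x x" using ip_self_nonneg[of p x] by simp
    have "c0 \<le> quad p ?a x / ip p x x"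
      unfolding c0_def
    proof (rule cSup_least)
      show "C \<noteq> {}" using low by blast
      show "c \<le> quad p ?a x / ip p x x" if "c \<in> C" for c
        using that pos by (simp add: C_def pos_le_divide_eq)
    qed
    then show ?thesis using pos by (simp add: field_simps)
  qed
  have "eigenvalue A c0"
  proof (rule ccontr)
    assume "\<not> eigenvalue A c0"
    define b where "b i j = ?a i j - (if i = j then c0 else 0)" for i j
    have "char_matrix A c0 = fmat p b"
      using A unfolding char_matrix_def by (intro eq_matI) (auto simp: fmat_def b_def)
    with \<open>\<not> eigenvalue A c0\<close> have "det (fmat p b) \<noteq> 0" using eigenvalue_det[OF A] by simp
    then obtain d where d: "\<And>x i. i < p \<Longrightarrow> (\<Sum>j<p. b i j * (\<Sum>k<p. d j k * x k)) = x i"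
      by (rule nonsingular_solve) blast
    \<comment> \<open>Exceeds the sum of the absolute entries of the inverse, hence bounds its
      quadratic form on unit vectors; the \<open>1\<close> keeps it positive.\<close>
    define K where "K = (\<Sum>i<p. \<Sum>j<p. \<bar>d i j\<bar>) + 1"
    have K: "0 < K" unfolding K_def by (intro add_nonneg_pos sum_nonneg) auto
    have qb: "quad p b x = quad p ?a x - c0 * ip p x x" for x
      unfolding b_def by (rule quad_diag)
    have "c0 + 1 / K \<in> C"
      unfolding C_def
    proof (rule CollectI, rule allI)
      fix x
      define w where "w j = (\<Sum>k<p. d j k * x k)" for j
      have "ip p x w = quad p d x"
        by (simp add: ip_def w_def quad_def sum_distrib_left algebra_simps)
      also have "\<dots> \<le> K * ip p x x"
        using abs_quad_le[of p d x] ip_self_nonneg[of p x] by (simp add: K_def algebra_simps)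
      finally have xw: "ip p x w \<le> K * ip p x x" .
      \<comment> \<open>Testing semidefiniteness at \<open>x - w / K\<close>, where
        \<open>b w = x\<close>, yields \<open>quad p b x >= |x|^2 / K\<close>, so \<open>c0\<close>
        could be raised by \<open>1 / K\<close>.\<close>
      have "0 \<le> quad p b (\<lambda>i. x i - (1 / K) * w i)" using c0 qb by simp
      also have "\<dots> = quad p b x - 2 * (1 / K) * ip p x x + (1 / K)\<^sup>2 * ip p x w"
      proof (rule quad_minus)
        show "(\<Sum>j<p. b i j * w j) = x i" if "i < p" for i unfolding w_def by (rule d[OF that])
        show "b i j = b j i" if "i < p" "j < p" for i j using asym that by (simp add: b_def)
      qed
      also have "\<dots> \<le> quad p b x - 2 * (1 / K) * ip p x x + (1 / K)\<^sup>2 * (K * ip p x x)"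
        using xw by (intro add_left_mono mult_left_mono) auto
      also have "\<dots> = quad p b x - ip p x x / K" using K by (simp add: power2_eq_square)
      finally show "(c0 + 1 / K) * ip p x x \<le> quad p ?a x" using qb[of x] by (simp add: algebra_simps)
    qed
    then have "c0 + 1 / K \<le> c0" unfolding c0_def using bdd by (intro cSup_upper) auto
    then show False using K by simp
  qed
  then show ?thesis using that[of c0] c0 by (auto simp: spectrum_def)
qed

text \<open>The lower bound for \<open>- A\<close>, whose eigenvalues are the negatives of those of
  \<open>A\<close>.\<close>

lemma quad_le_spectrum:
  assumes A: "A \<in> carrier_mat p p" and sym: "transpose_mat A = A" and p: "0 < p"
  obtains k where "k \<in> spectrum A" "\<And>x. quad p (entries A) x \<le> k * ip p x x"
proof -
  have "- A \<in> carrier_mat p p" using A by simp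
  moreover have "transpose_mat (- A) = - A"
    using sym A by (metis transpose_uminus)
  ultimately obtain k where k: "k \<in> spectrum (- A)" "\<And>x. k * ip p x x \<le> quad p (entries (- A)) x"
    using p by (rule spectrum_le_quad) blast
  have "quad p (entries (- A)) x = - quad p (entries A) x" for x
    using A unfolding quad_def sum_negf[symmetric] by (intro sum.cong) auto
  then have 2: "quad p (entries A) x \<le> (- k) * ip p x x" for x
    using k(2)[of x] by simp
  from k(1) obtain v where v: "v \<in> carrier_vec p" "v \<noteq> 0\<^sub>v p" "(- A) *\<^sub>v v = k \<cdot>\<^sub>v v"
    using A by (auto simp: spectrum_def eigenvalue_def eigenvector_def)
  have "A *\<^sub>v v = - ((- A) *\<^sub>v v)" using A v(1) by auto
  also have "\<dots> = (- k) \<cdot>\<^sub>v v" using v by auto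
  finally have "- k \<in> spectrum A"
    using A v by (auto simp: spectrum_def eigenvalue_def eigenvector_def)
  then show ?thesis using 2 that by blast
qed

text \<open>All that the upper bound keeps of the spectral conditions in \<open>Theta\<close>. The
  lower eigenvalue bound is multiplied out, so one constant serves on both sides.\<close>

definition cov_bounds :: "real \<Rightarrow> nat \<Rightarrow> real mat \<Rightarrow> bool" where
  "cov_bounds M p \<Sigma> \<longleftrightarrow> \<Sigma> \<in> carrier_mat p p \<and> (\<forall>i<p. \<forall>j<p. \<Sigma> $$ (i, j) = \<Sigma> $$ (j, i)) \<and>
    (\<forall>x. ip p x x \<le> M * quad p (entries \<Sigma>) x \<and> quad p (entries \<Sigma>) x \<le> M * ip p x x)"

lemma Theta_cov_bounds:
  assumes "(\<beta>, \<Sigma>, \<sigma>) \<in> Theta M1 M2 p k" and "0 < p" "1 < M1"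
  shows "cov_bounds M1 p \<Sigma>"
proof -
  have A: "\<Sigma> \<in> carrier_mat p p" "transpose_mat \<Sigma> = \<Sigma>" "1 / M1 \<le> Min (spectrum \<Sigma>)" "Max (spectrum \<Sigma>) \<le> M1"
    using assms by (auto simp: Theta_def lambda_min_def lambda_max_def)
  have fin: "finite (spectrum \<Sigma>)" by (rule card_finite_spectrum[OF A(1)])
  obtain k where k: "k \<in> spectrum \<Sigma>" "\<And>x. k * ip p x x \<le> quad p (entries \<Sigma>) x"
    using spectrum_le_quad[OF A(1,2) assms(2)] by blast
  obtain l where l: "l \<in> spectrum \<Sigma>" "\<And>x. quad p (entries \<Sigma>) x \<le> l * ip p x x"
    using quad_le_spectrum[OF A(1,2) assms(2)] by blast
  have "1 / M1 \<le> k" using A(3) Min_le[OF fin k(1)] by simp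
  moreover have "l \<le> M1" using A(4) Max_ge[OF fin l(1)] by simp
  ultimately have "ip p x x \<le> M1 * quad p (entries \<Sigma>) x \<and> quad p (entries \<Sigma>) x \<le> M1 * ip p x x" for x
  proof -
    have "1 / M1 * ip p x x \<le> k * ip p x x"
      using \<open>1 / M1 \<le> k\<close> ip_self_nonneg by (rule mult_right_mono)
    also have "\<dots> \<le> quad p (entries \<Sigma>) x" by (rule k)
    finally have "ip p x x \<le> M1 * quad p (entries \<Sigma>) x" using assms by (simp add: field_simps)
    moreover have "l * ip p x x \<le> M1 * ip p x x"
      using \<open>l \<le> M1\<close> ip_self_nonneg by (rule mult_right_mono)
    ultimately show ?thesis using l(2)[of x] by linarith
  qed
  moreover have "\<Sigma> $$ (i, j) = \<Sigma> $$ (j, i)" if "i < p" "j < p" for i j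
    using arg_cong[OF A(2), of "\<lambda>M. M $$ (j, i)"] A(1) that by auto
  ultimately show ?thesis using A by (auto simp: cov_bounds_def)
qed

lemma cov_bounds_posdef:
  assumes "cov_bounds M p \<Sigma>" "1 < M"
  shows "posdef p (entries \<Sigma>)"
  unfolding posdef_def
proof (intro conjI allI impI)
  show "\<Sigma> $$ (i, j) = \<Sigma> $$ (j, i)" if "i < p" "j < p" for i j
    using that assms by (auto simp: cov_bounds_def)
  fix x :: "nat \<Rightarrow> real" assume "\<exists>i<p. x i \<noteq> 0"
  then have "0 < ip p x x" using ip_self_eq_0[of p x] ip_self_nonneg[of p x] by force
  also have "\<dots> \<le> M * quad p (entries \<Sigma>) x" using assms by (auto simp: cov_bounds_def)
  finally show "0 < quad p (entries \<Sigma>) x" using assms(2) by (simp add: zero_less_mult_iff)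
qed

lemma posdef_mat_inverse:
  assumes S: "\<Sigma> \<in> carrier_mat p p" and pd: "posdef p (entries \<Sigma>)"
  obtains P where "mat_inverse \<Sigma> = Some P" "P \<in> carrier_mat p p" "posdef p (entries P)"
    "det P * det \<Sigma> = 1"
    "\<forall>v. \<forall>i<p. (\<Sum>j<p. P $$ (i, j) * (\<Sum>k<p. \<Sigma> $$ (j, k) * v k)) = v i"
proof -
  have d: "det \<Sigma> > 0" using gaussian_integral(2)[OF pd] fmat_entries[OF S] by simp
  obtain P where P: "mat_inverse \<Sigma> = Some P"
    using mat_inverse(1)[OF S, of "()"] det_non_zero_imp_unit[OF S, of "()"] d
    by (cases "mat_inverse \<Sigma>") auto
  then have PS: "\<Sigma> * P = 1\<^sub>m p" "P * \<Sigma> = 1\<^sub>m p" and Pc: "P \<in> carrier_mat p p"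
    using mat_inverse(2)[OF S P] by auto
  have 1: "(\<Sum>j<p. A $$ (i, j) * (\<Sum>k<p. B $$ (j, k) * v k)) = v i"
    if AB: "A * B = 1\<^sub>m p" "A \<in> carrier_mat p p" "B \<in> carrier_mat p p" and i: "i < p"
    for A B :: "real mat" and v i
  proof -
    have e: "(\<Sum>j<p. A $$ (i, j) * B $$ (j, k)) = (if i = k then 1 else 0)" if "k < p" for k
    proof -
      have "(A * B) $$ (i, k) = (\<Sum>j<p. A $$ (i, j) * B $$ (j, k))"
        using i that AB(2,3) by (auto simp: scalar_prod_def lessThan_atLeast0 intro!: sum.cong)
      then show ?thesis unfolding AB(1) using i that by simp
    qed
    have "(\<Sum>j<p. A $$ (i, j) * (\<Sum>k<p. B $$ (j, k) * v k))
        = (\<Sum>k<p. (\<Sum>j<p. A $$ (i, j) * B $$ (j, k)) * v k)"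
      unfolding sum_distrib_left sum_distrib_right by (subst sum.swap) (simp add: mult.assoc)
    also have "\<dots> = (\<Sum>k<p. if i = k then v k else 0)"
      by (intro sum.cong) (auto simp: e)
    finally show ?thesis using i by simp
  qed
  have "transpose_mat \<Sigma> = \<Sigma>"
    using S posdef_sym[OF pd] by (intro eq_matI) auto
  have "transpose_mat P = transpose_mat P * (\<Sigma> * P)" using Pc PS by simp
  also have "\<dots> = (transpose_mat P * \<Sigma>) * P"
    using Pc S by (simp add: assoc_mult_mat[of _ p p _ p _ p])
  also have "transpose_mat P * \<Sigma> = transpose_mat (\<Sigma> * P)"
    using Pc S \<open>transpose_mat \<Sigma> = \<Sigma>\<close> transpose_mult[OF S Pc] by simp
  also have "\<dots> = 1\<^sub>m p" using PS by simp
  finally have tP: "transpose_mat P = P" using Pc by simp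
  have Psym: "P $$ (i, j) = P $$ (j, i)" if "i < p" "j < p" for i j
    using arg_cong[OF tP, of "\<lambda>M. M $$ (j, i)"] Pc that by auto
  have "posdef p (entries P)"
    unfolding posdef_def
  proof (intro conjI allI impI Psym)
    fix x :: "nat \<Rightarrow> real" assume x: "\<exists>i<p. x i \<noteq> 0"
    define w where "w j = (\<Sum>k<p. P $$ (j, k) * x k)" for j
    have Sw: "(\<Sum>j<p. \<Sigma> $$ (i, j) * w j) = x i" if "i < p" for i
      unfolding w_def by (rule 1[OF PS(1) S Pc that])
    have "\<exists>i<p. w i \<noteq> 0"
    proof (rule ccontr)
      assume "\<not> (\<exists>i<p. w i \<noteq> 0)"
      then have "x i = 0" if "i < p" for i using Sw[OF that] by simp
      then show False using x by auto
    qed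
    then have "0 < quad p (entries \<Sigma>) w" by (rule posdef_pos[OF pd])
    also have "\<dots> = ip p x w" by (rule quad_eq_ip) (rule Sw)
    also have "\<dots> = quad p (entries P) x"
      by (simp add: ip_def w_def quad_def sum_distrib_left algebra_simps)
    finally show "0 < quad p (entries P) x" .
  qed
  moreover have "det P * det \<Sigma> = 1" using det_mult[OF Pc S] PS by simp
  ultimately show ?thesis using that[OF P Pc] 1[OF PS(2) Pc S] by blast
qed

section \<open>Exponential moments under the normal law\<close>

lemma vec_scalar_prod: "v \<in> carrier_vec p \<Longrightarrow> vec p x \<bullet> v = ip p x (\<lambda>j. v $ j)"
  by (auto simp: scalar_prod_def ip_def lessThan_atLeast0 intro!: sum.cong)

lemma vec_quad: "P \<in> carrier_mat p p \<Longrightarrow> vec p x \<bullet> (P *\<^sub>v vec p x) = quad p (entries P) x"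
  by (auto simp: scalar_prod_def quad_def lessThan_atLeast0 mult_mat_vec_def row_def
      sum_distrib_left algebra_simps intro!: sum.cong)

lemma mvn_eq_density:
  assumes S: "\<Sigma> \<in> carrier_mat p p" and pd: "posdef p (entries \<Sigma>)"
    and P: "mat_inverse \<Sigma> = Some P" "P \<in> carrier_mat p p"
  shows "mvn p \<Sigma> = density (PiM {..<p} (\<lambda>_. lborel))
     (\<lambda>x. ennreal (exp (- quad p (entries P) x / 2) / sqrt ((2 * pi) ^ p * det \<Sigma>)))"
  unfolding mvn_def P option.sel vec_quad[OF P(2)] ..

lemma sets_mvn [measurable_cong, simp]: "sets (mvn p \<Sigma>) = sets (PiM {..<p} (\<lambda>_. borel))"
  by (auto simp: mvn_def intro!: sets_PiM_cong)

lemma space_mvn: "space (mvn p \<Sigma>) = space (PiM {..<p} (\<lambda>_. borel :: real measure))"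
  by (rule sets_eq_imp_space_eq) simp

text \<open>Multiplying the normal density by the exponential of a quadratic form replaces the
  precision matrix \<open>P\<close> by \<open>q\<close>; the value is a ratio of two normalising
  constants.\<close>

lemma nn_integral_mvn:
  assumes S: "\<Sigma> \<in> carrier_mat p p" and pd: "posdef p (entries \<Sigma>)"
    and P: "mat_inverse \<Sigma> = Some P" "P \<in> carrier_mat p p"
    and q: "posdef p q" and f: "\<And>x. f x = exp ((quad p (entries P) x - quad p q x) / 2)"
  shows "(\<integral>\<^sup>+ x. ennreal (f x) \<partial>mvn p \<Sigma>) = ennreal (1 / sqrt (det (fmat p q) * det \<Sigma>))"
proof -
  have dS: "det \<Sigma> > 0" using gaussian_integral(2)[OF pd] fmat_entries[OF S] by simp
  note dq = gaussian_integral(2)[OF q]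
  let ?c = "1 / sqrt ((2 * pi) ^ p * det \<Sigma>)"
  let ?L = "PiM {..<p} (\<lambda>_. lborel :: real measure)"
  have [measurable]: "quad p a \<in> borel_measurable ?L" for a by (rule quad_measurable) simp
  have "(\<integral>\<^sup>+ x. ennreal (f x) \<partial>mvn p \<Sigma>)
      = (\<integral>\<^sup>+ x. ennreal (exp (- quad p (entries P) x / 2) / sqrt ((2 * pi) ^ p * det \<Sigma>)) * ennreal (f x) \<partial>?L)"
    unfolding mvn_eq_density[OF S pd P] f by (rule nn_integral_density) measurable
  also have "\<dots> = (\<integral>\<^sup>+ x. ennreal ?c * ennreal (exp (- quad p q x / 2)) \<partial>?L)"
  proof (rule nn_integral_cong)
    fix x
    have "exp (- quad p (entries P) x / 2) * exp ((quad p (entries P) x - quad p q x) / 2) = exp (- quad p q x / 2)"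
      unfolding exp_add[symmetric] by (simp add: diff_divide_distrib)
    then show "ennreal (exp (- quad p (entries P) x / 2) / sqrt ((2 * pi) ^ p * det \<Sigma>)) * ennreal (f x)
        = ennreal ?c * ennreal (exp (- quad p q x / 2))"
      using dS by (simp add: f ennreal_mult[symmetric])
  qed
  also have "\<dots> = ennreal ?c * ennreal (sqrt ((2 * pi) ^ p / det (fmat p q)))"
    by (subst nn_integral_cmult) (simp_all only: gaussian_integral(1)[OF q], measurable)
  also have "\<dots> = ennreal (1 / sqrt (det (fmat p q) * det \<Sigma>))"
    using dS dq by (simp add: ennreal_mult[symmetric] real_sqrt_mult real_sqrt_divide)
  finally show ?thesis .
qed

lemma prob_space_mvn:
  assumes S: "\<Sigma> \<in> carrier_mat p p" and pd: "posdef p (entries \<Sigma>)"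
  shows "prob_space (mvn p \<Sigma>)"
proof
  obtain P where P: "mat_inverse \<Sigma> = Some P" "P \<in> carrier_mat p p" "posdef p (entries P)"
    "det P * det \<Sigma> = 1"
    using posdef_mat_inverse[OF S pd] by metis
  have "emeasure (mvn p \<Sigma>) (space (mvn p \<Sigma>)) = (\<integral>\<^sup>+ x. ennreal 1 \<partial>mvn p \<Sigma>)"
    by simp
  also have "\<dots> = ennreal (1 / sqrt (det (fmat p (entries P)) * det \<Sigma>))"
    by (rule nn_integral_mvn[OF S pd P(1,2,3)]) simp
  finally show "emeasure (mvn p \<Sigma>) (space (mvn p \<Sigma>)) = 1"
    using P by (simp add: fmat_entries)
qed

text \<open>The chi-square moment generating function. The precision matrix gets the rank-one update
  \<open>- c v v^T\<close>, and \<open>w = \<Sigma> v\<close> solves \<open>P w = v\<close>.\<close>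

lemma mvn_exp_square:
  assumes S: "\<Sigma> \<in> carrier_mat p p" and pd: "posdef p (entries \<Sigma>)"
    and c: "c * quad p (entries \<Sigma>) v < 1"
  shows "(\<integral>\<^sup>+ x. ennreal (exp (c * (ip p v x)\<^sup>2 / 2)) \<partial>mvn p \<Sigma>)
      = ennreal (1 / sqrt (1 - c * quad p (entries \<Sigma>) v))"
proof -
  obtain P where P: "mat_inverse \<Sigma> = Some P" "P \<in> carrier_mat p p" "posdef p (entries P)"
    "det P * det \<Sigma> = 1"
    and PS: "\<forall>v. \<forall>i<p. (\<Sum>j<p. P $$ (i, j) * (\<Sum>k<p. \<Sigma> $$ (j, k) * v k)) = v i"
    by (rule posdef_mat_inverse[OF S pd])
  define w where "w j = (\<Sum>k<p. \<Sigma> $$ (j, k) * v k)" for j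
  have w: "(\<Sum>j<p. P $$ (i, j) * w j) = v i" if "i < p" for i
    unfolding w_def using PS that by blast
  have vw: "ip p v w = quad p (entries \<Sigma>) v"
    by (simp add: ip_def w_def quad_def sum_distrib_left algebra_simps)
  let ?q = "\<lambda>i j. P $$ (i, j) - c * v i * v j"
  have "(\<integral>\<^sup>+ x. ennreal (exp (c * (ip p v x)\<^sup>2 / 2)) \<partial>mvn p \<Sigma>)
      = ennreal (1 / sqrt (det (fmat p ?q) * det \<Sigma>))"
  proof (rule nn_integral_mvn[OF S pd P(1,2)])
    show "posdef p ?q" by (rule posdef_rank_one[OF P(3) w]) (use c vw in simp_all)
    show "exp (c * (ip p v x)\<^sup>2 / 2) = exp ((quad p (entries P) x - quad p ?q x) / 2)" for x
      by (simp add: quad_rank_one)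
  qed
  also have "det (fmat p ?q) = det P * (1 - c * ip p v w)"
    using det_rank_one[OF w, where c = c] posdef_sym[OF P(3)] by (simp add: fmat_entries[OF P(2)])
  also have "\<dots> * det \<Sigma> = 1 - c * quad p (entries \<Sigma>) v"
    using P(4) by (simp add: vw algebra_simps)
  finally show ?thesis .
qed

lemma quad_one: "quad p (entries (1\<^sub>m p)) x = ip p x x"
proof -
  have "quad p (entries (1\<^sub>m p)) x = (\<Sum>i<p. \<Sum>j<p. if i = j then x i * x j else 0)"
    unfolding quad_def by (intro sum.cong) auto
  then show ?thesis by (simp add: ip_def)
qed

lemma posdef_one: "posdef p (entries (1\<^sub>m p))"
proof -
  have "0 < ip p x x" if "\<exists>i<p. x i \<noteq> 0" for x
    using that ip_self_eq_0[of p x] ip_self_nonneg[of p x] by force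
  then show ?thesis by (auto simp: posdef_def quad_one)
qed

lemma mat_inverse_one: "mat_inverse (1\<^sub>m p :: real mat) = Some (1\<^sub>m p)"
proof -
  obtain P where P: "mat_inverse (1\<^sub>m p :: real mat) = Some P" "P \<in> carrier_mat p p"
    using posdef_mat_inverse[OF one_carrier_mat posdef_one] by metis
  then show ?thesis using mat_inverse(2)[OF one_carrier_mat P(1)] left_mult_one_mat[OF P(2)] by simp
qed

text \<open>Two rank-one updates of the identity, \<open>- a a^T / 2\<close> and then
  \<open>+ b b^T / 2\<close>. The exact value contains \<open>b . w\<close> for the solution
  \<open>w\<close> of the first updated system; \<open>b . w >= b . b\<close> gives a bound without
  the mixed product of \<open>a\<close> and \<open>b\<close>.\<close>

lemma mvn_exp_square_diff:
  assumes a: "ip p a a < 2"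
  shows "(\<integral>\<^sup>+ x. ennreal (exp (((ip p a x)\<^sup>2 - (ip p b x)\<^sup>2) / 4)) \<partial>mvn p (1\<^sub>m p))
      \<le> ennreal (1 / sqrt ((1 - ip p a a / 2) * (1 + ip p b b / 2)))"
proof -
  let ?I = "entries (1\<^sub>m p)"
  let ?q = "\<lambda>i j. ?I i j - (1 / 2) * a i * a j"
  let ?r = "\<lambda>i j. ?q i j - (- 1 / 2) * b i * b j"
  have id: "(\<Sum>j<p. 1\<^sub>m p $$ (i, j) * v j) = v i" if "i < p" for v :: "nat \<Rightarrow> real" and i
  proof -
    have "(\<Sum>j<p. 1\<^sub>m p $$ (i, j) * v j) = (\<Sum>j<p. if j = i then v j else 0)"
      by (intro sum.cong) (use that in auto)
    then show ?thesis using that by simp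
  qed
  have q: "posdef p ?q" by (rule posdef_rank_one[OF posdef_one id]) (use a in auto)
  have "det (fmat p ?q) = det (fmat p ?I) * (1 - (1 / 2) * ip p a a)"
    by (rule det_rank_one[OF id]) auto
  then have dq: "det (fmat p ?q) = 1 - ip p a a / 2"
    unfolding fmat_entries[OF one_carrier_mat] by simp
  \<comment> \<open>The Sherman-Morrison formula for the inverse of \<open>1 - a a^T / 2\<close>
    applied to \<open>b\<close>.\<close>
  define w where "w i = b i + ip p a b / (2 - ip p a a) * a i" for i
  have w: "(\<Sum>j<p. ?q i j * w j) = b i" if "i < p" for i
  proof -
    have "(\<Sum>j<p. ?q i j * w j) = (\<Sum>j<p. 1\<^sub>m p $$ (i, j) * w j) - (1 / 2) * a i * ip p a w"
      by (simp add: ip_def algebra_simps sum_subtractf sum_distrib_left)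
    also have "\<dots> = w i - (1 / 2) * a i * ip p a w" by (simp only: id[OF that])
    also have "ip p a w = ip p a b + ip p a b / (2 - ip p a a) * ip p a a"
      unfolding w_def by (simp add: ip_add_right ip_scale_right[of p a "ip p a b / (2 - ip p a a)", simplified])
    also have "\<dots> = 2 * (ip p a b / (2 - ip p a a))" using a by (simp add: field_simps)
    also have "w i - (1 / 2) * a i * \<dots> = b i" by (simp add: w_def)
    finally show ?thesis .
  qed
  have bw: "ip p b b \<le> ip p b w"
  proof -
    have "ip p b w = ip p b b + ip p a b / (2 - ip p a a) * ip p b a"
      unfolding w_def by (simp add: ip_add_right ip_scale_right[of p b "ip p a b / (2 - ip p a a)", simplified])
    then show ?thesis using a by (simp add: ip_commute[of p b a])
  qed
  have bw0: "0 \<le> ip p b w" using bw ip_self_nonneg[of p b] by linarith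
  have r: "posdef p ?r"
    by (rule posdef_rank_one[OF q w]) (use bw0 in auto)
  have "det (fmat p ?r) = det (fmat p ?q) * (1 - (- 1 / 2) * ip p b w)"
    by (rule det_rank_one[OF w]) (auto simp: posdef_sym[OF q])
  then have dr: "det (fmat p ?r) = (1 - ip p a a / 2) * (1 + ip p b w / 2)" unfolding dq by simp
  have "(\<integral>\<^sup>+ x. ennreal (exp (((ip p a x)\<^sup>2 - (ip p b x)\<^sup>2) / 4)) \<partial>mvn p (1\<^sub>m p))
      = ennreal (1 / sqrt (det (fmat p ?r) * det (1\<^sub>m p :: real mat)))"
  proof (rule nn_integral_mvn[OF one_carrier_mat posdef_one mat_inverse_one one_carrier_mat r])
    show "exp (((ip p a x)\<^sup>2 - (ip p b x)\<^sup>2) / 4) = exp ((quad p ?I x - quad p ?r x) / 2)" for x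
      unfolding quad_rank_one by (simp add: field_simps)
  qed
  also have "\<dots> \<le> ennreal (1 / sqrt ((1 - ip p a a / 2) * (1 + ip p b b / 2)))"
  proof (intro ennreal_leI divide_left_mono)
    show "sqrt ((1 - ip p a a / 2) * (1 + ip p b b / 2)) \<le> sqrt (det (fmat p ?r) * det (1\<^sub>m p :: real mat))"
      unfolding dr using a bw by (simp add: mult_left_mono)
    show "0 < sqrt (det (fmat p ?r) * det (1\<^sub>m p :: real mat)) * sqrt ((1 - ip p a a / 2) * (1 + ip p b b / 2))"
      unfolding dr using a bw0 ip_self_nonneg[of p b] by (simp add: add_pos_nonneg)
  qed simp
  finally show ?thesis .
qed

subsection \<open>Laws of the observations and tail bounds\<close>

abbreviation noise :: "real \<Rightarrow> real measure" where
  "noise \<sigma> \<equiv> density lborel (normal_density 0 \<sigma>)"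

lemma sets_obs_law [measurable_cong, simp]: "sets (obs_law p \<theta>) = sets (obs_space p)"
  by (cases \<theta>) (simp add: obs_law_def)

lemma sets_data_law [measurable_cong, simp]: "sets (data_law n p \<theta>) = sets (data_space n p)"
  by (auto simp: data_law_def data_space_def intro!: sets_PiM_cong)

lemma space_data_law: "space (data_law n p \<theta>) = space (data_space n p)"
  by (rule sets_eq_imp_space_eq) simp

lemma measurable_covariates [measurable]: "snd \<in> obs_space p \<rightarrow>\<^sub>M PiM {..<p} (\<lambda>_. borel)"
  by (simp add: obs_space_def)

lemma measurable_response [measurable]: "fst \<in> borel_measurable (obs_space p)"
  by (simp add: obs_space_def)

lemma ip_measurable_borel [measurable]: "ip p v \<in> borel_measurable (PiM {..<p} (\<lambda>_. borel))"
  by (rule ip_measurable) simp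

lemma ip_measurable_borel' [measurable]: "(\<lambda>x. ip p x v) \<in> borel_measurable (PiM {..<p} (\<lambda>_. borel))"
  by (subst ip_commute) simp

lemma obs_map_measurable:
  "(\<lambda>(x, e). (ip p x b + e, x)) \<in> mvn p \<Sigma> \<Otimes>\<^sub>M noise \<sigma> \<rightarrow>\<^sub>M obs_space p"
  unfolding obs_space_def by measurable

lemma obs_law_eq:
  assumes "\<beta> \<in> carrier_vec p"
  shows "obs_law p (\<beta>, \<Sigma>, \<sigma>) = distr (mvn p \<Sigma> \<Otimes>\<^sub>M noise \<sigma>) (obs_space p)
    (\<lambda>(x, e). (ip p x (($) \<beta>) + e, x))"
  by (simp add: obs_law_def vec_scalar_prod[OF assms])

lemma exp_noise:
  assumes "0 < \<sigma>"
  shows "(\<integral>\<^sup>+ e. ennreal (exp (s * e)) \<partial>noise \<sigma>) = ennreal (exp (s\<^sup>2 * \<sigma>\<^sup>2 / 2))"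
proof -
  have "(\<integral>\<^sup>+ e. ennreal (exp (s * e)) \<partial>noise \<sigma>)
      = (\<integral>\<^sup>+ e. ennreal (normal_density 0 \<sigma> e) * ennreal (exp (s * e)) \<partial>lborel)"
    by (rule nn_integral_density) auto
  also have "\<dots> = (\<integral>\<^sup>+ e. ennreal (exp (s\<^sup>2 * \<sigma>\<^sup>2 / 2)) * ennreal (normal_density (s * \<sigma>\<^sup>2) \<sigma> e) \<partial>lborel)"
  proof (rule nn_integral_cong)
    fix e :: real
    have "- (e\<^sup>2) / (2 * \<sigma>\<^sup>2) + s * e = s\<^sup>2 * \<sigma>\<^sup>2 / 2 + - ((e - s * \<sigma>\<^sup>2)\<^sup>2) / (2 * \<sigma>\<^sup>2)"
      using assms by (simp add: field_simps power2_eq_square)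
    then have "exp (- (e\<^sup>2) / (2 * \<sigma>\<^sup>2)) * exp (s * e)
        = exp (s\<^sup>2 * \<sigma>\<^sup>2 / 2) * exp (- ((e - s * \<sigma>\<^sup>2)\<^sup>2) / (2 * \<sigma>\<^sup>2))"
      unfolding exp_add[symmetric] by simp
    then show "ennreal (normal_density 0 \<sigma> e) * ennreal (exp (s * e))
        = ennreal (exp (s\<^sup>2 * \<sigma>\<^sup>2 / 2)) * ennreal (normal_density (s * \<sigma>\<^sup>2) \<sigma> e)"
      by (simp add: normal_density_def ennreal_mult[symmetric])
  qed
  also have "\<dots> = ennreal (exp (s\<^sup>2 * \<sigma>\<^sup>2 / 2))"
    using assms by (subst nn_integral_cmult)
      (auto simp: nn_integral_eq_integral normal_density_nonneg)
  finally show ?thesis .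
qed

lemma measurable_obs_component: "i < n \<Longrightarrow> (\<lambda>z. z i) \<in> data_space n p \<rightarrow>\<^sub>M obs_space p"
  unfolding data_space_def by (rule measurable_component_singleton) simp

text \<open>Applied to the chi-square moment, \<open>r / 2\<close> cancels against the mean in a
  Chernoff bound and \<open>r^2\<close> is what remains.\<close>

lemma inverse_sqrt_le_exp:
  assumes "\<bar>r\<bar> \<le> 1 / 2" shows "1 / sqrt (1 - r) \<le> exp (r / 2 + r\<^sup>2)"
proof -
  have "- r - 2 * r\<^sup>2 \<le> ln (1 - r)"
    using abs_ln_one_plus_x_minus_x_bound[of "- r"] assms by simp
  then have "exp (- r - 2 * r\<^sup>2) \<le> 1 - r"
    using assms by (subst (asm) ln_ge_iff) auto
  then have "sqrt (exp (- r - 2 * r\<^sup>2)) \<le> sqrt (1 - r)" by simp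
  also have "sqrt (exp (- r - 2 * r\<^sup>2)) = exp (- (r / 2 + r\<^sup>2))"
    by (rule real_sqrt_unique) (simp_all add: power2_eq_square exp_add[symmetric])
  finally show ?thesis using assms by (simp add: exp_minus field_simps)
qed

locale model =
  fixes p :: nat and \<beta> :: "real vec" and \<Sigma> :: "real mat" and \<sigma> :: real
  assumes beta: "\<beta> \<in> carrier_vec p" and Sigma: "\<Sigma> \<in> carrier_mat p p"
    and pd: "posdef p (entries \<Sigma>)" and sigma: "0 < \<sigma>"
begin

abbreviation "\<theta> \<equiv> (\<beta>, \<Sigma>, \<sigma>)"
abbreviation "q \<equiv> quad p (entries \<Sigma>)"

definition residual :: "obs \<Rightarrow> real" where
  "residual z = fst z - ip p (snd z) (($) \<beta>)"

lemma residual_measurable [measurable]: "residual \<in> borel_measurable (obs_space p)"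
  unfolding residual_def by measurable

sublocale cov: prob_space "mvn p \<Sigma>"
  by (rule prob_space_mvn[OF Sigma pd])

sublocale noise: prob_space "noise \<sigma>"
  by (rule prob_space_normal_density[OF sigma])

sublocale cov_noise: pair_prob_space "mvn p \<Sigma>" "noise \<sigma>" ..

sublocale obs: prob_space "obs_law p \<theta>"
  unfolding obs_law_eq[OF beta]
  by (rule cov_noise.prob_space_distr[OF obs_map_measurable])

sublocale data: prob_space "data_law n p \<theta>" for n
  unfolding data_law_def by (rule prob_space_PiM) unfold_locales

lemma nn_integral_obs:
  assumes f: "f \<in> borel_measurable (obs_space p)"
  shows "(\<integral>\<^sup>+ z. f z \<partial>obs_law p \<theta>)
    = (\<integral>\<^sup>+ x. \<integral>\<^sup>+ e. f (ip p x (($) \<beta>) + e, x) \<partial>noise \<sigma> \<partial>mvn p \<Sigma>)"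
proof -
  note [measurable] = f obs_map_measurable[of p "($) \<beta>" \<Sigma> \<sigma>]
  have "(\<integral>\<^sup>+ z. f z \<partial>obs_law p \<theta>)
    = (\<integral>\<^sup>+ w. f ((\<lambda>(x, e). (ip p x (($) \<beta>) + e, x)) w) \<partial>(mvn p \<Sigma> \<Otimes>\<^sub>M noise \<sigma>))"
    unfolding obs_law_eq[OF beta] by (rule nn_integral_distr) measurable
  also have "\<dots> = (\<integral>\<^sup>+ x. \<integral>\<^sup>+ e. f ((\<lambda>(x, e). (ip p x (($) \<beta>) + e, x)) (x, e)) \<partial>noise \<sigma> \<partial>mvn p \<Sigma>)"
    by (rule noise.nn_integral_fst[symmetric]) measurable
  finally show ?thesis by simp
qed

text \<open>Design and noise are separate arguments: the debiasing weight of one row depends on all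
  rows, so the noise must be integrated with the whole design fixed and not row by row.\<close>

definition sample :: "nat \<Rightarrow> (nat \<Rightarrow> nat \<Rightarrow> real) \<Rightarrow> (nat \<Rightarrow> real) \<Rightarrow> nat \<Rightarrow> obs" where
  "sample n X E = (\<lambda>i\<in>{..<n}. (ip p (X i) (($) \<beta>) + E i, X i))"

lemma nn_integral_data_prod:
  assumes [measurable]: "\<And>i. i < n \<Longrightarrow> f i \<in> borel_measurable (obs_space p)"
  shows "(\<integral>\<^sup>+ z. (\<Prod>i<n. f i (z i)) \<partial>data_law n p \<theta>) = (\<Prod>i<n. \<integral>\<^sup>+ z. f i z \<partial>obs_law p \<theta>)"
proof -
  interpret product_sigma_finite "\<lambda>_::nat. obs_law p \<theta>" ..
  show ?thesis unfolding data_law_def by (rule product_nn_integral_prod) auto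
qed

lemma sample_measurable:
  "(\<lambda>(X, E). sample n X E) \<in>
    PiM {..<n} (\<lambda>_. mvn p \<Sigma>) \<Otimes>\<^sub>M PiM {..<n} (\<lambda>_. noise \<sigma>) \<rightarrow>\<^sub>M data_space n p"
proof -
  have "(\<lambda>w. \<lambda>i\<in>{..<n}. (ip p (fst w i) (($) \<beta>) + snd w i, fst w i)) \<in>
    PiM {..<n} (\<lambda>_. mvn p \<Sigma>) \<Otimes>\<^sub>M PiM {..<n} (\<lambda>_. noise \<sigma>) \<rightarrow>\<^sub>M data_space n p"
    unfolding data_space_def
  proof (rule measurable_restrict)
    fix i assume i: "i \<in> {..<n}"
    have [measurable]: "(\<lambda>w. fst w i) \<in> PiM {..<n} (\<lambda>_. mvn p \<Sigma>) \<Otimes>\<^sub>M PiM {..<n} (\<lambda>_. noise \<sigma>)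
        \<rightarrow>\<^sub>M PiM {..<p} (\<lambda>_. borel)"
      using i by (intro measurable_compose[OF measurable_fst]
          measurable_compose[OF measurable_component_singleton[of i] ]) (auto simp: measurable_ident_sets)
    have [measurable]: "(\<lambda>w. snd w i) \<in> borel_measurable (PiM {..<n} (\<lambda>_. mvn p \<Sigma>) \<Otimes>\<^sub>M PiM {..<n} (\<lambda>_. noise \<sigma>))"
      using i by (intro measurable_compose[OF measurable_snd]
          measurable_compose[OF measurable_component_singleton[of i] ]) (auto simp: measurable_ident_sets)
    show "(\<lambda>w. (ip p (fst w i) (($) \<beta>) + snd w i, fst w i)) \<in>
      PiM {..<n} (\<lambda>_. mvn p \<Sigma>) \<Otimes>\<^sub>M PiM {..<n} (\<lambda>_. noise \<sigma>) \<rightarrow>\<^sub>M obs_space p"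
      unfolding obs_space_def by measurable
  qed
  then show ?thesis by (simp add: sample_def case_prod_beta)
qed

text \<open>Measures on a finite product agree once they agree on rectangles; there Fubini splits
  the noise from the design, and each factor is the law of one observation.\<close>

lemma data_law_eq:
  "data_law n p \<theta> = distr (PiM {..<n} (\<lambda>_. mvn p \<Sigma>) \<Otimes>\<^sub>M PiM {..<n} (\<lambda>_. noise \<sigma>)) (data_space n p)
    (\<lambda>(X, E). sample n X E)" (is "_ = ?D")
proof -
  interpret O: product_sigma_finite "\<lambda>_::nat. obs_law p \<theta>" ..
  interpret C: product_sigma_finite "\<lambda>_::nat. mvn p \<Sigma>" ..
  interpret N: product_sigma_finite "\<lambda>_::nat. noise \<sigma>" ..
  interpret N': finite_product_prob_space "\<lambda>_::nat. noise \<sigma>" "{..<n}" by unfold_locales auto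
  have "?D = PiM {..<n} (\<lambda>_. obs_law p \<theta>)"
  proof (rule O.PiM_eqI)
    show "sets ?D = sets (PiM {..<n} (\<lambda>_. obs_law p \<theta>))"
      using sets_data_law[of n p \<theta>] by (simp add: data_law_def)
    fix A assume A: "\<And>i. i \<in> {..<n} \<Longrightarrow> A i \<in> sets (obs_law p \<theta>)"
    have [measurable]: "indicator (A i) \<in> borel_measurable (obs_space p)" if "i < n" for i
      using A[of i] that by (intro borel_measurable_indicator) auto
    have PA: "Pi\<^sub>E {..<n} A \<in> sets (data_space n p)"
      unfolding data_space_def using A by (intro sets_PiM_I_finite) auto
    have "emeasure ?D (Pi\<^sub>E {..<n} A) = (\<integral>\<^sup>+ z. indicator (Pi\<^sub>E {..<n} A) z \<partial>?D)"
      using PA by simp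
    also have "\<dots> = (\<integral>\<^sup>+ w. indicator (Pi\<^sub>E {..<n} A) ((\<lambda>(X, E). sample n X E) w)
        \<partial>(PiM {..<n} (\<lambda>_. mvn p \<Sigma>) \<Otimes>\<^sub>M PiM {..<n} (\<lambda>_. noise \<sigma>)))"
      by (rule nn_integral_distr[OF sample_measurable]) (use PA in simp)
    also have "\<dots> = (\<integral>\<^sup>+ X. \<integral>\<^sup>+ E. indicator (Pi\<^sub>E {..<n} A) (sample n X E)
        \<partial>PiM {..<n} (\<lambda>_. noise \<sigma>) \<partial>PiM {..<n} (\<lambda>_. mvn p \<Sigma>))"
      by (subst N'.nn_integral_fst[symmetric])
        (use PA sample_measurable in \<open>auto intro!: measurable_compose[OF _ borel_measurable_indicator]\<close>)
    also have "\<dots> = (\<integral>\<^sup>+ X. \<integral>\<^sup>+ E. (\<Prod>i<n. indicator (A i) (ip p (X i) (($) \<beta>) + E i, X i))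
        \<partial>PiM {..<n} (\<lambda>_. noise \<sigma>) \<partial>PiM {..<n} (\<lambda>_. mvn p \<Sigma>))"
    proof (intro nn_integral_cong)
      fix X E
      have "sample n X E \<in> Pi\<^sub>E {..<n} A \<longleftrightarrow> (\<forall>i<n. (ip p (X i) (($) \<beta>) + E i, X i) \<in> A i)"
        by (auto simp: sample_def PiE_iff)
      then show "indicator (Pi\<^sub>E {..<n} A) (sample n X E)
          = (\<Prod>i<n. indicator (A i) (ip p (X i) (($) \<beta>) + E i, X i) :: ennreal)"
        by (auto simp: indicator_def prod.If_cases split: if_splits) 
    qed
    also have "\<dots> = (\<integral>\<^sup>+ X. (\<Prod>i<n. \<integral>\<^sup>+ e. indicator (A i) (ip p (X i) (($) \<beta>) + e, X i) \<partial>noise \<sigma>)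
        \<partial>PiM {..<n} (\<lambda>_. mvn p \<Sigma>))"
    proof (intro nn_integral_cong N.product_nn_integral_prod)
      fix X i assume X: "X \<in> space (PiM {..<n} (\<lambda>_. mvn p \<Sigma>))" and i: "i \<in> {..<n}"
      then have "X i \<in> space (mvn p \<Sigma>)" by (auto simp: space_PiM)
      then have [measurable]: "X i \<in> space (PiM {..<p} (\<lambda>_. borel))" by (simp add: space_mvn)
      have "(\<lambda>e. (ip p (X i) (($) \<beta>) + e, X i)) \<in> noise \<sigma> \<rightarrow>\<^sub>M obs_space p"
        unfolding obs_space_def by measurable
      then show "(\<lambda>e. indicator (A i) (ip p (X i) (($) \<beta>) + e, X i) :: ennreal) \<in> borel_measurable (noise \<sigma>)"
        by (rule measurable_compose) (use i in simp)
    qed auto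
    also have "\<dots> = (\<Prod>i<n. \<integral>\<^sup>+ x. \<integral>\<^sup>+ e. indicator (A i) (ip p x (($) \<beta>) + e, x) \<partial>noise \<sigma> \<partial>mvn p \<Sigma>)"
    proof (rule C.product_nn_integral_prod)
      fix i assume i: "i \<in> {..<n}"
      have "(\<lambda>(x, e). indicator (A i) (ip p x (($) \<beta>) + e, x) :: ennreal) \<in> borel_measurable (mvn p \<Sigma> \<Otimes>\<^sub>M noise \<sigma>)"
        using measurable_compose[OF obs_map_measurable[of p "($) \<beta>" \<Sigma> \<sigma>], of "indicator (A i)" borel] i
        by (simp add: case_prod_beta')
      then show "(\<lambda>x. \<integral>\<^sup>+ e. indicator (A i) (ip p x (($) \<beta>) + e, x) \<partial>noise \<sigma>) \<in> borel_measurable (mvn p \<Sigma>)"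
        by (rule noise.borel_measurable_nn_integral)
    qed auto
    also have "\<dots> = (\<Prod>i<n. \<integral>\<^sup>+ z. indicator (A i) z \<partial>obs_law p \<theta>)"
      by (intro prod.cong refl nn_integral_obs[symmetric]) simp
    also have "\<dots> = (\<Prod>i\<in>{..<n}. emeasure (obs_law p \<theta>) (A i))"
      using A by (intro prod.cong refl) simp
    finally show "emeasure ?D (Pi\<^sub>E {..<n} A) = (\<Prod>i\<in>{..<n}. emeasure (obs_law p \<theta>) (A i))" .
  qed simp
  then show ?thesis by (simp add: data_law_def)
qed

lemma nn_integral_data:
  assumes f: "f \<in> borel_measurable (data_space n p)"
  shows "(\<integral>\<^sup>+ z. f z \<partial>data_law n p \<theta>)
    = (\<integral>\<^sup>+ X. \<integral>\<^sup>+ E. f (sample n X E) \<partial>PiM {..<n} (\<lambda>_. noise \<sigma>) \<partial>PiM {..<n} (\<lambda>_. mvn p \<Sigma>))"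
proof -
  interpret N': finite_product_prob_space "\<lambda>_::nat. noise \<sigma>" "{..<n}" by unfold_locales auto
  have "(\<integral>\<^sup>+ z. f z \<partial>data_law n p \<theta>) = (\<integral>\<^sup>+ w. f ((\<lambda>(X, E). sample n X E) w)
        \<partial>(PiM {..<n} (\<lambda>_. mvn p \<Sigma>) \<Otimes>\<^sub>M PiM {..<n} (\<lambda>_. noise \<sigma>)))"
    unfolding data_law_eq by (rule nn_integral_distr[OF sample_measurable]) (use f in simp)
  also have "\<dots> = (\<integral>\<^sup>+ X. \<integral>\<^sup>+ E. f (sample n X E)
        \<partial>PiM {..<n} (\<lambda>_. noise \<sigma>) \<partial>PiM {..<n} (\<lambda>_. mvn p \<Sigma>))"
    by (subst N'.nn_integral_fst[symmetric])
      (use measurable_compose[OF sample_measurable f] in auto)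
  finally show ?thesis .
qed

lemma chernoff:
  assumes F: "F \<in> borel_measurable (data_space n p)"
    and K: "(\<integral>\<^sup>+ z. ennreal (exp (F z)) \<partial>data_law n p \<theta>) \<le> ennreal K" "0 \<le> K"
  shows "measure (data_law n p \<theta>) {z \<in> space (data_space n p). r \<le> F z} \<le> K * exp (- r)"
proof -
  let ?A = "{z \<in> space (data_space n p). r \<le> F z}"
  have A: "?A \<in> sets (data_law n p \<theta>)" using F by simp
  have "emeasure (data_law n p \<theta>) ?A = (\<integral>\<^sup>+ z. indicator ?A z \<partial>data_law n p \<theta>)"
    using A by simp
  also have "\<dots> \<le> (\<integral>\<^sup>+ z. ennreal (exp (F z)) * ennreal (exp (- r)) \<partial>data_law n p \<theta>)"
    by (intro nn_integral_mono)
      (auto simp: indicator_def ennreal_mult[symmetric] exp_add[symmetric] ennreal_1[symmetric]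
        simp del: ennreal_1 split: if_splits intro!: ennreal_leI)
  also have "\<dots> = (\<integral>\<^sup>+ z. ennreal (exp (F z)) \<partial>data_law n p \<theta>) * ennreal (exp (- r))"
    using F by (intro nn_integral_multc) simp
  also have "\<dots> \<le> ennreal K * ennreal (exp (- r))"
    using K by (intro mult_right_mono) auto
  also have "\<dots> = ennreal (K * exp (- r))" using K by (simp add: ennreal_mult)
  finally show ?thesis
    using K by (simp add: data.emeasure_eq_measure)
qed

lemma chernoff_sum:
  assumes g [measurable]: "g \<in> borel_measurable (obs_space p)"
    and K: "(\<integral>\<^sup>+ z. ennreal (exp (g z)) \<partial>obs_law p \<theta>) \<le> ennreal (exp K)"
  shows "measure (data_law n p \<theta>) {z \<in> space (data_space n p). r \<le> (\<Sum>i<n. g (z i))}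
    \<le> exp (real n * K - r)"
proof -
  have m [measurable]: "(\<lambda>z. g (z i)) \<in> borel_measurable (data_space n p)" if "i < n" for i
    by (rule measurable_compose[OF measurable_obs_component[OF that] g])
  have "(\<integral>\<^sup>+ z. ennreal (exp (\<Sum>i<n. g (z i))) \<partial>data_law n p \<theta>)
      = (\<integral>\<^sup>+ z. (\<Prod>i<n. ennreal (exp (g (z i)))) \<partial>data_law n p \<theta>)"
    by (simp add: exp_sum prod_ennreal)
  also have "\<dots> = (\<Prod>i<n. \<integral>\<^sup>+ z. ennreal (exp (g z)) \<partial>obs_law p \<theta>)"
    by (rule nn_integral_data_prod) simp
  also have "\<dots> \<le> (\<Prod>i<n. ennreal (exp K))"
    by (rule prod_mono_ennreal) (rule K)
  also have "\<dots> = ennreal (exp (real n * K))"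
    by (simp add: ennreal_power exp_of_nat_mult[symmetric])
  finally have "measure (data_law n p \<theta>) {z \<in> space (data_space n p). r \<le> (\<Sum>i<n. g (z i))}
      \<le> exp (real n * K) * exp (- r)"
    by (intro chernoff) auto
  then show ?thesis by (simp add: exp_diff exp_minus field_simps)
qed

lemma nn_integral_obs_covariates:
  assumes f [measurable]: "f \<in> borel_measurable (PiM {..<p} (\<lambda>_. borel))"
  shows "(\<integral>\<^sup>+ z. f (snd z) \<partial>obs_law p \<theta>) = (\<integral>\<^sup>+ x. f x \<partial>mvn p \<Sigma>)"
proof (subst nn_integral_obs)
  show "(\<lambda>z. f (snd z)) \<in> borel_measurable (obs_space p)" by measurable
  show "(\<integral>\<^sup>+ x. \<integral>\<^sup>+ e. f (snd (ip p x (($) \<beta>) + e, x)) \<partial>noise \<sigma> \<partial>mvn p \<Sigma>) = (\<integral>\<^sup>+ x. f x \<partial>mvn p \<Sigma>)"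
    using noise.emeasure_space_1 by simp
qed

text \<open>The sign of \<open>c\<close> selects the tail, so one computation serves both. The
  choice of \<open>|c|\<close> gives \<open>|c * q v| <= t / 4\<close>, so the second-order term
  \<open>(c * q v)^2\<close> takes at most half of the gain \<open>t^2 / 8\<close>.\<close>

lemma square_tail_aux:
  assumes Q: "q v \<le> Q" "0 < Q" and t: "0 < t" "t \<le> 1" and c: "\<bar>c\<bar> = t / (4 * Q)"
  shows "measure (data_law n p \<theta>) {z \<in> space (data_space n p).
      c / 2 * (real n * q v) + real n * t\<^sup>2 / 8 \<le> (\<Sum>i<n. c / 2 * (ip p v (snd (z i)))\<^sup>2)}
    \<le> exp (- (real n * t\<^sup>2 / 16))"
proof -
  have q0: "0 \<le> q v"
    using posdef_pos[OF pd, of v] by (cases "\<exists>i<p. v i \<noteq> 0") (auto simp: quad_def)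
  have "\<bar>c * q v\<bar> = t / 4 * (q v / Q)" using c q0 Q by (simp add: abs_mult)
  also have "\<dots> \<le> t / 4 * 1" using Q t by (intro mult_left_mono) auto
  finally have cq: "\<bar>c * q v\<bar> \<le> t / 4" by simp
  then have cq1: "c * q v < 1" using t by linarith
  have "(\<integral>\<^sup>+ z. ennreal (exp (c / 2 * (ip p v (snd z))\<^sup>2)) \<partial>obs_law p \<theta>)
      = (\<integral>\<^sup>+ x. ennreal (exp (c * (ip p v x)\<^sup>2 / 2)) \<partial>mvn p \<Sigma>)"
    by (subst nn_integral_obs_covariates[symmetric]) auto
  also have "\<dots> = ennreal (1 / sqrt (1 - c * q v))"
    by (rule mvn_exp_square[OF Sigma pd cq1])
  also have "\<dots> \<le> ennreal (exp (c * q v / 2 + (c * q v)\<^sup>2))"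
    using cq t by (intro ennreal_leI inverse_sqrt_le_exp) linarith
  finally have "measure (data_law n p \<theta>) {z \<in> space (data_space n p).
      c / 2 * (real n * q v) + real n * t\<^sup>2 / 8 \<le> (\<Sum>i<n. c / 2 * (ip p v (snd (z i)))\<^sup>2)}
      \<le> exp (real n * (c * q v / 2 + (c * q v)\<^sup>2) - (c / 2 * (real n * q v) + real n * t\<^sup>2 / 8))"
    by (intro chernoff_sum) auto
  also have "\<dots> = exp (real n * ((c * q v)\<^sup>2 - t\<^sup>2 / 8))"
    by (simp add: algebra_simps)
  also have "\<dots> \<le> exp (real n * (- (t\<^sup>2 / 16)))"
  proof -
    have "(c * q v)\<^sup>2 \<le> (t / 4)\<^sup>2" using cq by (rule abs_le_square_iff[THEN iffD1, OF order_trans]) simp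
    then have "(c * q v)\<^sup>2 - t\<^sup>2 / 8 \<le> - (t\<^sup>2 / 16)" by (simp add: power_divide)
    then have "real n * ((c * q v)\<^sup>2 - t\<^sup>2 / 8) \<le> real n * (- (t\<^sup>2 / 16))" by (rule mult_left_mono) simp
    then show ?thesis by (simp only: exp_le_cancel_iff)
  qed
  finally show ?thesis by simp
qed

lemma two_sided_tail:
  fixes F :: "(nat \<Rightarrow> obs) \<Rightarrow> real"
  assumes F [measurable]: "F \<in> borel_measurable (data_space n p)"
    and "\<And>\<epsilon>. \<epsilon> = 1 \<or> \<epsilon> = - 1 \<Longrightarrow>
      measure (data_law n p \<theta>) {z \<in> space (data_space n p). r \<le> \<epsilon> * F z} \<le> B"
  shows "measure (data_law n p \<theta>) {z \<in> space (data_space n p). r \<le> \<bar>F z\<bar>} \<le> 2 * B"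
proof -
  let ?A = "\<lambda>\<epsilon>. {z \<in> space (data_space n p). r \<le> \<epsilon> * F z}"
  have A: "?A \<epsilon> \<in> data.events n" for \<epsilon> 
  proof -
    have "(\<lambda>z. \<epsilon> * F z) \<in> borel_measurable (data_space n p)" by measurable
    then show ?thesis by simp
  qed
  have "measure (data_law n p \<theta>) {z \<in> space (data_space n p). r \<le> \<bar>F z\<bar>}
      \<le> measure (data_law n p \<theta>) (?A 1 \<union> ?A (- 1))"
  proof (rule data.finite_measure_mono)
    have "r \<le> \<bar>y\<bar> \<Longrightarrow> r \<le> 1 * y \<or> r \<le> - 1 * y" for y :: real by linarith
    then show "{z \<in> space (data_space n p). r \<le> \<bar>F z\<bar>} \<subseteq> ?A 1 \<union> ?A (- 1)" by blast
    show "?A 1 \<union> ?A (- 1) \<in> data.events n" using A by blast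
  qed
  also have "\<dots> \<le> measure (data_law n p \<theta>) (?A 1) + measure (data_law n p \<theta>) (?A (- 1))"
    using A by (intro measure_subadditive) (auto simp: data.emeasure_eq_measure)
  also have "\<dots> \<le> B + B" using assms(2)[of 1] assms(2)[of "- 1"] by (intro add_mono) simp_all
  finally show ?thesis by simp
qed

lemma square_tail:
  assumes Q: "q v \<le> Q" "0 < Q" and t: "0 < t" "t \<le> 1"
  shows "measure (data_law n p \<theta>) {z \<in> space (data_space n p).
      real n * t * Q \<le> \<bar>(\<Sum>i<n. (ip p v (snd (z i)))\<^sup>2) - real n * q v\<bar>}
    \<le> 2 * exp (- (real n * t\<^sup>2 / 16))"
proof (rule two_sided_tail)
  define c where "c = t / (4 * Q)"
  have c0: "0 < c" using Q t by (simp add: c_def)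
  show "(\<lambda>z. (\<Sum>i<n. (ip p v (snd (z i)))\<^sup>2) - real n * q v) \<in> borel_measurable (data_space n p)"
    by (intro borel_measurable_diff borel_measurable_sum borel_measurable_power borel_measurable_const
        measurable_compose[OF measurable_obs_component]
        measurable_compose[OF measurable_covariates ip_measurable_borel]) auto
  fix \<epsilon> :: real assume \<epsilon>: "\<epsilon> = 1 \<or> \<epsilon> = - 1"
  have "real n * t * Q \<le> \<epsilon> * (S - real n * q v) \<longleftrightarrow>
      (\<epsilon> * c) / 2 * (real n * q v) + real n * t\<^sup>2 / 8 \<le> (\<epsilon> * c) / 2 * S" for S
  proof -
    have "c / 2 * (real n * t * Q) = real n * t\<^sup>2 / 8" using Q by (simp add: c_def power2_eq_square)
    moreover have "real n * t * Q \<le> \<epsilon> * (S - real n * q v) \<longleftrightarrow>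
        c / 2 * (real n * t * Q) \<le> c / 2 * (\<epsilon> * (S - real n * q v))"
      using c0 by (intro mult_le_cancel_left_pos[symmetric]) simp
    moreover have "c / 2 * (\<epsilon> * (S - real n * q v)) = (\<epsilon> * c) / 2 * S - (\<epsilon> * c) / 2 * (real n * q v)"
      by (simp add: algebra_simps)
    ultimately show ?thesis by linarith
  qed
  then have "{z \<in> space (data_space n p).
        real n * t * Q \<le> \<epsilon> * ((\<Sum>i<n. (ip p v (snd (z i)))\<^sup>2) - real n * q v)}
      = {z \<in> space (data_space n p). (\<epsilon> * c) / 2 * (real n * q v) + real n * t\<^sup>2 / 8
          \<le> (\<Sum>i<n. (\<epsilon> * c) / 2 * (ip p v (snd (z i)))\<^sup>2)}"
    unfolding sum_distrib_left[symmetric] by simp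
  moreover have "\<bar>\<epsilon> * c\<bar> = t / (4 * Q)" using \<epsilon> Q t by (auto simp: c_def)
  ultimately show "measure (data_law n p \<theta>) {z \<in> space (data_space n p).
        real n * t * Q \<le> \<epsilon> * ((\<Sum>i<n. (ip p v (snd (z i)))\<^sup>2) - real n * q v)}
      \<le> exp (- (real n * t\<^sup>2 / 16))"
    using square_tail_aux[OF Q t, of "\<epsilon> * c" n] by simp
qed

lemma residual_sample: "i < n \<Longrightarrow> residual (sample n X E i) = E i"
  by (simp add: residual_def sample_def)

text \<open>Integrating the noise first leaves the exponential of a squared normal variable, again a
  chi-square moment. The condition \<open>t^2 <= 2 * Q\<close> keeps \<open>r\<close> at most
  \<open>1 / 2\<close>.\<close>

lemma cross_tail:
  assumes Q: "\<sigma>\<^sup>2 * q v \<le> Q" "0 < Q" and t: "0 < t" "t\<^sup>2 \<le> 2 * Q"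
  shows "measure (data_law n p \<theta>) {z \<in> space (data_space n p).
      real n * t \<le> \<bar>\<Sum>i<n. ip p v (snd (z i)) * residual (z i)\<bar>}
    \<le> 2 * exp (- (real n * t\<^sup>2 / (4 * Q)))"
proof (rule two_sided_tail)
  note m = measurable_obs_component
  show "(\<lambda>z. \<Sum>i<n. ip p v (snd (z i)) * residual (z i)) \<in> borel_measurable (data_space n p)"
    by (intro borel_measurable_sum borel_measurable_times measurable_compose[OF m]
        measurable_compose[OF measurable_covariates]) auto
  fix \<epsilon> :: real assume \<epsilon>: "\<epsilon> = 1 \<or> \<epsilon> = - 1"
  then have \<epsilon>2: "\<epsilon>\<^sup>2 = 1" by auto
  \<comment> \<open>The minimiser of \<open>s^2 * Q - s * t\<close>, the exponent per
    observation.\<close>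
  define s where "s = t / (2 * Q)"
  have s0: "0 < s" using t Q by (simp add: s_def)
  define r where "r = s\<^sup>2 * \<sigma>\<^sup>2 * q v"
  have q0: "0 \<le> q v"
    using posdef_pos[OF pd, of v] by (cases "\<exists>i<p. v i \<noteq> 0") (auto simp: quad_def)
  have r0: "0 \<le> r" using q0 by (simp add: r_def)
  have "r \<le> s\<^sup>2 * Q" using Q by (simp add: r_def mult.assoc mult_left_mono)
  also have "s\<^sup>2 * Q = t\<^sup>2 / (4 * Q)" using Q by (simp add: s_def power2_eq_square)
  finally have rt: "r \<le> t\<^sup>2 / (4 * Q)" .
  also have "\<dots> \<le> 1 / 2" using t Q by (simp add: field_simps)
  finally have r1: "r \<le> 1 / 2" .
  have "(\<integral>\<^sup>+ z. ennreal (exp (s * (\<epsilon> * (ip p v (snd z) * residual z)))) \<partial>obs_law p \<theta>)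
      = (\<integral>\<^sup>+ x. \<integral>\<^sup>+ e. ennreal (exp ((s * \<epsilon> * ip p v x) * e)) \<partial>noise \<sigma> \<partial>mvn p \<Sigma>)"
    by (subst nn_integral_obs) (auto simp: residual_def mult.assoc)
  also have "\<dots> = (\<integral>\<^sup>+ x. ennreal (exp ((s\<^sup>2 * \<sigma>\<^sup>2) * (ip p v x)\<^sup>2 / 2)) \<partial>mvn p \<Sigma>)"
    by (simp only: exp_noise[OF sigma] power_mult_distrib \<epsilon>2) (simp add: ac_simps)
  also have "\<dots> = ennreal (1 / sqrt (1 - r))"
    unfolding r_def by (rule mvn_exp_square[OF Sigma pd]) (use r1 in \<open>simp add: r_def\<close>)
  also have "\<dots> \<le> ennreal (exp (r / 2 + r\<^sup>2))"
    using r0 r1 by (intro ennreal_leI inverse_sqrt_le_exp) linarith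
  also have "\<dots> \<le> ennreal (exp (t\<^sup>2 / (4 * Q)))"
  proof -
    have "r\<^sup>2 \<le> r / 2" using r0 r1 mult_left_mono[OF r1 r0] by (simp add: power2_eq_square)
    then show ?thesis using rt by (intro ennreal_leI) auto
  qed
  finally have "measure (data_law n p \<theta>) {z \<in> space (data_space n p).
      s * (real n * t) \<le> (\<Sum>i<n. s * (\<epsilon> * (ip p v (snd (z i)) * residual (z i))))}
      \<le> exp (real n * (t\<^sup>2 / (4 * Q)) - s * (real n * t))"
    by (intro chernoff_sum) auto
  also have "{z \<in> space (data_space n p).
      s * (real n * t) \<le> (\<Sum>i<n. s * (\<epsilon> * (ip p v (snd (z i)) * residual (z i))))}
      = {z \<in> space (data_space n p). real n * t \<le> \<epsilon> * (\<Sum>i<n. ip p v (snd (z i)) * residual (z i))}"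
    using s0 by (simp add: sum_distrib_left[symmetric])
  also have "real n * (t\<^sup>2 / (4 * Q)) - s * (real n * t) = - (real n * t\<^sup>2 / (4 * Q))"
    using Q by (simp add: s_def power2_eq_square field_simps)
  finally show "measure (data_law n p \<theta>) {z \<in> space (data_space n p). real n * t
      \<le> \<epsilon> * (\<Sum>i<n. ip p v (snd (z i)) * residual (z i))} \<le> exp (- (real n * t\<^sup>2 / (4 * Q)))" .
qed

text \<open>Given the design the sum is normal with variance at most \<open>W\<close>, and this for
  every design, so the bound survives integration over designs. The premise \<open>cong\<close> says
  that the weights read the first \<open>n\<close> rows only.\<close>

lemma weighted_noise_tail:
  assumes w: "\<And>i. i < n \<Longrightarrow> (\<lambda>X. w X i) \<in> borel_measurable (PiM {..<n} (\<lambda>_. PiM {..<p} (\<lambda>_. borel)))"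
    and cong: "\<And>X X' i. (\<And>i. i < n \<Longrightarrow> X i = X' i) \<Longrightarrow> w X i = w X' i"
    and W: "\<And>X. \<sigma>\<^sup>2 * (\<Sum>i<n. (w X i)\<^sup>2) \<le> W" "0 < W" and r: "0 < r"
  shows "measure (data_law n p \<theta>) {z \<in> space (data_space n p).
      r \<le> \<bar>\<Sum>i<n. w (\<lambda>i. snd (z i)) i * residual (z i)\<bar>}
    \<le> 2 * exp (- (r\<^sup>2 / (2 * W)))"
proof (rule two_sided_tail)
  interpret N: product_sigma_finite "\<lambda>_::nat. noise \<sigma>" ..
  interpret C': finite_product_prob_space "\<lambda>_::nat. mvn p \<Sigma>" "{..<n}" by unfold_locales auto
  note m = measurable_obs_component
  have mX: "(\<lambda>z. \<lambda>i\<in>{..<n}. snd (z i)) \<in> data_space n p \<rightarrow>\<^sub>M PiM {..<n} (\<lambda>_. PiM {..<p} (\<lambda>_. borel))"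
    by (intro measurable_restrict measurable_compose[OF m measurable_covariates]) auto
  have wz: "w (\<lambda>i. snd (z i)) i = w (\<lambda>i\<in>{..<n}. snd (z i)) i" for z :: "nat \<Rightarrow> obs" and i
    by (rule cong) simp
  have mF [measurable]: "(\<lambda>z. \<Sum>i<n. w (\<lambda>i. snd (z i)) i * residual (z i)) \<in> borel_measurable (data_space n p)"
    unfolding wz
    by (intro borel_measurable_sum borel_measurable_times measurable_compose[OF m]
        measurable_compose[OF mX] w) auto
  then show "(\<lambda>z. \<Sum>i<n. w (\<lambda>i. snd (z i)) i * residual (z i)) \<in> borel_measurable (data_space n p)" .
  fix \<epsilon> :: real assume \<epsilon>: "\<epsilon> = 1 \<or> \<epsilon> = - 1"
  then have \<epsilon>2: "\<epsilon>\<^sup>2 = 1" by auto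
  \<comment> \<open>The minimiser of \<open>s^2 * W / 2 - s * r\<close>.\<close>
  define s where "s = r / W"
  have s0: "0 < s" using r W by (simp add: s_def)
  have "(\<integral>\<^sup>+ z. ennreal (exp (s * (\<epsilon> * (\<Sum>i<n. w (\<lambda>i. snd (z i)) i * residual (z i))))) \<partial>data_law n p \<theta>)
    = (\<integral>\<^sup>+ X. \<integral>\<^sup>+ E. (\<Prod>i<n. ennreal (exp (s * \<epsilon> * w X i * E i)))
        \<partial>PiM {..<n} (\<lambda>_. noise \<sigma>) \<partial>PiM {..<n} (\<lambda>_. mvn p \<Sigma>))"
  proof (subst nn_integral_data)
    show "(\<lambda>z. ennreal (exp (s * (\<epsilon> * (\<Sum>i<n. w (\<lambda>i. snd (z i)) i * residual (z i))))))
        \<in> borel_measurable (data_space n p)" by measurable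
    have "w (\<lambda>i. snd (sample n X E i)) = w X" for X E
      by (rule ext, rule cong) (simp add: sample_def)
    then show "(\<integral>\<^sup>+ X. \<integral>\<^sup>+ E. ennreal (exp (s * (\<epsilon> * (\<Sum>i<n. w (\<lambda>i. snd (sample n X E i)) i
          * residual (sample n X E i))))) \<partial>PiM {..<n} (\<lambda>_. noise \<sigma>) \<partial>PiM {..<n} (\<lambda>_. mvn p \<Sigma>))
      = (\<integral>\<^sup>+ X. \<integral>\<^sup>+ E. (\<Prod>i<n. ennreal (exp (s * \<epsilon> * w X i * E i)))
        \<partial>PiM {..<n} (\<lambda>_. noise \<sigma>) \<partial>PiM {..<n} (\<lambda>_. mvn p \<Sigma>))"
      by (simp add: residual_sample exp_sum[symmetric] prod_ennreal sum_distrib_left mult.assoc)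
  qed
  also have "\<dots> = (\<integral>\<^sup>+ X. (\<Prod>i<n. \<integral>\<^sup>+ e. ennreal (exp ((s * \<epsilon> * w X i) * e)) \<partial>noise \<sigma>)
        \<partial>PiM {..<n} (\<lambda>_. mvn p \<Sigma>))"
    by (intro nn_integral_cong N.product_nn_integral_prod) auto
  also have "\<dots> = (\<integral>\<^sup>+ X. ennreal (exp (s\<^sup>2 / 2 * (\<sigma>\<^sup>2 * (\<Sum>i<n. (w X i)\<^sup>2))))
        \<partial>PiM {..<n} (\<lambda>_. mvn p \<Sigma>))"
    unfolding exp_noise[OF sigma] power_mult_distrib \<epsilon>2
    by (simp add: prod_ennreal exp_sum[symmetric] sum_distrib_left mult.commute mult.left_commute)
  also have "\<dots> \<le> (\<integral>\<^sup>+ X. ennreal (exp (s\<^sup>2 / 2 * W)) \<partial>PiM {..<n} (\<lambda>_. mvn p \<Sigma>))"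
    using W by (intro nn_integral_mono ennreal_leI) (auto intro!: mult_left_mono)
  also have "\<dots> = ennreal (exp (s\<^sup>2 / 2 * W))"
    by (simp add: C'.emeasure_space_1)
  finally have "measure (data_law n p \<theta>) {z \<in> space (data_space n p).
      s * r \<le> s * (\<epsilon> * (\<Sum>i<n. w (\<lambda>i. snd (z i)) i * residual (z i)))}
      \<le> exp (s\<^sup>2 / 2 * W) * exp (- (s * r))"
    by (intro chernoff) auto
  also have "{z \<in> space (data_space n p).
      s * r \<le> s * (\<epsilon> * (\<Sum>i<n. w (\<lambda>i. snd (z i)) i * residual (z i)))}
    = {z \<in> space (data_space n p). r \<le> \<epsilon> * (\<Sum>i<n. w (\<lambda>i. snd (z i)) i * residual (z i))}"
    using s0 by simp
  also have "exp (s\<^sup>2 / 2 * W) * exp (- (s * r)) = exp (- (r\<^sup>2 / (2 * W)))"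
    unfolding exp_add[symmetric] using W by (simp add: s_def power2_eq_square field_simps)
  finally show "measure (data_law n p \<theta>) {z \<in> space (data_space n p).
      r \<le> \<epsilon> * (\<Sum>i<n. w (\<lambda>i. snd (z i)) i * residual (z i))} \<le> exp (- (r\<^sup>2 / (2 * W)))" .
qed

end

subsection \<open>Debiasing: the deterministic estimate\<close>

text \<open>The bilinear form of \<open>X^T X\<close> without the factor \<open>1 / n\<close>;
  population values therefore appear below as \<open>n\<close> times a form.\<close>

definition gram :: "nat \<Rightarrow> nat \<Rightarrow> (nat \<Rightarrow> nat \<Rightarrow> real) \<Rightarrow> (nat \<Rightarrow> real) \<Rightarrow> (nat \<Rightarrow> real) \<Rightarrow> real" where
  "gram n p X v w = (\<Sum>i<n. ip p v (X i) * ip p w (X i))"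

definition unit :: "nat \<Rightarrow> nat \<Rightarrow> real" where
  "unit j i = (if i = j then 1 else 0)"

lemma ip_unit: "j < p \<Longrightarrow> ip p (unit j) x = x j"
  by (simp add: ip_def unit_def if_distrib[of "\<lambda>a. a * _"] sum.delta cong: if_cong)

lemma gram_expand: "gram n p X v w = (\<Sum>j<p. v j * gram n p X (unit j) w)"
proof -
  have "gram n p X v w = (\<Sum>i<n. \<Sum>j<p. v j * (X i j * ip p w (X i)))"
    by (simp add: gram_def ip_def[of p v] sum_distrib_right mult.assoc)
  also have "\<dots> = (\<Sum>j<p. \<Sum>i<n. v j * (X i j * ip p w (X i)))" by (rule sum.swap)
  finally show ?thesis by (simp add: gram_def ip_unit sum_distrib_left)
qed

lemma gram_commute: "gram n p X v w = gram n p X w v"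
  by (simp add: gram_def mult.commute)

text \<open>Reduces the concentration of all entries of the Gram matrix to that of sums of
  squares.\<close>

lemma gram_polarize:
  "4 * gram n p X v w = gram n p X (\<lambda>i. v i + w i) (\<lambda>i. v i + w i)
    - gram n p X (\<lambda>i. v i - w i) (\<lambda>i. v i - w i)"
  by (simp add: gram_def ip_add_left ip_diff_left sum_distrib_left flip: sum_subtractf)
    (simp add: algebra_simps)

text \<open>Cauchy-Schwarz on the support of \<open>d\<close>.\<close>

lemma l1_sq_le:
  fixes d :: "nat \<Rightarrow> real"
  assumes "card {j. j < p \<and> d j \<noteq> 0} \<le> s"
  shows "(\<Sum>j<p. \<bar>d j\<bar>)\<^sup>2 \<le> real s * ip p d d"
proof -
  let ?S = "{j. j < p \<and> d j \<noteq> 0}"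
  have "(\<Sum>j<p. \<bar>d j\<bar>) = (\<Sum>j\<in>?S. \<bar>d j\<bar> * 1)"
    by (rule sum.mono_neutral_cong_right) auto
  then have "(\<Sum>j<p. \<bar>d j\<bar>)\<^sup>2 \<le> (\<Sum>j\<in>?S. \<bar>d j\<bar>\<^sup>2) * (\<Sum>j\<in>?S. 1\<^sup>2)"
    using Cauchy_Schwarz_ineq_sum[of "\<lambda>j. \<bar>d j\<bar>" "\<lambda>_. 1" ?S] by simp
  also have "(\<Sum>j\<in>?S. \<bar>d j\<bar>\<^sup>2) = ip p d d"
    unfolding ip_def by (rule sum.mono_neutral_cong_left) (auto simp: power2_eq_square)
  also have "ip p d d * (\<Sum>j\<in>?S. 1\<^sup>2) \<le> ip p d d * real s"
    using assms ip_self_nonneg[of p d] by (intro mult_left_mono) auto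
  finally show ?thesis by (simp add: mult.commute)
qed

lemma abs_sum_le_l1:
  fixes d a :: "nat \<Rightarrow> real"
  assumes "\<And>j. j < p \<Longrightarrow> d j \<noteq> 0 \<Longrightarrow> \<bar>a j\<bar> \<le> c"
  shows "\<bar>\<Sum>j<p. d j * a j\<bar> \<le> c * (\<Sum>j<p. \<bar>d j\<bar>)"
proof -
  have "\<bar>\<Sum>j<p. d j * a j\<bar> \<le> (\<Sum>j<p. \<bar>d j * a j\<bar>)" by (rule sum_abs)
  also have "\<dots> \<le> (\<Sum>j<p. c * \<bar>d j\<bar>)"
  proof (rule sum_mono)
    fix j assume "j \<in> {..<p}"
    then have "\<bar>d j\<bar> * \<bar>a j\<bar> \<le> \<bar>d j\<bar> * c"
      using assms[of j] by (cases "d j = 0") (auto intro: mult_left_mono)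
    then show "\<bar>d j * a j\<bar> \<le> c * \<bar>d j\<bar>" by (simp add: abs_mult mult.commute)
  qed
  finally show ?thesis by (simp add: sum_distrib_left)
qed

lemma card_support_diff:
  fixes b c :: "nat \<Rightarrow> real"
  assumes "card {j. j < p \<and> b j \<noteq> 0} \<le> k" "card {j. j < p \<and> c j \<noteq> 0} \<le> k"
  shows "card {j. j < p \<and> b j - c j \<noteq> 0} \<le> 2 * k"
proof -
  have "card {j. j < p \<and> b j - c j \<noteq> 0} \<le> card ({j. j < p \<and> b j \<noteq> 0} \<union> {j. j < p \<and> c j \<noteq> 0})"
    by (intro card_mono) auto
  also have "\<dots> \<le> card {j. j < p \<and> b j \<noteq> 0} + card {j. j < p \<and> c j \<noteq> 0}" by (rule card_Un_le)
  finally show ?thesis using assms by linarith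
qed

text \<open>In the ultra-sparse regime the entrywise error of the Gram matrix is small enough for
  it to be well conditioned on sparse vectors; no restricted eigenvalue theory is needed.\<close>

lemma sparse_l1_bound:
  assumes n: "0 < n" and M: "0 < M" and d: "card {j. j < p \<and> d j \<noteq> 0} \<le> 2 * k"
    and score: "\<And>j. j < p \<Longrightarrow> \<bar>gram n p X (unit j) d\<bar> \<le> real n * (2 * K * L)"
    and gram: "\<And>i j. i < p \<Longrightarrow> j < p \<Longrightarrow>
      \<bar>gram n p X (unit i) (unit j) - real n * S i j\<bar> \<le> real n * (16 * M * L)"
    and S: "ip p d d \<le> M * quad p S d" and small: "64 * M\<^sup>2 * real k * L \<le> 1"
    and K: "0 \<le> K" and L: "0 \<le> L"
  shows "(\<Sum>j<p. \<bar>d j\<bar>) \<le> 8 * real k * M * K * L"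
proof -
  define N where "N = (\<Sum>j<p. \<bar>d j\<bar>)"
  have N0: "0 \<le> N" by (simp add: N_def sum_nonneg)
  have sq: "N\<^sup>2 \<le> 2 * real k * ip p d d" using l1_sq_le[OF d] by (simp add: N_def)
  have up: "gram n p X d d \<le> real n * (2 * K * L) * N"
    using abs_sum_le_l1[of p d "\<lambda>j. gram n p X (unit j) d" "real n * (2 * K * L)"] score
    by (simp add: gram_expand[of n p X d d] N_def)
  have "\<bar>gram n p X d d - real n * quad p S d\<bar> \<le> real n * (16 * M * L) * N * N"
  proof -
    have "gram n p X (unit i) d = (\<Sum>j<p. d j * gram n p X (unit i) (unit j))" for i
      by (subst gram_commute, subst gram_expand) (simp only: gram_commute[of n p X _ "unit i"])
    then have "gram n p X d d = (\<Sum>i<p. d i * (\<Sum>j<p. d j * gram n p X (unit i) (unit j)))"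
      by (subst gram_expand) simp
    moreover have "real n * quad p S d = (\<Sum>i<p. d i * (\<Sum>j<p. d j * (real n * S i j)))"
      by (simp add: quad_def sum_distrib_left algebra_simps)
    ultimately have "gram n p X d d - real n * quad p S d
        = (\<Sum>i<p. d i * (\<Sum>j<p. d j * (gram n p X (unit i) (unit j) - real n * S i j)))"
      by (simp add: sum_subtractf right_diff_distrib)
    also have "\<bar>\<dots>\<bar> \<le> (real n * (16 * M * L) * N) * N"
      unfolding N_def by (intro abs_sum_le_l1 gram) auto
    finally show ?thesis by simp
  qed
  then have "real n * quad p S d \<le> real n * (2 * K * L) * N + real n * (16 * M * L) * N * N"
    using up by linarith
  then have "real n * quad p S d \<le> real n * (2 * K * L * N + 16 * M * L * N\<^sup>2)"
    by (simp add: algebra_simps power2_eq_square)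
  then have "quad p S d \<le> 2 * K * L * N + 16 * M * L * N\<^sup>2" using n by simp
  then have "ip p d d \<le> M * (2 * K * L * N + 16 * M * L * N\<^sup>2)"
    using S M by (meson mult_left_mono less_imp_le order_trans)
  also have "16 * M * L * N\<^sup>2 \<le> 16 * M * L * (2 * real k * ip p d d)"
    using sq M L by (intro mult_left_mono) auto
  finally have "ip p d d \<le> 2 * M * K * L * N + (32 * M\<^sup>2 * real k * L) * ip p d d"
    using M by (simp add: algebra_simps power2_eq_square)
  \<comment> \<open>The Gram error is at most half of the left side and is absorbed there.\<close>
  moreover have "(32 * M\<^sup>2 * real k * L) * ip p d d \<le> (1 / 2) * ip p d d"
    using small ip_self_nonneg[of p d] by (intro mult_right_mono) auto
  ultimately have "ip p d d \<le> 4 * M * K * L * N" by linarith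
  then have "2 * real k * ip p d d \<le> 2 * real k * (4 * M * K * L * N)"
    by (intro mult_left_mono) auto
  with sq have "N * N \<le> (8 * real k * M * K * L) * N" by (simp add: power2_eq_square algebra_simps)
  then show ?thesis
    unfolding N_def[symmetric] using N0 M K L by (cases "N = 0") auto
qed

text \<open>With \<open>d = b - c\<close>, the loading is cut at \<open>T\<close>. Past
  \<open>T\<close> it is small in sup norm while \<open>d\<close> is small in \<open>l1\<close>
  norm. Below \<open>T\<close>, \<open>n\<close> times the loading is the image of \<open>u\<close>
  under the Gram matrix up to an error that pairs with \<open>d\<close> in the same way; the main
  part \<open>u . X^T X d\<close> is the difference of the two correlations bounded in
  \<open>corr_b\<close> and \<open>corr_c\<close>. The vectors \<open>b\<close> and \<open>c\<close>
  enter symmetrically, and neither has to be the truth.\<close>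

lemma debiased_error:
  assumes n: "0 < n" and M: "0 < M" and h: "0 \<le> h" and k: "0 < k" and lp: "0 < lp"
    and L: "L = sqrt (lp / real n)" and K: "0 \<le> K" "0 \<le> K'"
    and b: "card {j. j < p \<and> b j \<noteq> 0} \<le> k" and c: "card {j. j < p \<and> c j \<noteq> 0} \<le> k"
    and score_b: "\<And>j. j < p \<Longrightarrow> \<bar>\<Sum>i<n. X i j * (y i - ip p (X i) b)\<bar> \<le> real n * (K * L)"
    and score_c: "\<And>j. j < p \<Longrightarrow> \<bar>\<Sum>i<n. X i j * (y i - ip p (X i) c)\<bar> \<le> real n * (K * L)"
    and gram: "\<And>i j. i < p \<Longrightarrow> j < p \<Longrightarrow>
      \<bar>gram n p X (unit i) (unit j) - real n * S i j\<bar> \<le> real n * (16 * M * L)"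
    and S: "\<And>d. ip p d d \<le> M * quad p S d" and small: "64 * M\<^sup>2 * real k * L \<le> 1"
    and sparse: "real k * lp \<le> C * sqrt (real n)"
    and u: "\<And>j. j < p \<Longrightarrow>
      \<bar>gram n p X (unit j) u - real n * (if j < T then \<xi> j else 0)\<bar> \<le> real n * (16 * M * h * L)"
    and corr_b: "\<bar>\<Sum>i<n. ip p u (X i) * (y i - ip p (X i) b)\<bar> \<le> K' * h * sqrt (real n)"
    and corr_c: "\<bar>\<Sum>i<n. ip p u (X i) * (y i - ip p (X i) c)\<bar> \<le> K' * h * sqrt (real n)"
    and tail: "\<And>j. T \<le> j \<Longrightarrow> j < p \<Longrightarrow> real k * sqrt lp * \<bar>\<xi> j\<bar> \<le> h"
  shows "\<bar>ip p \<xi> b - ip p \<xi> c\<bar> \<le> (8 * M * K + 128 * M\<^sup>2 * K * C + 2 * K') * h / sqrt (real n)"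
proof -
  define d where "d j = b j - c j" for j
  define N where "N = (\<Sum>j<p. \<bar>d j\<bar>)"
  have N0: "0 \<le> N" by (simp add: N_def sum_nonneg)
  have L0: "0 \<le> L" using L lp by simp
  have L2: "L\<^sup>2 = lp / real n" using L lp by simp
  \<comment> \<open>The response cancels in the difference of the two residual vectors.\<close>
  have diff: "(\<Sum>i<n. w i * ip p d (X i))
      = (\<Sum>i<n. w i * (y i - ip p (X i) c)) - (\<Sum>i<n. w i * (y i - ip p (X i) b))" for w
    unfolding d_def ip_diff_left sum_subtractf[symmetric]
    by (intro sum.cong refl) (simp add: ip_commute[of p "X _"] algebra_simps)
  have N: "N \<le> 8 * real k * M * K * L"
    unfolding N_def
  proof (rule sparse_l1_bound[OF n M _ _ gram S small K(1) L0])
    show "card {j. j < p \<and> d j \<noteq> 0} \<le> 2 * k"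
      unfolding d_def by (rule card_support_diff[OF b c])
    fix j assume j: "j < p"
    have "gram n p X (unit j) d = (\<Sum>i<n. X i j * ip p d (X i))" using j by (simp add: gram_def ip_unit)
    then show "\<bar>gram n p X (unit j) d\<bar> \<le> real n * (2 * K * L)"
      using diff[of "\<lambda>i. X i j"] score_b[OF j] score_c[OF j] by (simp add: algebra_simps)
  qed
  let ?l = "\<lambda>j. if j < T then \<xi> j else 0"
  have "\<bar>\<Sum>j<p. d j * (\<xi> j - ?l j)\<bar> \<le> h / (real k * sqrt lp) * N"
    unfolding N_def
  proof (rule abs_sum_le_l1)
    show "\<bar>\<xi> j - ?l j\<bar> \<le> h / (real k * sqrt lp)" if "j < p" for j
      using tail[of j] that k lp h by (auto simp: field_simps not_less)
  qed
  also have "\<dots> \<le> h / (real k * sqrt lp) * (8 * real k * M * K * L)"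
    using N h lp by (intro mult_left_mono) auto
  \<comment> \<open>The factors \<open>k\<close> and \<open>sqrt lp\<close> cancel; this fixes the
    cutoff \<open>k^2 lp\<close>.\<close>
  also have "\<dots> = 8 * M * K * h / sqrt (real n)"
    using k lp by (simp add: L real_sqrt_divide)
  finally have tl: "\<bar>\<Sum>j<p. d j * (\<xi> j - ?l j)\<bar> \<le> 8 * M * K * h / sqrt (real n)" .
  have "\<bar>\<Sum>j<p. d j * (gram n p X (unit j) u - real n * ?l j)\<bar> \<le> real n * (16 * M * h * L) * N"
    unfolding N_def by (intro abs_sum_le_l1 u)
  also have "\<dots> \<le> real n * (16 * M * h * L) * (8 * real k * M * K * L)"
    using N M h L0 by (intro mult_left_mono) auto
  also have "\<dots> = 128 * M\<^sup>2 * K * h * (real n * L\<^sup>2 * real k)"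
    by (simp add: power2_eq_square algebra_simps)
  \<comment> \<open>By \<open>n L^2 = lp\<close> the debiasing error is a multiple of
    \<open>k * lp\<close>, which the ultra-sparse regime bounds by \<open>C sqrt n\<close>.\<close>
  also have "\<dots> = 128 * M\<^sup>2 * K * h * (real k * lp)" using n by (simp add: L2 mult.commute)
  also have "\<dots> \<le> 128 * M\<^sup>2 * K * h * (C * sqrt (real n))"
    using sparse K h by (intro mult_left_mono) auto
  finally have 1: "\<bar>\<Sum>j<p. d j * (gram n p X (unit j) u - real n * ?l j)\<bar>
      \<le> 128 * M\<^sup>2 * K * h * (C * sqrt (real n))" .
  have "(\<Sum>j<p. d j * gram n p X (unit j) u) = (\<Sum>i<n. ip p u (X i) * ip p d (X i))"
    by (subst gram_expand[symmetric]) (simp add: gram_def mult.commute)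
  then have 2: "\<bar>\<Sum>j<p. d j * gram n p X (unit j) u\<bar> \<le> 2 * K' * h * sqrt (real n)"
    using diff[of "\<lambda>i. ip p u (X i)"] corr_b corr_c by simp
  have "real n * (\<Sum>j<p. d j * ?l j) = (\<Sum>j<p. d j * gram n p X (unit j) u)
      - (\<Sum>j<p. d j * (gram n p X (unit j) u - real n * ?l j))"
    by (simp only: right_diff_distrib sum_subtractf sum_distrib_left) (simp add: mult.left_commute)
  then have "real n * \<bar>\<Sum>j<p. d j * ?l j\<bar>
      \<le> 128 * M\<^sup>2 * K * h * (C * sqrt (real n)) + 2 * K' * h * sqrt (real n)"
  proof -
    assume e: "real n * (\<Sum>j<p. d j * ?l j) = (\<Sum>j<p. d j * gram n p X (unit j) u)
      - (\<Sum>j<p. d j * (gram n p X (unit j) u - real n * ?l j))"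
    have "real n * \<bar>\<Sum>j<p. d j * ?l j\<bar> = \<bar>real n * (\<Sum>j<p. d j * ?l j)\<bar>" by (simp add: abs_mult)
    then show ?thesis using 1 2 unfolding e by linarith
  qed
  also have "\<dots> = real n * ((128 * M\<^sup>2 * K * C + 2 * K') * h / sqrt (real n))"
  proof -
    define r where "r = sqrt (real n)"
    have "real n = r * r" "r \<noteq> 0" using n by (auto simp: r_def)
    then show ?thesis unfolding r_def[symmetric] by (simp add: field_simps)
  qed
  finally have "\<bar>\<Sum>j<p. d j * ?l j\<bar> \<le> (128 * M\<^sup>2 * K * C + 2 * K') * h / sqrt (real n)"
    using n by (simp only: mult_le_cancel_left_pos of_nat_0_less_iff)
  moreover have "ip p \<xi> b - ip p \<xi> c = (\<Sum>j<p. d j * (\<xi> j - ?l j)) + (\<Sum>j<p. d j * ?l j)"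
    by (simp add: ip_def d_def algebra_simps flip: sum.distrib sum_subtractf)
  ultimately show ?thesis using tl by (simp add: add_divide_distrib distrib_right)
qed

subsection \<open>The test\<close>

text \<open>Rounding down to the grid of mesh \<open>1 / (m + 1)\<close> fixes zero, so the
  approximants keep the sparsity of \<open>v\<close>.\<close>

lemma rational_approximation:
  fixes v :: "nat \<Rightarrow> real"
  obtains b where "\<And>m. b m \<in> Pi\<^sub>E {..<p} (\<lambda>_. \<rat>)" "\<And>m j. j < p \<Longrightarrow> v j = 0 \<Longrightarrow> b m j = 0"
    "\<And>x. (\<lambda>m. ip p x (b m)) \<longlonglongrightarrow> ip p x v"
proof
  define b where "b m = (\<lambda>j\<in>{..<p}. of_int \<lfloor>v j * real (Suc m)\<rfloor> / real (Suc m))" for m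
  show "b m \<in> Pi\<^sub>E {..<p} (\<lambda>_. \<rat>)" for m by (auto simp: b_def intro!: Rats_divide)
  show "b m j = 0" if "j < p" "v j = 0" for m j using that by (simp add: b_def)
  have lim: "(\<lambda>m. b m j) \<longlonglongrightarrow> v j" if "j < p" for j
  proof (rule LIMSEQ_I)
    fix e :: real assume "0 < e"
    then obtain N where N: "inverse (real (Suc N)) < e" using reals_Archimedean by blast
    show "\<exists>N. \<forall>m\<ge>N. norm (b m j - v j) < e"
    proof (intro exI allI impI)
      fix m assume "N \<le> m"
      have "\<bar>of_int \<lfloor>v j * real (Suc m)\<rfloor> - v j * real (Suc m)\<bar> \<le> 1" by linarith
      then have "\<bar>of_int \<lfloor>v j * real (Suc m)\<rfloor> - v j * real (Suc m)\<bar> / real (Suc m) \<le> 1 / real (Suc m)"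
        by (intro divide_right_mono) auto
      moreover have "of_int \<lfloor>v j * real (Suc m)\<rfloor> / real (Suc m) - v j
          = (of_int \<lfloor>v j * real (Suc m)\<rfloor> - v j * real (Suc m)) / real (Suc m)"
        by (simp add: diff_divide_distrib del: of_nat_Suc)
      ultimately have "\<bar>of_int \<lfloor>v j * real (Suc m)\<rfloor> / real (Suc m) - v j\<bar> \<le> inverse (real (Suc m))"
        by (simp add: inverse_eq_divide)
      also have "\<dots> \<le> inverse (real (Suc N))" using \<open>N \<le> m\<close> by (simp add: le_imp_inverse_le)
      finally show "norm (b m j - v j) < e" using N that by (simp add: b_def)
    qed
  qed
  show "(\<lambda>m. ip p x (b m)) \<longlonglongrightarrow> ip p x v" for x
    unfolding ip_def by (intro tendsto_sum tendsto_mult tendsto_const lim) auto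
qed

lemma countable_rational_functions: "countable (Pi\<^sub>E {..<p::nat} (\<lambda>_. \<rat> :: real set))"
  by (intro countable_PiE) (auto simp: countable_rat)

text \<open>Strict inequalities make the set of feasible \<open>u\<close> open, so a real solution
  yields a rational one. The second condition bounds the variance of the noise in the debiased
  statistic.\<close>

definition feasible :: "nat \<Rightarrow> nat \<Rightarrow> nat \<Rightarrow> (nat \<Rightarrow> real) \<Rightarrow> real \<Rightarrow> real \<Rightarrow> real
    \<Rightarrow> (nat \<Rightarrow> nat \<Rightarrow> real) \<Rightarrow> (nat \<Rightarrow> real) \<Rightarrow> bool" where
  "feasible n p T \<xi> M h L X u \<longleftrightarrow>
    (\<forall>j<p. \<bar>gram n p X (unit j) u - real n * (if j < T then \<xi> j else 0)\<bar> < real n * (16 * M * h * L))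
    \<and> gram n p X u u < real n * (2 * M * h\<^sup>2)"

text \<open>The debiasing direction is the first feasible rational vector, which makes it a
  measurable function of the design alone.\<close>

definition direction :: "nat \<Rightarrow> nat \<Rightarrow> nat \<Rightarrow> (nat \<Rightarrow> real) \<Rightarrow> real \<Rightarrow> real \<Rightarrow> real
    \<Rightarrow> (nat \<Rightarrow> nat \<Rightarrow> real) \<Rightarrow> nat \<Rightarrow> real" where
  "direction n p T \<xi> M h L X =
    (let u = from_nat_into (Pi\<^sub>E {..<p} (\<lambda>_. \<rat>)); P = (\<lambda>m. feasible n p T \<xi> M h L X (u m))
     in if \<exists>m. P m then u (LEAST m. P m) else (\<lambda>_. 0))"

lemma gram_cong: "(\<And>i. i < n \<Longrightarrow> X i = X' i) \<Longrightarrow> gram n p X v w = gram n p X' v w"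
  by (simp add: gram_def)

lemma direction_cong:
  assumes "\<And>i. i < n \<Longrightarrow> X i = X' i"
  shows "direction n p T \<xi> M h L X = direction n p T \<xi> M h L X'"
proof -
  have "gram n p X = gram n p X'" by (intro ext gram_cong assms)
  then show ?thesis by (simp add: direction_def feasible_def)
qed

text \<open>No event is involved: the default vector \<open>0\<close> also obeys the variance bound,
  as \<open>weighted_noise_tail\<close> asks of every design.\<close>

lemma gram_direction_le: "0 \<le> M \<Longrightarrow>
    gram n p X (direction n p T \<xi> M h L X) (direction n p T \<xi> M h L X) \<le> real n * (2 * M * h\<^sup>2)"
proof (cases "\<exists>m. feasible n p T \<xi> M h L X (from_nat_into (Pi\<^sub>E {..<p} (\<lambda>_. \<rat>)) m)")
  case True
  from LeastI_ex[OF True] True show ?thesis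
    by (auto simp only: direction_def Let_def feasible_def if_True less_imp_le)
next
  case False
  assume "0 \<le> M"
  then show ?thesis using False by (simp add: direction_def gram_def ip_def)
qed

lemma feasible_direction:
  assumes "feasible n p T \<xi> M h L X w"
  shows "feasible n p T \<xi> M h L X (direction n p T \<xi> M h L X)"
proof -
  let ?R = "Pi\<^sub>E {..<p} (\<lambda>_. \<rat> :: real set)"
  obtain b where b: "\<And>m. b m \<in> ?R" and lim: "\<And>x. (\<lambda>m. ip p x (b m)) \<longlonglongrightarrow> ip p x w"
    by (rule rational_approximation[of p w]) blast
  have lim': "(\<lambda>m. ip p (b m) x) \<longlonglongrightarrow> ip p w x" for x
    using lim[of x] by (simp add: ip_commute)
  have g1: "(\<lambda>m. gram n p X v (b m)) \<longlonglongrightarrow> gram n p X v w" for v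
    unfolding gram_def by (intro tendsto_sum tendsto_mult tendsto_const lim')
  have g2: "(\<lambda>m. gram n p X (b m) (b m)) \<longlonglongrightarrow> gram n p X w w"
    unfolding gram_def by (intro tendsto_sum tendsto_mult lim')
  have "\<forall>\<^sub>F m in sequentially. \<bar>gram n p X (unit j) (b m) - real n * (if j < T then \<xi> j else 0)\<bar>
      < real n * (16 * M * h * L)" if "j < p" for j
    by (rule order_tendstoD(2)[OF tendsto_rabs[OF tendsto_diff[OF g1 tendsto_const]]])
      (use assms that in \<open>simp add: feasible_def\<close>)
  then have "\<forall>\<^sub>F m in sequentially. \<forall>j\<in>{..<p}.
      \<bar>gram n p X (unit j) (b m) - real n * (if j < T then \<xi> j else 0)\<bar> < real n * (16 * M * h * L)"
    by (intro eventually_ball_finite) auto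
  moreover have "\<forall>\<^sub>F m in sequentially. gram n p X (b m) (b m) < real n * (2 * M * h\<^sup>2)"
    by (rule order_tendstoD(2)[OF g2]) (use assms in \<open>simp add: feasible_def\<close>)
  ultimately have "\<forall>\<^sub>F m in sequentially. feasible n p T \<xi> M h L X (b m)"
    by eventually_elim (simp add: feasible_def)
  then obtain m where m: "feasible n p T \<xi> M h L X (b m)"
    using eventually_happens'[OF sequentially_bot] by blast
  obtain i where "from_nat_into ?R i = b m"
    using from_nat_into_surj[OF countable_rational_functions b] by blast
  with m have ex: "\<exists>i. feasible n p T \<xi> M h L X (from_nat_into ?R i)" by metis
  from LeastI_ex[OF ex] ex show ?thesis by (simp add: direction_def Let_def)
qed

lemma measurable_design_row:
  "i < n \<Longrightarrow> (\<lambda>X. X i) \<in> PiM {..<n} (\<lambda>_. PiM {..<p} (\<lambda>_. borel)) \<rightarrow>\<^sub>M PiM {..<p} (\<lambda>_. borel)"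
  by (rule measurable_component_singleton) simp

lemma gram_measurable [measurable]:
  "(\<lambda>X. gram n p X v w) \<in> borel_measurable (PiM {..<n} (\<lambda>_. PiM {..<p} (\<lambda>_. borel)))"
  unfolding gram_def
  by (intro borel_measurable_sum borel_measurable_times
      measurable_compose[OF measurable_design_row ip_measurable_borel]) auto

lemma feasible_measurable [measurable]:
  "Measurable.pred (PiM {..<n} (\<lambda>_. PiM {..<p} (\<lambda>_. borel))) (\<lambda>X. feasible n p T \<xi> M h L X u)"
  unfolding feasible_def by measurable

text \<open>The index of the first feasible vector is a measurable map into a countable set, and for
  each fixed index the value is measurable.\<close>

lemma direction_measurable:
  assumes "i < n"
  shows "(\<lambda>X. ip p (direction n p T \<xi> M h L X) (X i))
    \<in> borel_measurable (PiM {..<n} (\<lambda>_. PiM {..<p} (\<lambda>_. borel)))"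
proof -
  let ?D = "PiM {..<n} (\<lambda>_. PiM {..<p} (\<lambda>_. borel :: real measure))"
  let ?u = "from_nat_into (Pi\<^sub>E {..<p} (\<lambda>_. \<rat> :: real set))"
  let ?P = "\<lambda>m X. feasible n p T \<xi> M h L X (?u m)"
  have 1: "(\<lambda>X. ip p (?u (LEAST m. ?P m X)) (X i)) \<in> borel_measurable ?D"
    by (rule measurable_compose_countable[where g = "\<lambda>X. LEAST m. ?P m X"
          and f = "\<lambda>m X. ip p (?u m) (X i)"])
      (auto intro!: measurable_compose[OF measurable_design_row[OF assms] ip_measurable_borel])
  have 2: "Measurable.pred ?D (\<lambda>X. \<exists>m. ?P m X)" by measurable
  have "(\<lambda>X. ip p (direction n p T \<xi> M h L X) (X i))
      = (\<lambda>X. if \<exists>m. ?P m X then ip p (?u (LEAST m. ?P m X)) (X i) else 0)"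
    by (rule ext) (simp add: direction_def ip_def Let_def)
  then show ?thesis using 1 2 by (auto intro!: measurable_If simp: pred_def)
qed

lemma quad_add_diff:
  assumes "\<And>i. i < p \<Longrightarrow> (\<Sum>j<p. a i j * w j) = v i"
    and "\<And>i j. i < p \<Longrightarrow> j < p \<Longrightarrow> a i j = a j i"
  shows "quad p a (\<lambda>i. x i + w i) - quad p a (\<lambda>i. x i - w i) = 4 * ip p v x"
    and "quad p a (\<lambda>i. x i + w i) + quad p a (\<lambda>i. x i - w i) = 2 * quad p a x + 2 * quad p a w"
  using quad_minus[OF assms, where x = x and t = 1] quad_minus[OF assms, where x = x and t = "- 1"]
    quad_eq_ip[OF assms(1)] by auto

text \<open>Rational vectors may miss the hyperplane of the null hypothesis, hence the slack
  \<open>r\<close>. Countability of the set makes the acceptance region measurable.\<close>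

definition test_set :: "nat \<Rightarrow> real \<Rightarrow> nat \<Rightarrow> (nat \<Rightarrow> real) \<Rightarrow> real \<Rightarrow> (nat \<Rightarrow> real) set" where
  "test_set p r k \<xi> t = {b \<in> Pi\<^sub>E {..<p} (\<lambda>_. \<rat>). card {j. j < p \<and> b j \<noteq> 0} \<le> k \<and> \<bar>ip p \<xi> b - t\<bar> \<le> r}"

text \<open>The sup-norm score constraint of the Dantzig selector, with one more inequality in the
  debiasing direction \<open>u\<close>. At the true coefficients the residuals are pure
  noise.\<close>

definition compatible :: "nat \<Rightarrow> nat \<Rightarrow> real \<Rightarrow> real \<Rightarrow> (nat \<Rightarrow> real) \<Rightarrow> (nat \<Rightarrow> obs) \<Rightarrow> (nat \<Rightarrow> real) \<Rightarrow> bool" where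
  "compatible n p B B' u z b \<longleftrightarrow>
    (\<forall>j<p. \<bar>\<Sum>i<n. snd (z i) j * (fst (z i) - ip p (snd (z i)) b)\<bar> < B) \<and>
    \<bar>\<Sum>i<n. ip p u (snd (z i)) * (fst (z i) - ip p (snd (z i)) b)\<bar> < B'"

text \<open>The inequalities in \<open>compatible\<close> are strict, so rational vectors close to
  \<open>\<beta>\<close> inherit them; their support lies in that of \<open>\<beta>\<close>.\<close>

lemma compatible_rational:
  assumes "compatible n p B B' u z \<beta>" and card: "card {j. j < p \<and> \<beta> j \<noteq> 0} \<le> k"
    and "ip p \<xi> \<beta> = t" "0 < r"
  shows "\<exists>b\<in>test_set p r k \<xi> t. compatible n p B B' u z b"
proof -
  obtain b where b: "\<And>m. b m \<in> Pi\<^sub>E {..<p} (\<lambda>_. \<rat>)" "\<And>m j. j < p \<Longrightarrow> \<beta> j = 0 \<Longrightarrow> b m j = 0"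
    and lim: "\<And>x. (\<lambda>m. ip p x (b m)) \<longlonglongrightarrow> ip p x \<beta>"
    by (rule rational_approximation[of p \<beta>]) blast
  have l: "(\<lambda>m. \<bar>\<Sum>i<n. w i * (fst (z i) - ip p (snd (z i)) (b m))\<bar>)
      \<longlonglongrightarrow> \<bar>\<Sum>i<n. w i * (fst (z i) - ip p (snd (z i)) \<beta>)\<bar>" for w
    by (intro tendsto_rabs tendsto_sum tendsto_mult tendsto_diff tendsto_const lim)
  have "\<forall>\<^sub>F m in sequentially. \<forall>j\<in>{..<p}.
      \<bar>\<Sum>i<n. snd (z i) j * (fst (z i) - ip p (snd (z i)) (b m))\<bar> < B"
    by (intro eventually_ball_finite ballI order_tendstoD(2)[OF l])
      (use assms in \<open>auto simp: compatible_def\<close>)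
  moreover have "\<forall>\<^sub>F m in sequentially.
      \<bar>\<Sum>i<n. ip p u (snd (z i)) * (fst (z i) - ip p (snd (z i)) (b m))\<bar> < B'"
    by (intro order_tendstoD(2)[OF l]) (use assms in \<open>auto simp: compatible_def\<close>)
  moreover have "\<forall>\<^sub>F m in sequentially. \<bar>ip p \<xi> (b m) - t\<bar> < r"
    by (rule order_tendstoD(2)[OF tendsto_rabs[OF tendsto_diff[OF lim tendsto_const]]])
      (use assms in simp)
  ultimately have "\<forall>\<^sub>F m in sequentially. \<bar>ip p \<xi> (b m) - t\<bar> < r \<and> compatible n p B B' u z (b m)"
    by eventually_elim (simp add: compatible_def)
  then obtain m where m: "\<bar>ip p \<xi> (b m) - t\<bar> < r" "compatible n p B B' u z (b m)"
    using eventually_happens'[OF sequentially_bot] by blast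
  have "card {j. j < p \<and> b m j \<noteq> 0} \<le> card {j. j < p \<and> \<beta> j \<noteq> 0}"
    using b(2) by (intro card_mono) auto
  then show ?thesis using b(1)[of m] m card by (auto simp: test_set_def)
qed

lemma design_measurable:
  "(\<lambda>z. \<lambda>i\<in>{..<n}. snd (z i)) \<in> data_space n p \<rightarrow>\<^sub>M PiM {..<n} (\<lambda>_. PiM {..<p} (\<lambda>_. borel))"
proof (rule measurable_restrict)
  fix i assume "i \<in> {..<n}"
  then have "(\<lambda>z. z i) \<in> data_space n p \<rightarrow>\<^sub>M obs_space p"
    by (intro measurable_obs_component) simp
  then show "(\<lambda>z. snd (z i)) \<in> data_space n p \<rightarrow>\<^sub>M PiM {..<p} (\<lambda>_. borel)"
    by (rule measurable_compose[OF _ measurable_covariates])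
qed

lemma compatible_measurable:
  "Measurable.pred (data_space n p)
    (\<lambda>z. compatible n p B B' (direction n p T \<xi> M h L (\<lambda>i. snd (z i))) z b)"
proof -
  note z = measurable_obs_component
  have x: "(\<lambda>z. snd (z i)) \<in> data_space n p \<rightarrow>\<^sub>M PiM {..<p} (\<lambda>_. borel)" if "i < n" for i
    by (rule measurable_compose[OF z[OF that] measurable_covariates])
  have [measurable]: "(\<lambda>z. snd (z i) j) \<in> borel_measurable (data_space n p)" if "i < n" "j < p" for i j
    using that by (intro measurable_compose[OF x measurable_component_singleton]) auto
  have [measurable]: "(\<lambda>z. fst (z i)) \<in> borel_measurable (data_space n p)" if "i < n" for i
    by (rule measurable_compose[OF z[OF that] measurable_response])
  have [measurable]: "(\<lambda>z. ip p (snd (z i)) b) \<in> borel_measurable (data_space n p)" if "i < n" for i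
    by (rule measurable_compose[OF x[OF that] ip_measurable_borel'])
  have u: "direction n p T \<xi> M h L (\<lambda>i. snd (z i)) = direction n p T \<xi> M h L (\<lambda>i\<in>{..<n}. snd (z i))"
    for z :: "nat \<Rightarrow> obs" by (rule direction_cong) simp
  have [measurable]: "(\<lambda>z. ip p (direction n p T \<xi> M h L (\<lambda>i. snd (z i))) (snd (z i)))
      \<in> borel_measurable (data_space n p)" if "i < n" for i
    using measurable_compose[OF design_measurable[of n p] direction_measurable[OF that, of p T \<xi> M h L]] that
    by (simp add: u)
  show ?thesis unfolding compatible_def by measurable
qed

lemma H_sq: "\<xi> \<in> carrier_vec p \<Longrightarrow> (H t \<xi>)\<^sup>2 = (\<Sum>j<min (nat \<lceil>t\<rceil>) p. (\<xi> $ j)\<^sup>2)"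
  by (simp add: H_def sum_nonneg)

lemma H_nonneg: "0 \<le> H t \<xi>"
  by (simp add: H_def sum_nonneg)

text \<open>Origin of the constants: \<open>K\<close> turns each of the \<open>p\<close> score tails
  into \<open>2 / p^2\<close>, \<open>K'\<close> leaves \<epsilon> / 2 to the debiased noise,
  \<open>large\<close> makes the remaining \<open>12 / p\<close> at most \<epsilon> / 2, and
  \<open>L_small\<close> keeps the relative deviation \<open>8 * L\<close> in the range of
  \<open>square_tail\<close>.\<close>

locale upper = model +
  fixes M M2 lp :: real and T :: nat and \<xi> :: "nat \<Rightarrow> real" and h L K K' :: real and n :: nat
    and \<epsilon> :: real
  assumes cov: "cov_bounds M p \<Sigma>" and M: "1 < M" and sM: "\<sigma> \<le> M2"
    and n: "0 < n" and p: "2 \<le> p" and lp: "lp = ln (real p)" and L: "L = sqrt (lp / real n)"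
    and h: "0 < h" "h\<^sup>2 = (\<Sum>j<min T p. (\<xi> j)\<^sup>2)" and L_small: "32 * L \<le> 1"
    and K: "K = sqrt (8 * M) * M2"
    and K': "0 < K'" "2 * exp (- (K'\<^sup>2 / (4 * M * M2\<^sup>2))) \<le> \<epsilon> / 2"
    and large: "24 / \<epsilon> \<le> real p" and eps: "0 < \<epsilon>"
begin

lemma M2: "0 < M2" using sM sigma by linarith

lemma lp0: "0 < lp" using p by (simp add: lp)

lemma L0: "0 < L" using lp0 n by (simp add: L)

lemma nL2: "real n * L\<^sup>2 = lp" using lp0 n by (simp add: L)

abbreviation "design \<equiv> \<lambda>z :: nat \<Rightarrow> obs. \<lambda>i. snd (z i)"
abbreviation "dir X \<equiv> direction n p T \<xi> M h L X"

text \<open>The relative deviation \<open>8 * L\<close> gives the exponent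
  \<open>n * (8 * L)^2 / 16 = 4 * lp\<close>, hence probability \<open>2 / p^4\<close>, enough for a
  union over order \<open>p^2\<close> vectors. The scale \<open>4 * M\<close> bounds the form at the
  sums and differences needed for polarisation.\<close>

definition deviates :: "(nat \<Rightarrow> real) \<Rightarrow> (nat \<Rightarrow> obs) set" where
  "deviates v = {z \<in> space (data_space n p).
     real n * (8 * L) * (4 * M) \<le> \<bar>(\<Sum>i<n. (ip p v (snd (z i)))\<^sup>2) - real n * q v\<bar>}"

lemma gram_sq: "gram n p X v v = (\<Sum>i<n. (ip p v (X i))\<^sup>2)"
  by (simp add: gram_def power2_eq_square)

lemma deviates_event: "deviates v \<in> data.events n"
proof -
  have [measurable]: "(\<lambda>z. ip p v (snd (z i))) \<in> borel_measurable (data_space n p)" if "i < n" for i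
    by (intro measurable_compose[OF measurable_obs_component[OF that]]
        measurable_compose[OF measurable_covariates ip_measurable_borel])
  show ?thesis unfolding deviates_def sets_data_law by measurable
qed

lemma deviates_prob:
  assumes "q v \<le> 4 * M" shows "measure (data_law n p \<theta>) (deviates v) \<le> 2 / real p ^ 4"
proof -
  have "measure (data_law n p \<theta>) (deviates v) \<le> 2 * exp (- (real n * (8 * L)\<^sup>2 / 16))"
    unfolding deviates_def using assms M L0 L_small by (intro square_tail) auto
  also have "real n * (8 * L)\<^sup>2 / 16 = 4 * lp" using nL2 by (simp add: power_mult_distrib)
  also have "2 * exp (- (4 * lp)) = 2 / real p ^ 4"
    using p exp_of_nat_mult[of 4 lp] by (simp add: lp exp_minus field_simps)
  finally show ?thesis .
qed

lemma q_nonneg: "0 \<le> q v"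
  using posdef_pos[OF pd, of v] by (cases "\<exists>i<p. v i \<noteq> 0") (auto simp: quad_def)

lemma q_unit: "j < p \<Longrightarrow> q (unit j) \<le> M"
  using cov M by (auto simp: cov_bounds_def ip_unit unit_def dest!: spec[of _ "unit j"])

lemma Sigma_unit: "j < p \<Longrightarrow> (\<Sum>k<p. \<Sigma> $$ (i, k) * unit j k) = \<Sigma> $$ (i, j)"
  by (simp add: unit_def if_distrib cong: if_cong)

text \<open>A quarter of two errors of size \<open>n * (8 * L) * (4 * M)\<close> is
  \<open>n * (16 * M * L)\<close>.\<close>

lemma polarized:
  assumes w: "\<And>i. i < p \<Longrightarrow> (\<Sum>j<p. \<Sigma> $$ (i, j) * w j) = v i"
    and "z \<in> space (data_space n p)"
    and "z \<notin> deviates (\<lambda>i. x i + w i)" "z \<notin> deviates (\<lambda>i. x i - w i)"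
  shows "\<bar>gram n p (design z) x w - real n * ip p v x\<bar> < real n * (16 * M * L)"
proof -
  let ?a = "\<lambda>i. x i + w i" and ?b = "\<lambda>i. x i - w i"
  have "\<bar>gram n p (design z) ?a ?a - real n * q ?a\<bar> < real n * (8 * L) * (4 * M)"
    "\<bar>gram n p (design z) ?b ?b - real n * q ?b\<bar> < real n * (8 * L) * (4 * M)"
    using assms by (auto simp: deviates_def gram_sq not_le)
  moreover have "4 * (gram n p (design z) x w - real n * ip p v x)
      = (gram n p (design z) ?a ?a - real n * q ?a) - (gram n p (design z) ?b ?b - real n * q ?b)"
    using gram_polarize[of n p "design z" x w] quad_add_diff(1)[OF w posdef_sym[OF pd], of x]
    by (simp add: right_diff_distrib[symmetric])
      (simp add: algebra_simps)
  moreover have "real n * (16 * M * L) = (real n * (8 * L) * (4 * M)) / 2" by simp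
  moreover have "\<bar>X\<bar> < D" if "\<bar>A\<bar> < B" "\<bar>C\<bar> < B" "4 * X = A - C" "D = B / 2" for A B C D X :: real
    using that by linarith
  ultimately show ?thesis by blast
qed

lemma sum_diff_q:
  assumes w: "\<And>i. i < p \<Longrightarrow> (\<Sum>j<p. \<Sigma> $$ (i, j) * w j) = v i" and "q x \<le> M" "q w \<le> M"
  shows "q (\<lambda>i. x i + w i) \<le> 4 * M" "q (\<lambda>i. x i - w i) \<le> 4 * M"
  using quad_add_diff(2)[OF w posdef_sym[OF pd], of x] assms(2,3)
    q_nonneg[of "\<lambda>i. x i + w i"] q_nonneg[of "\<lambda>i. x i - w i"] by auto

text \<open>The ideal debiasing direction: the inverse covariance applied to the large part of the
  loading, which division by \<open>h\<close> has scaled to unit length. Cauchy-Schwarz gives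
  \<open>(q w)^2 <= |w|^2 <= M * q w\<close>.\<close>

lemma target:
  obtains w where "\<And>i. i < p \<Longrightarrow> (\<Sum>j<p. \<Sigma> $$ (i, j) * w j) = (if i < T then \<xi> i / h else 0)"
    "q w \<le> M"
proof -
  let ?l = "\<lambda>i. if i < T then \<xi> i / h else 0"
  have "det (fmat p (entries \<Sigma>)) \<noteq> 0" using gaussian_integral(2)[OF pd] by simp
  then obtain d where d: "\<And>x i. i < p \<Longrightarrow> (\<Sum>j<p. \<Sigma> $$ (i, j) * (\<Sum>k<p. d j k * x k)) = x i"
    by (rule nonsingular_solve) blast
  define w where "w j = (\<Sum>k<p. d j k * ?l k)" for j
  have w: "(\<Sum>j<p. \<Sigma> $$ (i, j) * w j) = ?l i" if "i < p" for i
    unfolding w_def by (rule d[OF that])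
  have "ip p ?l ?l = (\<Sum>i<p. if i < T then (\<xi> i / h)\<^sup>2 else 0)"
    unfolding ip_def by (intro sum.cong) (auto simp: power2_eq_square)
  also have "\<dots> = (\<Sum>i<min T p. (\<xi> i / h)\<^sup>2)"
    by (rule sum.mono_neutral_cong_right) auto
  also have "\<dots> = 1" using h(1) by (simp add: power_divide h(2)[symmetric] flip: sum_divide_distrib)
  finally have ll: "ip p ?l ?l = 1" .
  have qw: "q w = ip p ?l w" by (rule quad_eq_ip) (rule w)
  have "(q w)\<^sup>2 \<le> ip p ?l ?l * ip p w w"
    using Cauchy_Schwarz_ineq_sum[of ?l w "{..<p}"] by (simp add: qw ip_def power2_eq_square)
  also have "\<dots> \<le> M * q w" using cov by (auto simp: ll cov_bounds_def)
  finally have "q w * q w \<le> M * q w" by (simp add: power2_eq_square)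
  then have "q w \<le> M" using q_nonneg[of w] M by (cases "q w = 0") auto
  then show ?thesis using that w by blast
qed

definition "score_bound = real n * (K * L)"
definition "corr_bound = K' * h * sqrt (real n)"

text \<open>Gram concentration is needed only along the finite set \<open>V\<close> of directions,
  so a union bound is enough. \<open>A1\<close> collects its failures, \<open>A2\<close> those of
  the scores, and \<open>A3\<close> is a large debiased noise term.\<close>

lemma good_event:
  obtains A where "A \<in> data.events n" "measure (data_law n p \<theta>) A \<le> \<epsilon>"
    "\<And>z. z \<in> space (data_space n p) \<Longrightarrow> z \<notin> A \<Longrightarrow>
      (\<forall>i<p. \<forall>j<p. \<bar>gram n p (design z) (unit i) (unit j) - real n * \<Sigma> $$ (i, j)\<bar> \<le> real n * (16 * M * L))
      \<and> feasible n p T \<xi> M h L (design z) (dir (design z))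
      \<and> compatible n p score_bound corr_bound (dir (design z)) z (($) \<beta>)"
proof -
  obtain w where w: "\<And>i. i < p \<Longrightarrow> (\<Sum>j<p. \<Sigma> $$ (i, j) * w j) = (if i < T then \<xi> i / h else 0)"
    and qw: "q w \<le> M" by (rule target) blast
  let ?I = "{..<p} \<times> {..<p}"
  define V where "V = (\<lambda>(i, j). (\<lambda>k. unit i k + unit j k)) ` ?I
    \<union> ((\<lambda>(i, j). (\<lambda>k. unit i k - unit j k)) ` ?I \<union> ((\<lambda>j k. unit j k + w k) ` {..<p}
    \<union> ((\<lambda>j k. unit j k - w k) ` {..<p} \<union> {w})))"
  have fin: "finite V" by (simp add: V_def)
  \<comment> \<open>At most \<open>2 p^2 + 2 p + 1\<close> directions.\<close>
  have cV: "real (card V) \<le> 5 * real p ^ 2"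
  proof -
    have "card V \<le> card ?I + (card ?I + (card {..<p} + (card {..<p} + 1)))"
      unfolding V_def
      by (intro order_trans[OF card_Un_le] add_mono card_image_le) auto
    also have "\<dots> \<le> 5 * p ^ 2"
    proof -
      have "p \<le> p * p" "1 \<le> p * p" using p by (auto simp: Suc_le_eq)
      moreover have "card ?I = p * p" by simp
      ultimately show ?thesis unfolding power2_eq_square card_lessThan by linarith
    qed
    finally show ?thesis by (simp flip: of_nat_power of_nat_mult)
  qed
  have qV: "q v \<le> 4 * M" if "v \<in> V" for v
    using that M qw unfolding V_def
    by (auto intro!: sum_diff_q[OF Sigma_unit] sum_diff_q[OF w] q_unit)
  define A1 where "A1 = (\<Union>v\<in>V. deviates v)"
  have A1: "A1 \<in> data.events n" unfolding A1_def by (intro sets.finite_UN fin deviates_event)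
  have "measure (data_law n p \<theta>) A1 \<le> (\<Sum>v\<in>V. measure (data_law n p \<theta>) (deviates v))"
    unfolding A1_def by (intro measure_UNION_le fin deviates_event)
  also have "\<dots> \<le> real (card V) * (2 / real p ^ 4)"
    by (intro sum_bounded_above deviates_prob qV)
  also have "\<dots> \<le> (5 * real p ^ 2) * (2 / real p ^ 4)" using cV by (intro mult_right_mono) auto
  also have "\<dots> = 10 / (real p * real p)" using p by (simp add: power2_eq_square power4_eq_xxxx)
  also have "\<dots> \<le> 10 / (real p * 1)" using p by (intro divide_left_mono mult_left_mono) auto
  finally have P1: "measure (data_law n p \<theta>) A1 \<le> 10 / real p" by simp
  define B where "B j = {z \<in> space (data_space n p).
      real n * (K * L) \<le> \<bar>\<Sum>i<n. ip p (unit j) (snd (z i)) * residual (z i)\<bar>}" for j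
  have mB: "B j \<in> data.events n" for j
  proof -
    have [measurable]: "(\<lambda>z. ip p (unit j) (snd (z i))) \<in> borel_measurable (data_space n p)"
      "(\<lambda>z. residual (z i)) \<in> borel_measurable (data_space n p)" if "i < n" for i
      using that by (auto intro!: measurable_compose[OF measurable_obs_component]
        measurable_compose[OF measurable_covariates ip_measurable_borel])
    show ?thesis unfolding B_def sets_data_law by measurable
  qed
  have K0: "0 < K" using M M2 by (simp add: K)
  have K2: "K\<^sup>2 = 8 * (M2\<^sup>2 * M)" using M by (simp add: K power_mult_distrib)
  have PB: "measure (data_law n p \<theta>) (B j) \<le> 2 / (real p * real p)" if "j < p" for j
  proof -
    have "measure (data_law n p \<theta>) (B j) \<le> 2 * exp (- (real n * (K * L)\<^sup>2 / (4 * (M2\<^sup>2 * M))))"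
      unfolding B_def
    proof (rule cross_tail)
      show "\<sigma>\<^sup>2 * q (unit j) \<le> M2\<^sup>2 * M"
        using sM sigma q_unit[OF that] q_nonneg by (intro mult_mono power_mono) auto
      have "L * L \<le> (1 / 32) * (1 / 32)" using L_small L0 by (intro mult_mono) auto
      then have "8 * (M2\<^sup>2 * M) * L\<^sup>2 \<le> 8 * (M2\<^sup>2 * M) * (1 / 4)"
        using M by (intro mult_left_mono) (auto simp: power2_eq_square)
      then show "(K * L)\<^sup>2 \<le> 2 * (M2\<^sup>2 * M)" by (simp add: power_mult_distrib K2)
    qed (use M M2 K0 L0 in auto)
    also have "real n * (K * L)\<^sup>2 / (4 * (M2\<^sup>2 * M)) = 2 * (real n * L\<^sup>2)"
      using M M2 by (simp add: power_mult_distrib K2)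
    also have "\<dots> = 2 * lp" by (simp add: nL2)
    also have "2 * exp (- (2 * lp)) = 2 / (real p * real p)"
      using p exp_of_nat_mult[of 2 lp] by (simp add: lp exp_minus field_simps power2_eq_square)
    finally show ?thesis .
  qed
  define A2 where "A2 = (\<Union>j<p. B j)"
  have A2: "A2 \<in> data.events n" unfolding A2_def by (intro sets.finite_UN mB) auto
  have "measure (data_law n p \<theta>) A2 \<le> (\<Sum>j<p. measure (data_law n p \<theta>) (B j))"
    unfolding A2_def by (intro measure_UNION_le mB) auto
  also have "\<dots> \<le> real (card {..<p}) * (2 / (real p * real p))"
    by (intro sum_bounded_above PB) auto
  also have "\<dots> = 2 / real p" using p by simp
  finally have P2: "measure (data_law n p \<theta>) A2 \<le> 2 / real p" .
  \<comment> \<open>Rows from \<open>n\<close> on get weight zero, since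
    \<open>weighted_noise_tail\<close> wants every weight to be determined by the first
    \<open>n\<close> rows.\<close>
  define wt where "wt X i = (if i < n then ip p (dir X) (X i) else 0)" for X i
  define A3 where "A3 = {z \<in> space (data_space n p).
      corr_bound \<le> \<bar>\<Sum>i<n. wt (design z) i * residual (z i)\<bar>}"
  have wz: "wt (design z) i = wt (\<lambda>i\<in>{..<n}. snd (z i)) i" for z :: "nat \<Rightarrow> obs" and i
    unfolding wt_def using direction_cong[of n "design z" "\<lambda>i\<in>{..<n}. snd (z i)"] by simp
  have wm: "(\<lambda>X. wt X i) \<in> borel_measurable (PiM {..<n} (\<lambda>_. PiM {..<p} (\<lambda>_. borel)))" for i
    by (cases "i < n") (simp_all add: wt_def direction_measurable)
  have A3: "A3 \<in> data.events n"
  proof -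
    have [measurable]: "(\<lambda>z. wt (design z) i) \<in> borel_measurable (data_space n p)" for i
      unfolding wz by (rule measurable_compose[OF design_measurable wm])
    have [measurable]: "(\<lambda>z. residual (z i)) \<in> borel_measurable (data_space n p)" if "i < n" for i
      using that by (auto intro!: measurable_compose[OF measurable_obs_component])
    show ?thesis unfolding A3_def sets_data_law by measurable
  qed
  have P3: "measure (data_law n p \<theta>) A3 \<le> \<epsilon> / 2"
  proof -
    define W where "W = M2\<^sup>2 * (real n * (2 * M * h\<^sup>2))"
    have W0: "0 < W" using M2 n M h(1) by (simp add: W_def)
    have "measure (data_law n p \<theta>) A3 \<le> 2 * exp (- (corr_bound\<^sup>2 / (2 * W)))"
      unfolding A3_def
    proof (rule weighted_noise_tail)
      show "(\<lambda>X. wt X i) \<in> borel_measurable (PiM {..<n} (\<lambda>_. PiM {..<p} (\<lambda>_. borel)))" for i by (rule wm)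
      show "wt X i = wt X' i" if "\<And>i. i < n \<Longrightarrow> X i = X' i" for X X' i
        using that direction_cong[of n X X'] by (simp add: wt_def)
      fix X
      have "(\<Sum>i<n. (wt X i)\<^sup>2) = gram n p X (dir X) (dir X)"
        by (simp add: gram_sq wt_def)
      also have "\<dots> \<le> real n * (2 * M * h\<^sup>2)" using M by (intro gram_direction_le) simp
      finally show "\<sigma>\<^sup>2 * (\<Sum>i<n. (wt X i)\<^sup>2) \<le> W"
        unfolding W_def using sM sigma by (intro mult_mono power_mono) (auto intro!: sum_nonneg)
    qed (use W0 K' h n in \<open>auto simp: corr_bound_def\<close>)
    also have "corr_bound\<^sup>2 / (2 * W) = K'\<^sup>2 / (4 * M * M2\<^sup>2)"
      using n h(1) M2 M by (simp add: corr_bound_def W_def power_mult_distrib field_simps)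
    finally show ?thesis using K' by linarith
  qed
  show ?thesis
  proof (rule that[of "A1 \<union> (A2 \<union> A3)"])
    show "A1 \<union> (A2 \<union> A3) \<in> data.events n" using A1 A2 A3 by blast
    have "measure (data_law n p \<theta>) (A1 \<union> (A2 \<union> A3))
        \<le> measure (data_law n p \<theta>) A1 + (measure (data_law n p \<theta>) A2 + measure (data_law n p \<theta>) A3)"
      using A1 A2 A3
      by (intro order_trans[OF measure_Un_le] add_mono order_refl) auto
    also have "\<dots> \<le> 10 / real p + (2 / real p + \<epsilon> / 2)" by (intro add_mono P1 P2 P3)
    also have "\<dots> \<le> \<epsilon>"
    proof -
      have "12 / real p \<le> \<epsilon> / 2" using large eps p by (simp add: field_simps)
      then show ?thesis by (simp add: add_divide_distrib)
    qed
    finally show "measure (data_law n p \<theta>) (A1 \<union> (A2 \<union> A3)) \<le> \<epsilon>" .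
    fix z assume z: "z \<in> space (data_space n p)" and zA: "z \<notin> A1 \<union> (A2 \<union> A3)"
    have nd: "z \<notin> deviates v" if "v \<in> V" for v using zA that by (auto simp: A1_def)
    have g1: "\<bar>gram n p (design z) (unit i) (unit j) - real n * \<Sigma> $$ (i, j)\<bar> < real n * (16 * M * L)"
      if "i < p" "j < p" for i j
    proof -
      have "\<bar>gram n p (design z) (unit i) (unit j) - real n * ip p (\<lambda>i. \<Sigma> $$ (i, j)) (unit i)\<bar>
          < real n * (16 * M * L)"
        using that by (intro polarized[OF Sigma_unit z] nd) (auto simp: V_def)
      then show ?thesis using that by (simp add: ip_commute[of p _ "unit i"] ip_unit)
    qed
    \<comment> \<open>Undoing the normalisation in \<open>target\<close>: \<open>h * w\<close>
      witnesses feasibility, so the direction that is actually chosen is feasible too.\<close>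
    have "feasible n p T \<xi> M h L (design z) (\<lambda>i. h * w i)"
      unfolding feasible_def
    proof (intro conjI allI impI)
      fix j assume j: "j < p"
      let ?l = "\<lambda>i. if i < T then \<xi> i / h else 0"
      have "\<bar>gram n p (design z) (unit j) w - real n * ip p ?l (unit j)\<bar> < real n * (16 * M * L)"
        using j by (intro polarized[OF w z] nd) (auto simp: V_def)
      then have "h * \<bar>gram n p (design z) (unit j) w - real n * ?l j\<bar> < h * (real n * (16 * M * L))"
        using h j by (simp add: ip_commute[of p _ "unit j"] ip_unit)
      also have "h * \<bar>gram n p (design z) (unit j) w - real n * ?l j\<bar>
          = \<bar>h * (gram n p (design z) (unit j) w - real n * ?l j)\<bar>" using h by (simp add: abs_mult)
      also have "h * (gram n p (design z) (unit j) w - real n * ?l j)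
          = gram n p (design z) (unit j) (\<lambda>i. h * w i) - real n * (if j < T then \<xi> j else 0)"
        using h by (simp add: gram_def ip_scale_left sum_distrib_left algebra_simps)
      finally show "\<bar>gram n p (design z) (unit j) (\<lambda>i. h * w i) - real n * (if j < T then \<xi> j else 0)\<bar>
          < real n * (16 * M * h * L)" by (simp add: algebra_simps)
    next
      have "z \<notin> deviates w" by (rule nd) (simp add: V_def)
      then have "gram n p (design z) w w - real n * q w < real n * (8 * L) * (4 * M)"
        using z by (auto simp: deviates_def gram_sq not_le)
      moreover have "real n * q w \<le> real n * M" using qw by (simp add: mult_left_mono)
      \<comment> \<open>By \<open>32 * L <= 1\<close> the deviation is at most \<open>n * M\<close>,
        the bound on the mean; hence the factor \<open>2\<close> in \<open>feasible\<close>.\<close>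
      moreover have "real n * (8 * L) * (4 * M) \<le> real n * M"
        using mult_right_mono[OF L_small, of "real n * M"] M by (simp add: algebra_simps)
      ultimately have "gram n p (design z) w w < 2 * real n * M" by linarith
      then have "h\<^sup>2 * gram n p (design z) w w < h\<^sup>2 * (2 * real n * M)"
        using h(1) by (intro mult_strict_left_mono) auto
      moreover have "gram n p (design z) (\<lambda>i. h * w i) (\<lambda>i. h * w i) = h\<^sup>2 * gram n p (design z) w w"
        by (simp add: gram_sq ip_scale_left power_mult_distrib sum_distrib_left)
      ultimately show "gram n p (design z) (\<lambda>i. h * w i) (\<lambda>i. h * w i) < real n * (2 * M * h\<^sup>2)"
        by (simp add: algebra_simps)
    qed
    then have g2: "feasible n p T \<xi> M h L (design z) (dir (design z))" by (rule feasible_direction)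
    have "\<bar>\<Sum>i<n. snd (z i) j * residual (z i)\<bar> < score_bound" if "j < p" for j
      using zA z that by (auto simp: A2_def B_def ip_unit score_bound_def not_le)
    moreover have "\<bar>\<Sum>i<n. ip p (dir (design z)) (snd (z i)) * residual (z i)\<bar> < corr_bound"
      using zA z by (auto simp: A3_def wt_def not_le)
    ultimately have g3: "compatible n p score_bound corr_bound (dir (design z)) z (($) \<beta>)"
      by (simp add: compatible_def residual_def)
    show "(\<forall>i<p. \<forall>j<p. \<bar>gram n p (design z) (unit i) (unit j) - real n * \<Sigma> $$ (i, j)\<bar> \<le> real n * (16 * M * L))
      \<and> feasible n p T \<xi> M h L (design z) (dir (design z))
      \<and> compatible n p score_bound corr_bound (dir (design z)) z (($) \<beta>)"
      using g1 g2 g3 by (auto intro: less_imp_le)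
  qed
qed

end

lemma scalar_prod_ip: "dim_vec w = p \<Longrightarrow> v \<bullet> w = ip p (($) v) (($) w)"
  by (auto simp: scalar_prod_def ip_def lessThan_atLeast0 intro!: sum.cong)

lemma l0_eq: "v \<in> carrier_vec p \<Longrightarrow> l0 v = card {j. j < p \<and> v $ j \<noteq> 0}"
  by (simp add: l0_def)

lemma loading_first: "loading p \<xi> \<Longrightarrow> 0 < p \<and> \<xi> $ 0 \<noteq> 0"
proof -
  assume l: "loading p \<xi>"
  then have c: "\<xi> \<in> carrier_vec p" by (simp add: loading_def)
  have "\<exists>j<p. \<xi> $ j \<noteq> 0"
  proof (rule ccontr)
    assume "\<not> (\<exists>j<p. \<xi> $ j \<noteq> 0)"
    then have "\<xi> = 0\<^sub>v p" using c by (intro eq_vecI) auto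
    then show False using l by (simp add: loading_def)
  qed
  then obtain j where j: "j < p" "\<xi> $ j \<noteq> 0" by blast
  then have "\<bar>\<xi> $ j\<bar> \<le> \<bar>\<xi> $ 0\<bar>" using l by (simp add: loading_def)
  then show ?thesis using j by auto
qed

lemma loading_mono: "loading p \<xi> \<Longrightarrow> i \<le> j \<Longrightarrow> j < p \<Longrightarrow> \<bar>\<xi> $ j\<bar> \<le> \<bar>\<xi> $ i\<bar>"
  by (simp add: loading_def)

lemma H_pos:
  assumes "loading p \<xi>" "0 < t" shows "0 < H t \<xi>"
proof -
  have c: "\<xi> \<in> carrier_vec p" using assms by (simp add: loading_def)
  have f: "0 < p" "\<xi> $ 0 \<noteq> 0" using loading_first[OF assms(1)] by auto
  have "0 < (\<xi> $ 0)\<^sup>2" using f by simp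
  also have "\<dots> \<le> (\<Sum>j<min (nat \<lceil>t\<rceil>) p. (\<xi> $ j)\<^sup>2)"
    using f assms(2) by (intro member_le_sum) auto
  finally show ?thesis using c by (simp add: H_def)
qed

text \<open>In a sorted loading, an entry past position \<open>a^2\<close> is at most the root mean
  square of the entries before it.\<close>

lemma H_tail:
  assumes l: "loading p \<xi>" and "0 \<le> a" and j: "nat \<lceil>a\<^sup>2\<rceil> \<le> j" "j < p"
  shows "a * \<bar>\<xi> $ j\<bar> \<le> H (a\<^sup>2) \<xi>"
proof -
  let ?T = "nat \<lceil>a\<^sup>2\<rceil>"
  have c: "\<xi> \<in> carrier_vec p" using l by (simp add: loading_def)
  have "(a * \<bar>\<xi> $ j\<bar>)\<^sup>2 = a\<^sup>2 * (\<xi> $ j)\<^sup>2" by (simp add: power_mult_distrib)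
  also have "\<dots> \<le> real ?T * (\<xi> $ j)\<^sup>2" by (intro mult_right_mono real_nat_ceiling_ge) auto
  also have "\<dots> = (\<Sum>i<?T. (\<xi> $ j)\<^sup>2)" by simp
  also have "\<dots> \<le> (\<Sum>i<?T. (\<xi> $ i)\<^sup>2)"
  proof (rule sum_mono)
    fix i assume "i \<in> {..<?T}"
    then have "i < ?T" by simp
    then have "i \<le> j" using j(1) by linarith
    then show "(\<xi> $ j)\<^sup>2 \<le> (\<xi> $ i)\<^sup>2" using loading_mono[OF l _ j(2)] by (simp add: abs_le_square_iff)
  qed
  also have "\<dots> = (H (a\<^sup>2) \<xi>)\<^sup>2" using j by (simp add: H_sq[OF c] min_absorb1)
  finally show ?thesis using H_nonneg by (rule power2_le_imp_le)
qed

lemma model_of_Theta: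
  assumes "(\<beta>, \<Sigma>, \<sigma>) \<in> Theta M1 M2 p k" "0 < p" "1 < M1"
  shows "model p \<beta> \<Sigma> \<sigma>"
  using assms cov_bounds_posdef[OF Theta_cov_bounds[OF assms] assms(3)]
  by unfold_locales (auto simp: Theta_def)

text \<open>Level: on the good event the true vector has a rational neighbour in the test set.
  Power: if the test accepts on the good event, the accepted vector and the truth are both
  compatible, so \<open>debiased_error\<close> puts their functionals closer than the separation
  allows. Both error probabilities are at most \<epsilon>.\<close>

theorem tau_adap_le:
  fixes M1 M2 \<alpha> \<eta> \<epsilon> C K' :: real and n p ku k :: nat
  defines "lp \<equiv> ln (real p)"
  defines "L \<equiv> sqrt (lp / real n)" and "K \<equiv> sqrt (8 * M1) * M2"
  assumes M1: "1 < M1" and M2: "0 < M2" and eps_le: "0 < \<epsilon>" "\<epsilon> \<le> \<alpha>" "\<epsilon> \<le> \<eta>"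
    and p: "2 \<le> p" and n: "0 < n" and k: "0 < ku" "k \<le> ku" and l: "loading p \<xi>"
    and K': "0 < K'" "2 * exp (- (K'\<^sup>2 / (4 * M1 * M2\<^sup>2))) \<le> \<epsilon> / 2"
    and large: "24 / \<epsilon> \<le> real p" and L_small: "32 * L \<le> 1"
    and small: "64 * M1\<^sup>2 * real ku * L \<le> 1" and sparse: "real ku * lp \<le> C * sqrt (real n)"
    and C: "0 \<le> C"
  shows "tau_adap M1 M2 \<alpha> \<eta> n p ku k \<xi> t0
    \<le> ereal ((8 * M1 * K + 128 * M1\<^sup>2 * K * C + 2 * K' + 2) * (H ((real ku)\<^sup>2 * lp) \<xi> / sqrt (real n)))"
    (is "_ \<le> ereal ?\<tau>")
proof -
  define h where "h = H ((real ku)\<^sup>2 * lp) \<xi>"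
  define T where "T = nat \<lceil>(real ku)\<^sup>2 * lp\<rceil>"
  have c: "\<xi> \<in> carrier_vec p" using l by (simp add: loading_def)
  have lp0: "0 < lp" using p by (simp add: lp_def)
  have h0: "0 < h" unfolding h_def using lp0 k by (intro H_pos[OF l]) simp
  have hT: "h\<^sup>2 = (\<Sum>j<min T p. (\<xi> $ j)\<^sup>2)" unfolding h_def T_def by (rule H_sq[OF c])
  have asq: "(real ku * sqrt lp)\<^sup>2 = (real ku)\<^sup>2 * lp" using lp0 by (simp add: power_mult_distrib)
  have tail: "real ku * sqrt lp * \<bar>\<xi> $ j\<bar> \<le> h" if "T \<le> j" "j < p" for j
    using H_tail[OF l, of "real ku * sqrt lp" j] that lp0 by (simp add: asq h_def T_def)
  \<comment> \<open>A slack of the order of the rate itself, so it only enlarges the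
    constant.\<close>
  define r where "r = h / sqrt (real n)"
  have r0: "0 < r" using h0 n by (simp add: r_def)
  have K0: "0 \<le> K" using M1 M2 by (simp add: K_def)
  have U: "upper p \<beta> \<Sigma> \<sigma> M1 M2 lp T (($) \<xi>) h L K K' n \<epsilon>"
    if "(\<beta>, \<Sigma>, \<sigma>) \<in> Theta M1 M2 p m" for \<beta> \<Sigma> \<sigma> m
  proof -
    have "model p \<beta> \<Sigma> \<sigma>" using that p M1 by (intro model_of_Theta) auto
    moreover have "cov_bounds M1 p \<Sigma>" using that p M1 by (intro Theta_cov_bounds) auto
    moreover have "\<sigma> \<le> M2" using that by (simp add: Theta_def)
    ultimately show ?thesis
      using M1 n p h0 hT L_small K' large eps_le
      by (intro upper.intro upper_axioms.intro) (simp_all add: lp_def L_def K_def)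
  qed
  let ?dir = "\<lambda>z :: nat \<Rightarrow> obs. direction n p T (($) \<xi>) M1 h L (\<lambda>i. snd (z i))"
  let ?comp = "\<lambda>z b. compatible n p (real n * (K * L)) (K' * h * sqrt (real n)) (?dir z) z b"
  define Acc where "Acc = {z \<in> space (data_space n p). \<exists>b\<in>test_set p r ku (($) \<xi>) t0. ?comp z b}"
  have count: "countable (test_set p r ku (($) \<xi>) t0)"
    unfolding test_set_def by (rule countable_subset[OF Collect_restrict countable_rational_functions])
  have Acc: "Acc \<in> sets (data_space n p)"
  proof -
    have "Measurable.pred (data_space n p) (\<lambda>z. \<exists>b\<in>test_set p r ku (($) \<xi>) t0. ?comp z b)"
      by (rule measurable_pred_countable(2)[OF count]) (rule compatible_measurable)
    then show ?thesis unfolding Acc_def by (simp add: pred_def)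
  qed
  define \<psi> where "\<psi> z = 1 - indicat_real Acc z" for z
  have expect: "expect n p (\<beta>, \<Sigma>, \<sigma>) \<psi> = 1 - measure (data_law n p (\<beta>, \<Sigma>, \<sigma>)) Acc"
    if "(\<beta>, \<Sigma>, \<sigma>) \<in> Theta M1 M2 p m" for \<beta> \<Sigma> \<sigma> m
  proof -
    interpret upper p \<beta> \<Sigma> \<sigma> M1 M2 lp T "($) \<xi>" h L K K' n \<epsilon> by (rule U[OF that])
    have "Acc \<in> data.events n" using Acc by simp
    then show ?thesis
      unfolding expect_def \<psi>_def
      by (subst Bochner_Integration.integral_diff) (auto simp: data.prob_space data.emeasure_eq_measure)
  qed
  have tests: "\<psi> \<in> Tests n p \<alpha> (Theta_null M1 M2 p ku \<xi> t0)"
    unfolding Tests_def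
  proof (intro CollectI conjI ballI)
    show "\<psi> \<in> borel_measurable (data_space n p)" unfolding \<psi>_def using Acc by measurable
    show "0 \<le> \<psi> z" "\<psi> z \<le> 1" for z by (auto simp: \<psi>_def indicator_def)
    show "(SUP \<theta>\<in>Theta_null M1 M2 p ku \<xi> t0. ereal (expect n p \<theta> \<psi>)) \<le> ereal \<alpha>"
    proof (rule SUP_least)
      fix \<theta> assume "\<theta> \<in> Theta_null M1 M2 p ku \<xi> t0"
      then obtain \<beta> \<Sigma> \<sigma> where \<theta>: "\<theta> = (\<beta>, \<Sigma>, \<sigma>)" and th: "(\<beta>, \<Sigma>, \<sigma>) \<in> Theta M1 M2 p ku"
        and null: "\<xi> \<bullet> \<beta> = t0" by (auto simp: Theta_null_def)
      interpret upper p \<beta> \<Sigma> \<sigma> M1 M2 lp T "($) \<xi>" h L K K' n \<epsilon> by (rule U[OF th])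
      obtain A where A: "A \<in> data.events n" "measure (data_law n p (\<beta>, \<Sigma>, \<sigma>)) A \<le> \<epsilon>"
        and good: "\<And>z. z \<in> space (data_space n p) \<Longrightarrow> z \<notin> A \<Longrightarrow> ?comp z (($) \<beta>)"
        by (rule good_event) (auto simp: score_bound_def corr_bound_def)
      have "space (data_space n p) - A \<subseteq> Acc"
      proof
        fix z assume z: "z \<in> space (data_space n p) - A"
        have "card {j. j < p \<and> \<beta> $ j \<noteq> 0} \<le> ku" using th l0_eq[OF beta] by (simp add: Theta_def)
        moreover have "ip p (($) \<xi>) (($) \<beta>) = t0" using null beta by (simp add: scalar_prod_ip)
        ultimately show "z \<in> Acc"
          using compatible_rational[OF good _ _ r0] z by (simp add: Acc_def)
      qed
      then have "space (data_law n p (\<beta>, \<Sigma>, \<sigma>)) - Acc \<subseteq> A" by (auto simp: space_data_law)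
      then have "measure (data_law n p (\<beta>, \<Sigma>, \<sigma>)) (space (data_law n p (\<beta>, \<Sigma>, \<sigma>)) - Acc) \<le> \<epsilon>"
        using A data.finite_measure_mono[OF _ A(1)] by (meson order_trans)
      then have "1 - measure (data_law n p (\<beta>, \<Sigma>, \<sigma>)) Acc \<le> \<epsilon>"
        using data.prob_compl[of Acc n] Acc by simp
      then show "ereal (expect n p \<theta> \<psi>) \<le> ereal \<alpha>" using expect[OF th] eps_le by (simp add: \<theta>)
    qed
  qed
  have \<tau>: "0 < ?\<tau>"
    using M1 K0 C K'(1) r0 unfolding h_def[symmetric] r_def[symmetric]
    by (intro mult_pos_pos add_nonneg_pos add_nonneg_nonneg mult_nonneg_nonneg) auto
  have alt: "ereal (1 - \<eta>) \<le> ereal (expect n p \<theta> \<psi>)" if "\<theta> \<in> Theta_alt M1 M2 p k \<xi> t0 ?\<tau>" for \<theta>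
  proof -
    obtain \<beta> \<Sigma> \<sigma> where \<theta>: "\<theta> = (\<beta>, \<Sigma>, \<sigma>)" and th: "(\<beta>, \<Sigma>, \<sigma>) \<in> Theta M1 M2 p k"
      and far: "?\<tau> \<le> \<bar>\<xi> \<bullet> \<beta> - t0\<bar>" using \<open>\<theta> \<in> _\<close> by (auto simp: Theta_alt_def)
    interpret upper p \<beta> \<Sigma> \<sigma> M1 M2 lp T "($) \<xi>" h L K K' n \<epsilon> by (rule U[OF th])
    have card: "card {j. j < p \<and> \<beta> $ j \<noteq> 0} \<le> ku" using th l0_eq[OF beta] k by (simp add: Theta_def)
    obtain A where A: "A \<in> data.events n" "measure (data_law n p (\<beta>, \<Sigma>, \<sigma>)) A \<le> \<epsilon>"
      and good: "\<And>z. z \<in> space (data_space n p) \<Longrightarrow> z \<notin> A \<Longrightarrow>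
        (\<forall>i<p. \<forall>j<p. \<bar>gram n p (design z) (unit i) (unit j) - real n * \<Sigma> $$ (i, j)\<bar> \<le> real n * (16 * M1 * L))
      \<and> feasible n p T (($) \<xi>) M1 h L (design z) (?dir z) \<and> ?comp z (($) \<beta>)"
      by (rule good_event) (auto simp: score_bound_def corr_bound_def)
    have "Acc \<subseteq> A"
    proof (rule ccontr)
      assume "\<not> Acc \<subseteq> A"
      then obtain z where z: "z \<in> Acc" "z \<notin> A" by blast
      then obtain b where b: "b \<in> test_set p r ku (($) \<xi>) t0" "?comp z b"
        and zs: "z \<in> space (data_space n p)" by (auto simp: Acc_def)
      note g = good[OF zs z(2)]
      have "\<bar>ip p (($) \<xi>) b - ip p (($) \<xi>) (($) \<beta>)\<bar>
          \<le> (8 * M1 * K + 128 * M1\<^sup>2 * K * C + 2 * K') * h / sqrt (real n)"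
      proof (rule debiased_error[where k = ku and lp = lp and L = L and T = T and X = "design z"
            and y = "\<lambda>i. fst (z i)" and u = "?dir z" and S = "entries \<Sigma>"])
        show "card {j. j < p \<and> b j \<noteq> 0} \<le> ku" using b by (simp add: test_set_def)
        show "ip p d d \<le> M1 * q d" for d using cov by (simp add: cov_bounds_def)
        show "\<bar>\<Sum>i<n. snd (z i) j * (fst (z i) - ip p (snd (z i)) b)\<bar> \<le> real n * (K * L)"
          "\<bar>\<Sum>i<n. snd (z i) j * (fst (z i) - ip p (snd (z i)) (($) \<beta>))\<bar> \<le> real n * (K * L)"
          if "j < p" for j using that b(2) g by (auto simp: compatible_def intro: less_imp_le)
        show "\<bar>\<Sum>i<n. ip p (?dir z) (snd (z i)) * (fst (z i) - ip p (snd (z i)) b)\<bar> \<le> K' * h * sqrt (real n)"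
          "\<bar>\<Sum>i<n. ip p (?dir z) (snd (z i)) * (fst (z i) - ip p (snd (z i)) (($) \<beta>))\<bar> \<le> K' * h * sqrt (real n)"
          using b(2) g by (auto simp: compatible_def intro: less_imp_le)
        show "\<bar>gram n p (design z) (unit j) (?dir z) - real n * (if j < T then \<xi> $ j else 0)\<bar>
            \<le> real n * (16 * M1 * h * L)" if "j < p" for j
          using g that by (auto simp: feasible_def intro: less_imp_le)
      qed (use M1 n h0 k lp0 K0 K' card g small sparse tail L_def in auto)
      moreover have "\<bar>ip p (($) \<xi>) b - t0\<bar> \<le> r" using b by (simp add: test_set_def)
      moreover have "\<xi> \<bullet> \<beta> = ip p (($) \<xi>) (($) \<beta>)" using beta by (simp add: scalar_prod_ip)
      \<comment> \<open>One \<open>r\<close> pays for the slack of the test set, the other makes the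
        contradiction strict.\<close>
      moreover have "?\<tau> = (8 * M1 * K + 128 * M1\<^sup>2 * K * C + 2 * K') * h / sqrt (real n) + 2 * r"
        unfolding h_def[symmetric] by (simp add: r_def distrib_right add_divide_distrib)
      ultimately show False using far r0 by linarith
    qed
    then have "measure (data_law n p (\<beta>, \<Sigma>, \<sigma>)) Acc \<le> \<epsilon>"
      using A data.finite_measure_mono[OF _ A(1)] by (meson order_trans)
    then show ?thesis using expect[OF th] eps_le by (simp add: \<theta>)
  qed
  have "ereal (1 - \<eta>) \<le> (SUP \<psi> \<in> Tests n p \<alpha> (Theta_null M1 M2 p ku \<xi> t0).
        INF \<theta> \<in> Theta_alt M1 M2 p k \<xi> t0 ?\<tau>. ereal (expect n p \<theta> \<psi>))"
    by (rule SUP_upper2[OF tests]) (intro INF_greatest alt)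
  then show ?thesis unfolding tau_adap_def using \<tau> by (intro Inf_lower) blast
qed

subsection \<open>Lower bound: likelihood ratios\<close>

text \<open>Checked on rectangles, where the integral of the product factorises.\<close>

lemma PiM_density:
  assumes I: "finite I" and M: "sigma_finite_measure M" and D: "sigma_finite_measure (density M f)"
    and f [measurable]: "f \<in> borel_measurable M"
  shows "PiM I (\<lambda>_. density M f) = density (PiM I (\<lambda>_. M)) (\<lambda>z. \<Prod>i\<in>I. f (z i))"
proof -
  interpret M: product_sigma_finite "\<lambda>_. M" using M by (simp add: product_sigma_finite_def)
  interpret D: product_sigma_finite "\<lambda>_. density M f" using D by (simp add: product_sigma_finite_def)
  have m [measurable]: "(\<lambda>z. \<Prod>i\<in>I. f (z i)) \<in> borel_measurable (PiM I (\<lambda>_. M))"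
    by measurable
  have "density (PiM I (\<lambda>_. M)) (\<lambda>z. \<Prod>i\<in>I. f (z i)) = PiM I (\<lambda>_. density M f)"
  proof (rule D.PiM_eqI[OF I])
    show "sets (density (PiM I (\<lambda>_. M)) (\<lambda>z. \<Prod>i\<in>I. f (z i))) = sets (PiM I (\<lambda>_. density M f))"
      by (auto intro!: sets_PiM_cong)
    fix A assume A: "\<And>i. i \<in> I \<Longrightarrow> A i \<in> sets (density M f)"
    then have A' [measurable]: "\<And>i. i \<in> I \<Longrightarrow> A i \<in> sets M" by simp
    have "emeasure (density (PiM I (\<lambda>_. M)) (\<lambda>z. \<Prod>i\<in>I. f (z i))) (Pi\<^sub>E I A)
      = (\<integral>\<^sup>+ z. (\<Prod>i\<in>I. f (z i)) * indicator (Pi\<^sub>E I A) z \<partial>PiM I (\<lambda>_. M))"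
      using A' I by (intro emeasure_density m sets_PiM_I_finite) auto
    also have "\<dots> = (\<integral>\<^sup>+ z. (\<Prod>i\<in>I. f (z i) * indicator (A i) (z i)) \<partial>PiM I (\<lambda>_. M))"
    proof (rule nn_integral_cong)
      fix z assume z: "z \<in> space (PiM I (\<lambda>_. M))"
      then have ext: "z \<in> extensional I" by (auto simp: space_PiM PiE_def)
      have "(\<Prod>i\<in>I. indicator (A i) (z i)) = (indicator (Pi\<^sub>E I A) z :: ennreal)"
      proof (cases "\<forall>i\<in>I. z i \<in> A i")
        case True then show ?thesis using ext by (auto simp: PiE_iff indicator_def)
      next
        case False then show ?thesis using I by (auto simp: PiE_iff indicator_def intro: prod_zero)
      qed
      then show "(\<Prod>i\<in>I. f (z i)) * indicator (Pi\<^sub>E I A) z = (\<Prod>i\<in>I. f (z i) * indicator (A i) (z i))"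
        by (simp add: prod.distrib)
    qed
    also have "\<dots> = (\<Prod>i\<in>I. \<integral>\<^sup>+ x. f x * indicator (A i) x \<partial>M)"
      by (rule M.product_nn_integral_prod[OF I]) simp
    also have "\<dots> = (\<Prod>i\<in>I. emeasure (density M f) (A i))"
      using A' by (intro prod.cong refl emeasure_density[symmetric]) auto
    finally show "emeasure (density (PiM I (\<lambda>_. M)) (\<lambda>z. \<Prod>i\<in>I. f (z i))) (Pi\<^sub>E I A)
      = (\<Prod>i\<in>I. emeasure (density M f) (A i))" .
  qed
  then show ?thesis by simp
qed

lemma nn_integral_noise_shift:
  assumes s: "0 < \<sigma>" and f [measurable]: "f \<in> borel_measurable borel"
  shows "(\<integral>\<^sup>+ e. f (e - s) \<partial>noise \<sigma>)
    = (\<integral>\<^sup>+ e. ennreal (exp (- s * e / \<sigma>\<^sup>2 - s\<^sup>2 / (2 * \<sigma>\<^sup>2))) * f e \<partial>noise \<sigma>)"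
proof -
  have "(\<integral>\<^sup>+ e. f (e - s) \<partial>noise \<sigma>) = (\<integral>\<^sup>+ e. ennreal (normal_density 0 \<sigma> e) * f (e - s) \<partial>lborel)"
    by (rule nn_integral_density) auto
  also have "\<dots> = (\<integral>\<^sup>+ e. ennreal (normal_density 0 \<sigma> (s + 1 * e)) * f ((s + 1 * e) - s) \<partial>lborel)"
    by (subst nn_integral_real_affine[where c = 1 and t = s]) auto
  also have "\<dots> = (\<integral>\<^sup>+ e. ennreal (normal_density 0 \<sigma> e)
      * (ennreal (exp (- s * e / \<sigma>\<^sup>2 - s\<^sup>2 / (2 * \<sigma>\<^sup>2))) * f e) \<partial>lborel)"
  proof (rule nn_integral_cong)
    fix e :: real
    have "- ((s + e)\<^sup>2) / (2 * \<sigma>\<^sup>2) = - (e\<^sup>2) / (2 * \<sigma>\<^sup>2) + (- s * e / \<sigma>\<^sup>2 - s\<^sup>2 / (2 * \<sigma>\<^sup>2))"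
      using s by (simp add: field_simps power2_eq_square)
    then have "exp (- ((s + e)\<^sup>2) / (2 * \<sigma>\<^sup>2))
        = exp (- (e\<^sup>2) / (2 * \<sigma>\<^sup>2)) * exp (- s * e / \<sigma>\<^sup>2 - s\<^sup>2 / (2 * \<sigma>\<^sup>2))"
      unfolding exp_add[symmetric] by simp
    then show "ennreal (normal_density 0 \<sigma> (s + 1 * e)) * f ((s + 1 * e) - s)
        = ennreal (normal_density 0 \<sigma> e) * (ennreal (exp (- s * e / \<sigma>\<^sup>2 - s\<^sup>2 / (2 * \<sigma>\<^sup>2))) * f e)"
      by (simp add: normal_density_def ennreal_mult[symmetric] mult.assoc[symmetric])
  qed
  also have "\<dots> = (\<integral>\<^sup>+ e. ennreal (exp (- s * e / \<sigma>\<^sup>2 - s\<^sup>2 / (2 * \<sigma>\<^sup>2))) * f e \<partial>noise \<sigma>)"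
    by (rule nn_integral_density[symmetric]) auto
  finally show ?thesis .
qed

context model
begin

text \<open>The likelihood ratio of coefficients \<open>\<beta> - d\<close> against
  \<open>\<beta>\<close> at one observation. The law of the covariates is common to both and
  cancels.\<close>

definition lr :: "(nat \<Rightarrow> real) \<Rightarrow> obs \<Rightarrow> real" where
  "lr d z = exp (- ip p (snd z) d * residual z / \<sigma>\<^sup>2 - (ip p (snd z) d)\<^sup>2 / (2 * \<sigma>\<^sup>2))"

lemma lr_measurable [measurable]: "lr d \<in> borel_measurable (obs_space p)"
  unfolding lr_def by measurable

lemma lr_pos: "0 < lr d z" by (simp add: lr_def)

lemma obs_law_shift:
  assumes b: "\<beta>' \<in> carrier_vec p" and d: "\<And>j. j < p \<Longrightarrow> \<beta>' $ j = \<beta> $ j - d j"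
  shows "obs_law p (\<beta>', \<Sigma>, \<sigma>) = density (obs_law p \<theta>) (lr d)"
proof (rule measure_eqI)
  show "sets (obs_law p (\<beta>', \<Sigma>, \<sigma>)) = sets (density (obs_law p \<theta>) (lr d))" by simp
  interpret m': model p \<beta>' \<Sigma> \<sigma> by unfold_locales (use b Sigma pd sigma in auto)
  fix A assume "A \<in> sets (obs_law p (\<beta>', \<Sigma>, \<sigma>))"
  then have A [measurable]: "A \<in> sets (obs_space p)" by simp
  have "emeasure (obs_law p (\<beta>', \<Sigma>, \<sigma>)) A = (\<integral>\<^sup>+ z. indicator A z \<partial>obs_law p (\<beta>', \<Sigma>, \<sigma>))"
    using A by simp
  also have "\<dots> = (\<integral>\<^sup>+ x. \<integral>\<^sup>+ e. indicator A (ip p x (($) \<beta>') + e, x) \<partial>noise \<sigma> \<partial>mvn p \<Sigma>)"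
    by (rule m'.nn_integral_obs) simp
  also have "\<dots> = (\<integral>\<^sup>+ x. \<integral>\<^sup>+ e. ennreal (lr d (ip p x (($) \<beta>) + e, x)) * indicator A (ip p x (($) \<beta>) + e, x)
      \<partial>noise \<sigma> \<partial>mvn p \<Sigma>)"
  proof (rule nn_integral_cong)
    fix x assume "x \<in> space (mvn p \<Sigma>)"
    then have [measurable]: "x \<in> space (PiM {..<p} (\<lambda>_. borel))" by (simp add: space_mvn)
    have m: "(\<lambda>e. indicator A (ip p x (($) \<beta>) + e, x) :: ennreal) \<in> borel_measurable borel"
    proof -
      have "(\<lambda>e. (ip p x (($) \<beta>) + e, x)) \<in> borel \<rightarrow>\<^sub>M obs_space p" unfolding obs_space_def by measurable
      then show ?thesis by (rule measurable_compose) simp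
    qed
    have "ip p x (($) \<beta>') = ip p x (\<lambda>j. \<beta> $ j - d j)" by (rule ip_cong) (auto simp: d)
    then have "ip p x (($) \<beta>') + e = ip p x (($) \<beta>) + (e - ip p x d)" for e
      by (simp add: ip_diff_right)
    then have "(\<integral>\<^sup>+ e. indicator A (ip p x (($) \<beta>') + e, x) \<partial>noise \<sigma>)
        = (\<integral>\<^sup>+ e. indicator A (ip p x (($) \<beta>) + (e - ip p x d), x) \<partial>noise \<sigma>)"
      by (simp only:)
    also have "\<dots> = (\<integral>\<^sup>+ e. ennreal (exp (- ip p x d * e / \<sigma>\<^sup>2 - (ip p x d)\<^sup>2 / (2 * \<sigma>\<^sup>2)))
        * indicator A (ip p x (($) \<beta>) + e, x) \<partial>noise \<sigma>)"
      by (rule nn_integral_noise_shift[OF sigma m])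
    finally show "(\<integral>\<^sup>+ e. indicator A (ip p x (($) \<beta>') + e, x) \<partial>noise \<sigma>)
        = (\<integral>\<^sup>+ e. ennreal (lr d (ip p x (($) \<beta>) + e, x)) * indicator A (ip p x (($) \<beta>) + e, x) \<partial>noise \<sigma>)"
      by (simp add: lr_def residual_def)
  qed
  also have "\<dots> = (\<integral>\<^sup>+ z. ennreal (lr d z) * indicator A z \<partial>obs_law p \<theta>)"
    by (rule nn_integral_obs[symmetric]) measurable
  also have "\<dots> = emeasure (density (obs_law p \<theta>) (lr d)) A"
    using A by (subst emeasure_density) auto
  finally show "emeasure (obs_law p (\<beta>', \<Sigma>, \<sigma>)) A = emeasure (density (obs_law p \<theta>) (lr d)) A" .
qed

definition LR :: "nat \<Rightarrow> (nat \<Rightarrow> real) \<Rightarrow> (nat \<Rightarrow> obs) \<Rightarrow> real" where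
  "LR n d z = (\<Prod>i<n. lr d (z i))"

lemma LR_measurable [measurable]: "LR n d \<in> borel_measurable (data_space n p)"
  unfolding LR_def
  by (intro borel_measurable_prod measurable_compose[OF measurable_obs_component lr_measurable]) auto

lemma LR_nonneg: "0 \<le> LR n d z"
  unfolding LR_def by (intro prod_nonneg) (auto intro: less_imp_le lr_pos)

lemma data_law_shift:
  assumes b: "\<beta>' \<in> carrier_vec p" and d: "\<And>j. j < p \<Longrightarrow> \<beta>' $ j = \<beta> $ j - d j"
  shows "data_law n p (\<beta>', \<Sigma>, \<sigma>) = density (data_law n p \<theta>) (LR n d)"
proof -
  interpret m': model p \<beta>' \<Sigma> \<sigma> by unfold_locales (use b Sigma pd sigma in auto)
  have e: "obs_law p (\<beta>', \<Sigma>, \<sigma>) = density (obs_law p \<theta>) (\<lambda>z. ennreal (lr d z))"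
    by (rule obs_law_shift[OF b d])
  have "data_law n p (\<beta>', \<Sigma>, \<sigma>) = PiM {..<n} (\<lambda>_. density (obs_law p \<theta>) (\<lambda>z. ennreal (lr d z)))"
    by (simp add: data_law_def e)
  also have "\<dots> = density (PiM {..<n} (\<lambda>_. obs_law p \<theta>)) (\<lambda>z. \<Prod>i<n. ennreal (lr d (z i)))"
  proof (rule PiM_density)
    show "sigma_finite_measure (density (obs_law p \<theta>) (\<lambda>z. ennreal (lr d z)))"
      unfolding e[symmetric] by unfold_locales
  qed (auto intro: obs.sigma_finite_measure_axioms)
  also have "\<dots> = density (data_law n p \<theta>) (\<lambda>z. ennreal (LR n d z))"
    unfolding data_law_def LR_def
    by (intro arg_cong2[where f = density] refl ext) (simp add: prod_ennreal lr_pos less_imp_le)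
  finally show ?thesis .
qed

text \<open>Integrating the noise leaves the exponential of
  \<open>(x . c) (x . d) / \<sigma>^2\<close>, a difference of squares, to which
  \<open>mvn_exp_square_diff\<close> applies. Its determinant bound is
  \<open>(1 - r)^2 - s^2 / 4\<close>: the overlap \<open>r\<close> counts at first order, the norms
  \<open>s\<close> only at second. With norms of order \<open>ku / n\<close>, \<open>n S^2\<close>
  is of order \<open>ku^2 / n\<close>.\<close>

lemma LR_second_moment:
  assumes one: "\<Sigma> = 1\<^sub>m p" and S: "(ip p c c + ip p d d) / \<sigma>\<^sup>2 \<le> S" "S \<le> 1 / 2"
    and cd: "0 \<le> ip p c d" "ip p c d / \<sigma>\<^sup>2 \<le> \<rho>"
  shows "(\<integral>\<^sup>+ z. ennreal (LR n c z * LR n d z) \<partial>data_law n p \<theta>)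
    \<le> ennreal (exp (real n * (2 * \<rho> + S\<^sup>2)))"
proof -
  define s where "s = (ip p c c + ip p d d) / \<sigma>\<^sup>2"
  define r where "r = ip p c d / \<sigma>\<^sup>2"
  have s0: "0 \<le> s" using ip_self_nonneg[of p c] ip_self_nonneg[of p d] by (simp add: s_def)
  have r0: "0 \<le> r" using cd by (simp add: r_def)
  \<comment> \<open>Scaled sum and difference, so that \<open>(x . c) (x . d) / \<sigma>^2\<close>
    is a quarter of a difference of squares.\<close>
  define a where "a i = 1 / \<sigma> * (c i + d i)" for i
  define b where "b i = 1 / \<sigma> * (c i - d i)" for i
  have sig2: "\<sigma>\<^sup>2 = \<sigma> * \<sigma>" by (simp add: power2_eq_square)
  have aa: "ip p a a = s + 2 * r" and bb: "ip p b b = s - 2 * r"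
    unfolding a_def b_def ip_scale_left ip_scale_right ip_add_left ip_add_right ip_diff_left ip_diff_right
    by (simp_all add: s_def r_def ip_commute[of p d c] sig2 add_divide_distrib diff_divide_distrib)
  have rs: "r \<le> s / 2" using bb ip_self_nonneg[of p b] by simp
  have aa2: "ip p a a < 2" using aa rs S by (simp add: s_def[symmetric])
  have obs: "(\<integral>\<^sup>+ z. ennreal (lr c z * lr d z) \<partial>obs_law p \<theta>) \<le> ennreal (exp (2 * \<rho> + S\<^sup>2))"
  proof -
    have "(\<integral>\<^sup>+ z. ennreal (lr c z * lr d z) \<partial>obs_law p \<theta>)
      = (\<integral>\<^sup>+ x. \<integral>\<^sup>+ e. ennreal (lr c (ip p x (($) \<beta>) + e, x) * lr d (ip p x (($) \<beta>) + e, x)) \<partial>noise \<sigma> \<partial>mvn p \<Sigma>)"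
      by (rule nn_integral_obs) measurable
    also have "\<dots> = (\<integral>\<^sup>+ x. ennreal (exp (((ip p a x)\<^sup>2 - (ip p b x)\<^sup>2) / 4)) \<partial>mvn p \<Sigma>)"
    proof (rule nn_integral_cong)
      fix x
      define A where "A = ip p x c"
      define B where "B = ip p x d"
      have "(\<integral>\<^sup>+ e. ennreal (lr c (ip p x (($) \<beta>) + e, x) * lr d (ip p x (($) \<beta>) + e, x)) \<partial>noise \<sigma>)
        = (\<integral>\<^sup>+ e. ennreal (exp (- ((A\<^sup>2 + B\<^sup>2) / (2 * \<sigma>\<^sup>2)))) * ennreal (exp ((- (A + B) / \<sigma>\<^sup>2) * e)) \<partial>noise \<sigma>)"
        by (intro nn_integral_cong)
          (simp add: lr_def residual_def A_def B_def ennreal_mult[symmetric] exp_add[symmetric]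
            add_divide_distrib diff_divide_distrib algebra_simps)
      also have "\<dots> = ennreal (exp (- ((A\<^sup>2 + B\<^sup>2) / (2 * \<sigma>\<^sup>2)))) * ennreal (exp ((- (A + B) / \<sigma>\<^sup>2)\<^sup>2 * \<sigma>\<^sup>2 / 2))"
        by (subst nn_integral_cmult) (auto simp only: exp_noise[OF sigma], measurable)
      also have "\<dots> = ennreal (exp (- ((A\<^sup>2 + B\<^sup>2) / (2 * \<sigma>\<^sup>2)) + (- (A + B) / \<sigma>\<^sup>2)\<^sup>2 * \<sigma>\<^sup>2 / 2))"
        by (simp only: ennreal_mult[symmetric] exp_ge_zero exp_add)
      also have "- ((A\<^sup>2 + B\<^sup>2) / (2 * \<sigma>\<^sup>2)) + (- (A + B) / \<sigma>\<^sup>2)\<^sup>2 * \<sigma>\<^sup>2 / 2 = A * B / \<sigma>\<^sup>2"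
        using sigma by (simp add: field_simps power2_eq_square)
      also have "A * B / \<sigma>\<^sup>2 = ((ip p a x)\<^sup>2 - (ip p b x)\<^sup>2) / 4"
        unfolding a_def b_def ip_scale_left ip_add_left ip_diff_left
        using sigma by (simp add: A_def B_def ip_commute[of p x] field_simps power2_eq_square)
      finally show "(\<integral>\<^sup>+ e. ennreal (lr c (ip p x (($) \<beta>) + e, x) * lr d (ip p x (($) \<beta>) + e, x)) \<partial>noise \<sigma>)
        = ennreal (exp (((ip p a x)\<^sup>2 - (ip p b x)\<^sup>2) / 4))" .
    qed
    also have "\<dots> \<le> ennreal (1 / sqrt ((1 - ip p a a / 2) * (1 + ip p b b / 2)))"
      unfolding one by (rule mvn_exp_square_diff[OF aa2])
    also have "\<dots> \<le> ennreal (exp (2 * \<rho> + S\<^sup>2))"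
    proof (rule ennreal_leI)
      \<comment> \<open>Used twice for \<open>r\<close> and once for \<open>s^2\<close>. The loss of
        a factor \<open>2\<close> in the exponent is the origin of
        \<open>2 * \<rho>\<close>.\<close>
      have half: "exp (- 2 * y) \<le> 1 - y" if "0 \<le> y" "y \<le> 1 / 2" for y :: real
      proof -
        have "1 \<le> (1 - y) * (1 + 2 * y)" using that mult_left_mono[OF that(2,1)] by (simp add: algebra_simps)
        also have "\<dots> \<le> (1 - y) * exp (2 * y)"
          using that exp_ge_add_one_self[of "2 * y"] by (intro mult_left_mono) auto
        finally show ?thesis by (simp add: exp_minus field_simps)
      qed
      have s12: "s \<le> 1 / 2" unfolding s_def using S by linarith
      have "s\<^sup>2 \<le> (1 / 2)\<^sup>2" using s0 s12 by (intro power_mono) auto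
      then have s2: "s\<^sup>2 \<le> 1 / 2" by (simp add: power2_eq_square)
      have r14: "r \<le> 1 / 4" using rs s12 by simp
      have "exp (- (4 * r + 2 * s\<^sup>2)) = exp (- 2 * r) * exp (- 2 * r) * exp (- 2 * s\<^sup>2)"
        by (simp add: exp_add[symmetric])
      also have "\<dots> \<le> ((1 - r) * (1 - r)) * (1 - s\<^sup>2)"
        using half[of r] half[of "s\<^sup>2"] r0 r14 s2 by (intro mult_mono) auto
      also have "\<dots> \<le> (1 - r) * (1 - r) - s\<^sup>2 / 4"
      proof -
        have "(1 / 2) * (1 / 2) \<le> (1 - r) * (1 - r)" using r14 r0 by (intro mult_mono) auto
        then have "(1 / 4) * s\<^sup>2 \<le> ((1 - r) * (1 - r)) * s\<^sup>2" by (intro mult_right_mono) auto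
        then show ?thesis by (simp add: algebra_simps)
      qed
      also have "\<dots> = (1 - ip p a a / 2) * (1 + ip p b b / 2)"
        unfolding aa bb by (simp add: power2_eq_square field_simps)
      finally have "sqrt (exp (- (4 * r + 2 * s\<^sup>2))) \<le> sqrt ((1 - ip p a a / 2) * (1 + ip p b b / 2))"
        by simp
      moreover have "sqrt (exp (- (4 * r + 2 * s\<^sup>2))) = exp (- (2 * r + s\<^sup>2))"
        by (rule real_sqrt_unique) (simp_all add: power2_eq_square exp_add[symmetric])
      ultimately have X: "exp (- (2 * r + s\<^sup>2)) \<le> sqrt ((1 - ip p a a / 2) * (1 + ip p b b / 2))"
        by (simp only:)
      have "1 / sqrt ((1 - ip p a a / 2) * (1 + ip p b b / 2)) \<le> 1 / exp (- (2 * r + s\<^sup>2))"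
        by (intro divide_left_mono X mult_pos_pos less_le_trans[OF exp_gt_zero X] exp_gt_zero) simp
      also have "\<dots> = exp (2 * r + s\<^sup>2)"
        using exp_minus[of "- (2 * r + s\<^sup>2)"] by (simp only: minus_minus inverse_eq_divide)
      also have "\<dots> \<le> exp (2 * \<rho> + S\<^sup>2)"
        using cd S s0 by (auto simp: r_def s_def[symmetric] intro!: add_mono power_mono)
      finally show "1 / sqrt ((1 - ip p a a / 2) * (1 + ip p b b / 2)) \<le> exp (2 * \<rho> + S\<^sup>2)" .
    qed
    finally show ?thesis .
  qed
  have "ennreal (LR n c z * LR n d z) = (\<Prod>i<n. ennreal (lr c (z i) * lr d (z i)))" for z
    unfolding LR_def prod.distrib[symmetric]
    by (rule prod_ennreal[symmetric]) (intro mult_nonneg_nonneg less_imp_le lr_pos)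
  then have "(\<integral>\<^sup>+ z. ennreal (LR n c z * LR n d z) \<partial>data_law n p \<theta>)
      = (\<integral>\<^sup>+ z. (\<Prod>i<n. ennreal (lr c (z i) * lr d (z i))) \<partial>data_law n p \<theta>)"
    by simp
  also have "\<dots> = (\<Prod>i<n. \<integral>\<^sup>+ z. ennreal (lr c z * lr d z) \<partial>obs_law p \<theta>)"
    by (rule nn_integral_data_prod) measurable
  also have "\<dots> \<le> (\<Prod>i<n. ennreal (exp (2 * \<rho> + S\<^sup>2)))"
    by (rule prod_mono_ennreal) (rule obs)
  also have "\<dots> = ennreal (exp (real n * (2 * \<rho> + S\<^sup>2)))"
    by (simp add: ennreal_power exp_of_nat_mult[symmetric])
  finally show ?thesis .
qed

end

text \<open>The excess of the power over the mean level is at most \<open>E |1 - L|\<close> for the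
  mixture ratio \<open>L\<close>. By the inequality of arithmetic and geometric means this is at
  most \<open>\<epsilon> / 2 + E (1 - L)^2 / (2 * \<epsilon>)\<close>, and
  \<open>E (1 - L)^2 = E L^2 - 1 <= \<epsilon>^2\<close>.\<close>

lemma (in prob_space) mixture_testing:
  fixes l :: "'d \<Rightarrow> 'a \<Rightarrow> real" and w \<epsilon> :: real
  assumes D: "finite D" and w: "0 \<le> w" "w * real (card D) = 1"
    and l [measurable]: "\<And>d. d \<in> D \<Longrightarrow> l d \<in> borel_measurable M"
    and l0: "\<And>d x. 0 \<le> l d x"
    and l1: "\<And>d. d \<in> D \<Longrightarrow> (\<integral>\<^sup>+ x. ennreal (l d x) \<partial>M) = 1"
    and l2: "\<And>d d'. d \<in> D \<Longrightarrow> d' \<in> D \<Longrightarrow> (\<integral>\<^sup>+ x. ennreal (l d x * l d' x) \<partial>M) \<le> ennreal (c d d')"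
    and c: "\<And>d d'. 0 \<le> c d d'" "w\<^sup>2 * (\<Sum>d\<in>D. \<Sum>d'\<in>D. c d d') \<le> 1 + \<epsilon>\<^sup>2" and e: "0 < \<epsilon>"
    and psi [measurable]: "\<psi> \<in> borel_measurable M" and psi01: "\<And>x. x \<in> space M \<Longrightarrow> 0 \<le> \<psi> x \<and> \<psi> x \<le> 1"
  shows "(\<integral>x. \<psi> x \<partial>M) \<le> w * (\<Sum>d\<in>D. \<integral>x. l d x * \<psi> x \<partial>M) + \<epsilon>"
proof -
  have il: "integrable M (l d)" if "d \<in> D" for d
    using l1[OF that] l0 that by (intro integrableI_nonneg) auto
  have el: "(\<integral>x. l d x \<partial>M) = 1" if "d \<in> D" for d
    using l1[OF that] l0 that by (subst integral_eq_nn_integral) auto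
  have ill: "integrable M (\<lambda>x. l d x * l d' x)" if "d \<in> D" "d' \<in> D" for d d'
    using l2[OF that] l0 that by (intro integrableI_nonneg) (auto intro: le_less_trans)
  have ell: "(\<integral>x. l d x * l d' x \<partial>M) \<le> c d d'" if "d \<in> D" "d' \<in> D" for d d'
    using l2[OF that] l0 that c by (subst integral_eq_nn_integral) (auto intro!: enn2real_leI)
  have ilp: "integrable M (\<lambda>x. l d x * \<psi> x)" if "d \<in> D" for d
  proof (rule Bochner_Integration.integrable_bound[OF il[OF that]])
    show "(\<lambda>x. l d x * \<psi> x) \<in> borel_measurable M" using that by measurable
    show "AE x in M. norm (l d x * \<psi> x) \<le> norm (l d x)"
    proof (rule AE_I2)
      fix x assume "x \<in> space M"
      then show "norm (l d x * \<psi> x) \<le> norm (l d x)"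
        using psi01[of x] l0[of d x] mult_left_mono[of "\<psi> x" 1 "l d x"] by (simp add: abs_mult)
    qed
  qed
  have ip: "integrable M \<psi>"
    by (rule integrable_const_bound[where B = 1]) (use psi01 in auto)
  define L where "L x = w * (\<Sum>d\<in>D. l d x)" for x
  have iL: "integrable M L" unfolding L_def by (intro integrable_mult_right Bochner_Integration.integrable_sum il)
  have eL: "(\<integral>x. L x \<partial>M) = 1"
    unfolding L_def using w by (simp add: il el)
  have LL: "L x * L x = w\<^sup>2 * (\<Sum>d\<in>D. \<Sum>d'\<in>D. l d x * l d' x)" for x
    by (simp add: L_def power2_eq_square sum_product mult_ac)
  have iLL: "integrable M (\<lambda>x. L x * L x)"
    unfolding LL by (intro integrable_mult_right Bochner_Integration.integrable_sum ill)
  have "(\<integral>x. L x * L x \<partial>M) = w\<^sup>2 * (\<Sum>d\<in>D. \<Sum>d'\<in>D. \<integral>x. l d x * l d' x \<partial>M)"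
    unfolding LL by (simp add: ill)
  also have "\<dots> \<le> w\<^sup>2 * (\<Sum>d\<in>D. \<Sum>d'\<in>D. c d d')" by (intro mult_left_mono sum_mono ell) auto
  also have "\<dots> \<le> 1 + \<epsilon>\<^sup>2" by (rule c)
  finally have eLL: "(\<integral>x. L x * L x \<partial>M) \<le> 1 + \<epsilon>\<^sup>2" .
  have iLp: "integrable M (\<lambda>x. L x * \<psi> x)"
    unfolding L_def mult.assoc sum_distrib_right by (intro integrable_mult_right Bochner_Integration.integrable_sum ilp)
  have "(\<integral>x. \<psi> x - L x * \<psi> x \<partial>M) \<le> (\<integral>x. \<epsilon> / 2 + (1 - 2 * L x + L x * L x) / (2 * \<epsilon>) \<partial>M)"
  proof (rule integral_mono)
    fix x assume "x \<in> space M"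
    then have p01: "0 \<le> \<psi> x" "\<psi> x \<le> 1" using psi01 by auto
    have "\<psi> x - L x * \<psi> x = \<psi> x * (1 - L x)" by (simp add: algebra_simps)
    also have "\<dots> \<le> \<psi> x * \<bar>1 - L x\<bar>" using p01 by (intro mult_left_mono) auto
    also have "\<dots> \<le> 1 * \<bar>1 - L x\<bar>" using p01 by (intro mult_right_mono) auto
    also have "\<dots> \<le> \<epsilon> / 2 + (1 - 2 * L x + L x * L x) / (2 * \<epsilon>)"
    proof -
      have "0 \<le> (\<epsilon> - \<bar>1 - L x\<bar>)\<^sup>2" by simp
      also have "\<dots> = \<epsilon>\<^sup>2 - 2 * \<epsilon> * \<bar>1 - L x\<bar> + (1 - L x)\<^sup>2" by (simp add: power2_diff)
      finally have "2 * \<epsilon> * \<bar>1 - L x\<bar> \<le> \<epsilon>\<^sup>2 + (1 - L x)\<^sup>2" by simp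
      then have "\<bar>1 - L x\<bar> \<le> (\<epsilon>\<^sup>2 + (1 - L x)\<^sup>2) / (2 * \<epsilon>)" using e by (simp add: field_simps)
      also have "\<dots> = \<epsilon> / 2 + (1 - 2 * L x + L x * L x) / (2 * \<epsilon>)"
        using e by (simp add: add_divide_distrib diff_divide_distrib power2_eq_square algebra_simps)
      finally show ?thesis by simp
    qed
    finally show "\<psi> x - L x * \<psi> x \<le> \<epsilon> / 2 + (1 - 2 * L x + L x * L x) / (2 * \<epsilon>)" .
  qed (use ip iLp iL iLL in auto)
  also have "\<dots> = \<epsilon> / 2 + (1 - 2 * 1 + (\<integral>x. L x * L x \<partial>M)) / (2 * \<epsilon>)"
    using iL iLL eL by (simp add: prob_space)
  also have "\<dots> \<le> \<epsilon> / 2 + (1 - 2 * 1 + (1 + \<epsilon>\<^sup>2)) / (2 * \<epsilon>)"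
    using eLL e by (intro add_left_mono divide_right_mono) auto
  also have "\<dots> = \<epsilon>" using e by (simp add: power2_eq_square)
  finally have "(\<integral>x. \<psi> x \<partial>M) - (\<integral>x. L x * \<psi> x \<partial>M) \<le> \<epsilon>"
    using ip iLp by simp
  moreover have "(\<integral>x. L x * \<psi> x \<partial>M) = w * (\<Sum>d\<in>D. \<integral>x. l d x * \<psi> x \<partial>M)"
    unfolding L_def mult.assoc sum_distrib_right by (simp add: ilp)
  ultimately show ?thesis by simp
qed

subsection \<open>Lower bound: the least favourable prior\<close>

text \<open>Each later chunk of length \<open>N\<close> is dominated by the first. This is how
  \<open>H\<close> is compared at different cutoffs.\<close>

lemma sum_antitone_chunks:
  fixes g :: "nat \<Rightarrow> real"
  assumes "\<And>i j. i \<le> j \<Longrightarrow> g j \<le> g i"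
  shows "(\<Sum>j<q * N. g j) \<le> real q * (\<Sum>j<N. g j)"
proof -
  have "(\<Sum>j<q * N. g j) = (\<Sum>m<q. sum g {m * N..<m * N + N})" by (rule sum.nat_group[symmetric])
  also have "\<dots> \<le> (\<Sum>m<q. \<Sum>j<N. g j)"
  proof (rule sum_mono)
    fix m
    have "sum g {m * N..<m * N + N} = sum g {0 + m * N..<N + m * N}" by (simp add: add.commute)
    also have "\<dots> = (\<Sum>j<N. g (j + m * N))"
      unfolding sum.shift_bounds_nat_ivl by (simp add: lessThan_atLeast0)
    also have "\<dots> \<le> (\<Sum>j<N. g j)" by (intro sum_mono assms) simp
    finally show "sum g {m * N..<m * N + N} \<le> (\<Sum>j<N. g j)" .
  qed
  finally show ?thesis by simp
qed

text \<open>Extension by zero, so that cutoffs beyond the dimension need no case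
  distinction.\<close>

definition sq0 :: "real vec \<Rightarrow> nat \<Rightarrow> real" where
  "sq0 \<xi> j = (if j < dim_vec \<xi> then (\<xi> $ j)\<^sup>2 else 0)"

lemma sq0_antitone:
  assumes "loading p \<xi>" "i \<le> j" shows "sq0 \<xi> j \<le> sq0 \<xi> i"
  using loading_mono[OF assms] assms by (auto simp: sq0_def loading_def abs_le_square_iff)

lemma sum_sq0: "(\<Sum>j<N. sq0 \<xi> j) = (\<Sum>j<min N (dim_vec \<xi>). (\<xi> $ j)\<^sup>2)"
  unfolding sq0_def by (rule sum.mono_neutral_cong_right) auto

lemma triangle_mono: "b \<le> c \<Longrightarrow> triangle b \<le> triangle c"
  by (induction rule: dec_induct) auto

text \<open>The positions \<open>triangle b + i\<close> with \<open>i <= b\<close> hit each index at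
  most once, so perturbations of different blocks never meet.\<close>

lemma triangle_unique:
  assumes "i \<le> b" "j \<le> c" "triangle b + i = triangle c + j" shows "b = c"
proof -
  have "\<not> x < y" if "k \<le> x" "triangle x + k = triangle y + m" for x y k m
  proof
    assume "x < y"
    then have "triangle (Suc x) \<le> triangle y" by (intro triangle_mono) simp
    then show False using that by simp
  qed
  from this[OF assms(1,3)] this[OF assms(2) assms(3)[symmetric]] show ?thesis by simp
qed

text \<open>Block \<open>b\<close> consists of the \<open>b + 1\<close> coordinates from \<open>triangle b\<close> on; \<open>v b\<close> is its
  smallest entry. One coordinate per block is perturbed, so \<open>ku\<close> blocks reach the first
  \<open>ku * (ku + 1) / 2\<close> coordinates. The perturbation is inversely proportional to the loading,
  which makes the perturbation of the linear functional deterministic.\<close>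

locale blocks =
  fixes p ku :: nat and \<xi> :: "real vec" and a :: real and n :: nat
  assumes l: "loading p \<xi>" and fits: "triangle ku \<le> p" and ku: "0 < ku" and n: "0 < n" and a: "0 < a"
begin

definition "v b = \<bar>\<xi> $ (triangle b + b)\<bar>"
text \<open>Blocks that reach a zero entry are left out, because the perturbation divides by the
  loading; their terms in \<open>V\<close> are zero.\<close>

definition "B = {b. b < ku \<and> 0 < v b}"
definition "V = (\<Sum>b<ku. real (b + 1) * (v b)\<^sup>2)"
text \<open>Maximises the shift \<open>sum amp b\<close> of the functional at fixed cost
  \<open>sum (amp b / v b)^2 / (b + 1)\<close>, by equality in Cauchy-Schwarz. The maximum is
  proportional to \<open>sqrt V\<close>.\<close>

definition "amp b = a * (real (b + 1) * (v b)\<^sup>2) / (sqrt (real n) * sqrt V)"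
definition "D = Pi\<^sub>E B (\<lambda>b. {..b})"
definition "delta d j = (\<Sum>b\<in>B. if j = triangle b + d b then amp b / \<xi> $ j else 0)"
text \<open>The squared perturbation in block \<open>b\<close> is at most
  \<open>a^2 * y b\<close>.\<close>

definition "y b = (real (b + 1))\<^sup>2 * (v b)\<^sup>2 / (real n * V)"

lemma finite_B [simp]: "finite B" by (simp add: B_def)

lemma finite_D: "finite D" by (simp add: D_def finite_PiE)

lemma carrier: "\<xi> \<in> carrier_vec p" using l by (simp add: loading_def)

lemma position_less: "b < ku \<Longrightarrow> i \<le> b \<Longrightarrow> triangle b + i < p"
  using triangle_mono[of "Suc b" ku] fits by simp

lemma v0: "0 < v 0" using loading_first[OF l] by (simp add: v_def)

lemma zero_in_B: "0 \<in> B" using v0 ku by (simp add: B_def)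

lemma V_pos: "0 < V"
proof -
  have "real (0 + 1) * (v 0)\<^sup>2 \<le> V" unfolding V_def using ku by (intro member_le_sum) auto
  then show ?thesis using v0 by (simp add: less_le_trans[rotated])
qed

lemma V_eq_B: "V = (\<Sum>b\<in>B. real (b + 1) * (v b)\<^sup>2)"
  unfolding V_def by (rule sum.mono_neutral_right) (auto simp: B_def v_def)

lemma v_le: "b < ku \<Longrightarrow> i \<le> b \<Longrightarrow> v b \<le> \<bar>\<xi> $ (triangle b + i)\<bar>"
  unfolding v_def by (rule loading_mono[OF l]) (auto simp: position_less)

lemma v_antitone: "b \<le> c \<Longrightarrow> c < ku \<Longrightarrow> v c \<le> v b"
  unfolding v_def using triangle_mono[of b c]
  by (intro loading_mono[OF l]) (auto simp: position_less)

text \<open>The entries \<open>v\<close> decrease, so \<open>V\<close> is at least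
  \<open>1 + ... + (b + 1)\<close> times \<open>(v b)^2\<close>. Hence no single perturbation
  exceeds a multiple of \<open>1 / sqrt n\<close>, and each block contributes a bounded exponent to
  the second moment.\<close>

lemma block_sq_le:
  assumes "b < ku" shows "(real (b + 1))\<^sup>2 * (v b)\<^sup>2 \<le> 2 * V"
proof -
  have gauss: "2 * (\<Sum>c<b + 1. real (c + 1)) = real (b + 1) * real (b + 2)"
    by (induction b) (auto simp: algebra_simps)
  have "(real (b + 1))\<^sup>2 * (v b)\<^sup>2 \<le> (real (b + 1) * real (b + 2)) * (v b)\<^sup>2"
    by (intro mult_right_mono) (auto simp: power2_eq_square)
  also have "\<dots> = 2 * (\<Sum>c<b + 1. real (c + 1) * (v b)\<^sup>2)"
    unfolding gauss[symmetric] by (simp only: sum_distrib_right mult.assoc)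
  also have "\<dots> \<le> 2 * (\<Sum>c<b + 1. real (c + 1) * (v c)\<^sup>2)"
    using assms v_antitone
    by (intro mult_left_mono sum_mono power_mono) (auto simp: v_def)
  also have "\<dots> \<le> 2 * V"
    unfolding V_def using assms by (intro mult_left_mono sum_mono2) auto
  finally show ?thesis .
qed

lemma D_le: "d \<in> D \<Longrightarrow> b \<in> B \<Longrightarrow> d b \<le> b"
  by (auto simp: D_def)

lemma delta_position:
  assumes "d \<in> D" "d' \<in> D" "b \<in> B"
  shows "delta d (triangle b + d' b) = (if d b = d' b then amp b / \<xi> $ (triangle b + d b) else 0)"
proof -
  have "delta d (triangle b + d' b)
      = (\<Sum>c\<in>B. if c = b then (if d b = d' b then amp b / \<xi> $ (triangle b + d b) else 0) else 0)"
    unfolding delta_def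
  proof (rule sum.cong[OF refl])
    fix c assume c: "c \<in> B"
    have "triangle b + d' b = triangle c + d c \<Longrightarrow> b = c"
      using triangle_unique[of "d' b" b "d c" c] D_le assms c by blast
    then show "(if triangle b + d' b = triangle c + d c then amp c / \<xi> $ (triangle b + d' b) else 0)
        = (if c = b then if d b = d' b then amp b / \<xi> $ (triangle b + d b) else 0 else 0)"
      by (cases "c = b") (simp_all, metis)
  qed
  then show ?thesis using assms by simp
qed

lemma ip_delta:
  assumes "d \<in> D"
  shows "ip p x (delta d) = (\<Sum>b\<in>B. x (triangle b + d b) * (amp b / \<xi> $ (triangle b + d b)))"
proof -
  have "ip p x (delta d) = (\<Sum>j<p. \<Sum>b\<in>B. if j = triangle b + d b then x j * (amp b / \<xi> $ j) else 0)"
    unfolding ip_def delta_def sum_distrib_left by (intro sum.cong refl) auto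
  also have "\<dots> = (\<Sum>b\<in>B. \<Sum>j<p. if j = triangle b + d b then x j * (amp b / \<xi> $ j) else 0)"
    by (rule sum.swap)
  also have "\<dots> = (\<Sum>b\<in>B. x (triangle b + d b) * (amp b / \<xi> $ (triangle b + d b)))"
  proof (rule sum.cong[OF refl])
    fix b assume b: "b \<in> B"
    then have "triangle b + d b < p" using D_le[OF assms b] by (intro position_less) (auto simp: B_def)
    then show "(\<Sum>j<p. if j = triangle b + d b then x j * (amp b / \<xi> $ j) else 0)
        = x (triangle b + d b) * (amp b / \<xi> $ (triangle b + d b))" by simp
  qed
  finally show ?thesis .
qed

lemma xi_position: "d \<in> D \<Longrightarrow> b \<in> B \<Longrightarrow> \<xi> $ (triangle b + d b) \<noteq> 0"
  using v_le[of b "d b"] D_le[of d b] by (auto simp: B_def)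

lemma ip_xi_delta:
  assumes "d \<in> D" shows "ip p (($) \<xi>) (delta d) = a * sqrt V / sqrt (real n)"
proof -
  have "ip p (($) \<xi>) (delta d) = (\<Sum>b\<in>B. amp b)"
    unfolding ip_delta[OF assms] using xi_position[OF assms] by (intro sum.cong) auto
  also have "\<dots> = a * (\<Sum>b\<in>B. real (b + 1) * (v b)\<^sup>2) / (sqrt (real n) * sqrt V)"
    unfolding amp_def by (simp add: sum_distrib_left sum_divide_distrib)
  also have "\<dots> = a * sqrt V / sqrt (real n)"
    unfolding V_eq_B[symmetric] using V_pos n real_sqrt_mult_self[of V] by (simp add: field_simps)
  finally show ?thesis .
qed

lemma y_nonneg: "0 \<le> y b" using V_pos by (simp add: y_def)

lemma y_le: "b < ku \<Longrightarrow> y b \<le> 2 / real n"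
  unfolding y_def using block_sq_le[of b] V_pos n by (simp add: field_simps)

lemma amp_sq_le:
  assumes "d \<in> D" "b \<in> B" shows "(amp b / \<xi> $ (triangle b + d b))\<^sup>2 \<le> a\<^sup>2 * y b"
proof -
  have b: "b < ku" "0 < v b" using assms by (auto simp: B_def)
  have "(v b)\<^sup>2 \<le> (\<xi> $ (triangle b + d b))\<^sup>2"
    using v_le[OF b(1) D_le[OF assms]] b by (simp add: abs_le_square_iff[symmetric])
  then have "(amp b)\<^sup>2 / (\<xi> $ (triangle b + d b))\<^sup>2 \<le> (amp b)\<^sup>2 / (v b)\<^sup>2"
    using b by (intro divide_left_mono mult_pos_pos) (auto simp: xi_position[OF assms])
  also have "\<dots> = a\<^sup>2 * y b"
  proof -
    have e: "(sqrt (real n) * sqrt V)\<^sup>2 = real n * V"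
      using V_pos by (simp only: power_mult_distrib) simp
    have "(amp b)\<^sup>2 = (a\<^sup>2 * y b) * (v b)\<^sup>2"
      unfolding amp_def y_def power_divide e by (simp add: power2_eq_square)
    then show ?thesis using b by simp
  qed
  finally show ?thesis by (simp add: power_divide)
qed

lemma ip_delta_delta:
  assumes "d \<in> D" "d' \<in> D"
  shows "0 \<le> ip p (delta d) (delta d')"
    and "ip p (delta d) (delta d') \<le> a\<^sup>2 * (\<Sum>b\<in>B. if d b = d' b then y b else 0)"
proof -
  have e: "ip p (delta d) (delta d')
      = (\<Sum>b\<in>B. if d b = d' b then (amp b / \<xi> $ (triangle b + d b))\<^sup>2 else 0)"
    unfolding ip_delta[OF assms(2)]
    by (intro sum.cong refl) (auto simp: delta_position[OF assms] power2_eq_square)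
  show "0 \<le> ip p (delta d) (delta d')" unfolding e by (intro sum_nonneg) auto
  show "ip p (delta d) (delta d') \<le> a\<^sup>2 * (\<Sum>b\<in>B. if d b = d' b then y b else 0)"
    unfolding e sum_distrib_left using amp_sq_le[OF assms(2)] by (intro sum_mono) auto
qed

lemma ip_delta_self:
  assumes "d \<in> D" shows "ip p (delta d) (delta d) \<le> 2 * a\<^sup>2 * real ku / real n"
proof -
  have "ip p (delta d) (delta d) \<le> a\<^sup>2 * (\<Sum>b\<in>B. y b)"
    using ip_delta_delta(2)[OF assms assms] by simp
  also have "(\<Sum>b\<in>B. y b) \<le> (\<Sum>b\<in>B. 2 / real n)" by (intro sum_mono y_le) (simp add: B_def)
  also have "\<dots> \<le> real ku * (2 / real n)"
  proof -
    have "card B \<le> ku" using card_mono[of "{..<ku}" B] by (auto simp: B_def)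
    then show ?thesis by (simp add: divide_right_mono)
  qed
  finally have "ip p (delta d) (delta d) \<le> a\<^sup>2 * (real ku * (2 / real n))"
    by (simp add: mult_left_mono)
  then show ?thesis by (simp add: mult_ac)
qed

definition "w = 1 / real (card D)"

lemma card_D: "real (card D) = (\<Prod>b\<in>B. real (b + 1))"
  unfolding D_def by (subst card_PiE) simp_all

lemma w: "0 \<le> w" "w * real (card D) = 1"
  unfolding w_def card_D by (auto simp: prod_nonneg)

text \<open>Two independent draws agree in block \<open>b\<close> with probability
  \<open>1 / (b + 1)\<close>, independently over the blocks, so the mean is the product of the
  factors \<open>1 + (exp (X b) - 1) / (b + 1)\<close>. On \<open>[0, 1]\<close>,
  \<open>exp x - 1 <= 2 * x\<close>.\<close>

lemma prior_sum:
  assumes X: "\<And>b. b \<in> B \<Longrightarrow> 0 \<le> X b \<and> X b \<le> 1"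
  shows "w\<^sup>2 * (\<Sum>d\<in>D. \<Sum>d'\<in>D. exp (\<Sum>b\<in>B. if d b = d' b then X b else 0))
    \<le> exp (\<Sum>b\<in>B. 2 * X b / real (b + 1))"
proof -
  define g where "g b i j = exp (if i = j then X b else 0)" for b and i j :: nat
  have "(\<Sum>d\<in>D. \<Sum>d'\<in>D. exp (\<Sum>b\<in>B. if d b = d' b then X b else 0))
      = (\<Sum>d\<in>D. \<Sum>d'\<in>D. \<Prod>b\<in>B. g b (d b) (d' b))"
    by (simp add: exp_sum g_def)
  also have "\<dots> = (\<Sum>d\<in>D. \<Prod>b\<in>B. \<Sum>j\<le>b. g b (d b) j)"
    unfolding D_def by (intro sum.cong refl prod_sum_PiE[symmetric]) auto
  also have "\<dots> = (\<Prod>b\<in>B. \<Sum>i\<le>b. \<Sum>j\<le>b. g b i j)"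
    unfolding D_def by (intro prod_sum_PiE[symmetric]) auto
  finally have "w\<^sup>2 * (\<Sum>d\<in>D. \<Sum>d'\<in>D. exp (\<Sum>b\<in>B. if d b = d' b then X b else 0))
      = (\<Prod>b\<in>B. (\<Sum>i\<le>b. \<Sum>j\<le>b. g b i j) / (real (b + 1))\<^sup>2)"
    by (simp add: w_def card_D power_divide prod_dividef prod_power_distrib)
  also have "\<dots> \<le> (\<Prod>b\<in>B. exp (2 * X b / real (b + 1)))"
  proof (rule prod_mono, intro conjI)
    fix b assume b: "b \<in> B"
    show "0 \<le> (\<Sum>i\<le>b. \<Sum>j\<le>b. g b i j) / (real (b + 1))\<^sup>2"
      by (intro divide_nonneg_nonneg sum_nonneg) (auto simp: g_def)
    have "(\<Sum>i\<le>b. \<Sum>j\<le>b. g b i j) = (\<Sum>i\<le>b. real (b + 1) + (exp (X b) - 1))"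
    proof (rule sum.cong[OF refl])
      fix i assume "i \<in> {..b}"
      have "(\<Sum>j\<le>b. g b i j) = (\<Sum>j\<le>b. 1 + (if j = i then exp (X b) - 1 else 0))"
        by (intro sum.cong) (auto simp: g_def)
      also have "\<dots> = real (b + 1) + (exp (X b) - 1)"
        using \<open>i \<in> {..b}\<close> by (simp add: sum.distrib)
      finally show "(\<Sum>j\<le>b. g b i j) = real (b + 1) + (exp (X b) - 1)" .
    qed
    also have "\<dots> = (real (b + 1))\<^sup>2 + real (b + 1) * (exp (X b) - 1)"
      by (simp add: power2_eq_square algebra_simps)
    finally have "(\<Sum>i\<le>b. \<Sum>j\<le>b. g b i j) / (real (b + 1))\<^sup>2 = 1 + (exp (X b) - 1) / real (b + 1)"
      by (simp add: add_divide_distrib power2_eq_square del: of_nat_add)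
    also have "\<dots> \<le> 1 + 2 * X b / real (b + 1)"
    proof -
      have "exp (X b) \<le> 1 + X b + (X b)\<^sup>2" using X[OF b] by (intro exp_bound) auto
      moreover have "(X b)\<^sup>2 \<le> X b" using X[OF b] by (simp add: power2_eq_square mult_left_le)
      ultimately show ?thesis by (intro add_left_mono divide_right_mono) auto
    qed
    also have "\<dots> \<le> exp (2 * X b / real (b + 1))" by (rule exp_ge_add_one_self)
    finally show "(\<Sum>i\<le>b. \<Sum>j\<le>b. g b i j) / (real (b + 1))\<^sup>2 \<le> exp (2 * X b / real (b + 1))" .
  qed
  also have "\<dots> = exp (\<Sum>b\<in>B. 2 * X b / real (b + 1))" by (simp add: exp_sum)
  finally show ?thesis .
qed

text \<open>The cost of the prior, which the normalisation of \<open>amp\<close> makes independent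
  of the loading.\<close>

lemma sum_y: "(\<Sum>b\<in>B. y b / real (b + 1)) = 1 / real n"
proof -
  have "(\<Sum>b\<in>B. y b / real (b + 1)) = (\<Sum>b\<in>B. real (b + 1) * (v b)\<^sup>2) / (real n * V)"
  proof -
    have "k\<^sup>2 * u / W / k = k * u / W" if "k \<noteq> 0" for k u W :: real
      using that by (simp add: power2_eq_square)
    then show ?thesis unfolding y_def sum_divide_distrib by (intro sum.cong refl) simp
  qed
  then show ?thesis using V_pos unfolding V_eq_B[symmetric] by simp
qed

text \<open>\<open>V\<close> counts each block by its smallest entry, which loses only a constant:
  the \<open>m + 2\<close> entries of block \<open>m + 1\<close> are at most \<open>v m\<close>, and
  \<open>m + 2 <= 2 * (m + 1)\<close>. Block \<open>0\<close> is counted apart, and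
  \<open>ku^2 <= 2 * triangle ku\<close> supplies the last factor \<open>2\<close>.\<close>

lemma H_le_V: "(H ((real ku)\<^sup>2) \<xi>)\<^sup>2 \<le> 6 * V"
proof -
  have ind: "(\<Sum>j<triangle (Suc m). sq0 \<xi> j) \<le> (v 0)\<^sup>2 + 2 * (\<Sum>b<m. real (b + 1) * (v b)\<^sup>2)"
    if "m < ku" for m
    using that
  proof (induction m)
    case 0
    then show ?case by (simp add: sq0_def v_def)
  next
    case (Suc m)
    have "(\<Sum>j<triangle (Suc (Suc m)). sq0 \<xi> j)
        = (\<Sum>j<triangle (Suc m). sq0 \<xi> j) + sum (sq0 \<xi>) {triangle (Suc m)..<triangle (Suc (Suc m))}"
      unfolding lessThan_atLeast0 by (rule sum.atLeastLessThan_concat[symmetric]) auto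
    also have "sum (sq0 \<xi>) {triangle (Suc m)..<triangle (Suc (Suc m))}
        \<le> real (card {triangle (Suc m)..<triangle (Suc (Suc m))}) * (v m)\<^sup>2"
    proof (rule sum_bounded_above)
      fix j assume "j \<in> {triangle (Suc m)..<triangle (Suc (Suc m))}"
      then have "sq0 \<xi> j \<le> sq0 \<xi> (triangle m + m)" by (intro sq0_antitone[OF l]) simp
      also have "\<dots> = (v m)\<^sup>2"
        using position_less[of m m] Suc.prems carrier by (simp add: sq0_def v_def)
      finally show "sq0 \<xi> j \<le> (v m)\<^sup>2" .
    qed
    also have "real (card {triangle (Suc m)..<triangle (Suc (Suc m))}) * (v m)\<^sup>2 \<le> 2 * (real (m + 1) * (v m)\<^sup>2)"
      using mult_right_mono[of "real (m + 2)" "2 * real (m + 1)" "(v m)\<^sup>2"] by (simp add: algebra_simps)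
    finally show ?case using Suc by simp
  qed
  have v0V: "(v 0)\<^sup>2 \<le> V"
    using member_le_sum[of 0 "{..<ku}" "\<lambda>b. real (b + 1) * (v b)\<^sup>2"] ku by (simp add: V_def)
  have "(\<Sum>j<triangle ku. sq0 \<xi> j) \<le> (v 0)\<^sup>2 + 2 * (\<Sum>b<ku - 1. real (b + 1) * (v b)\<^sup>2)"
    using ind[of "ku - 1"] ku by simp
  also have "(\<Sum>b<ku - 1. real (b + 1) * (v b)\<^sup>2) \<le> V"
    unfolding V_def by (intro sum_mono2) auto
  finally have 3: "(\<Sum>j<triangle ku. sq0 \<xi> j) \<le> 3 * V" using v0V by simp
  have "nat \<lceil>(real ku)\<^sup>2\<rceil> = ku\<^sup>2" by (simp flip: of_nat_power)
  then have "(H ((real ku)\<^sup>2) \<xi>)\<^sup>2 = (\<Sum>j<ku\<^sup>2. sq0 \<xi> j)"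
    using carrier by (simp add: H_sq[OF carrier] sum_sq0)
  also have "\<dots> \<le> (\<Sum>j<2 * triangle ku. sq0 \<xi> j)"
  proof (rule sum_mono2)
    have "even (ku * Suc ku)" by simp
    then have "2 * triangle ku = ku * Suc ku" unfolding triangle_def by (rule dvd_mult_div_cancel)
    then show "{..<ku\<^sup>2} \<subseteq> {..<2 * triangle ku}" by (auto simp: power2_eq_square)
  qed (auto simp: sq0_def)
  also have "\<dots> \<le> real 2 * (\<Sum>j<triangle ku. sq0 \<xi> j)"
    by (rule sum_antitone_chunks) (rule sq0_antitone[OF l])
  also have "\<dots> \<le> 6 * V" using 3 by simp
  finally show ?thesis .
qed

end

section \<open>From the prior to the lower bound on the separation\<close>

lemma spectrum_one_mat: "0 < p \<Longrightarrow> spectrum (1\<^sub>m p :: real mat) = {1}"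
proof -
  assume p: "0 < p"
  have "k = 1" if k: "eigenvalue (1\<^sub>m p :: real mat) k" for k
  proof -
    obtain v where v: "v \<in> carrier_vec p" "v \<noteq> 0\<^sub>v p" "v = k \<cdot>\<^sub>v v"
      using k by (auto simp: eigenvalue_def eigenvector_def)
    then obtain i where i: "i < p" "v $ i \<noteq> 0" by (metis carrier_vecD eq_vecI index_zero_vec)
    have "v $ i = k * v $ i" using arg_cong[OF v(3), of "\<lambda>u. u $ i"] i v(1) by simp
    then show ?thesis using i by simp
  qed
  moreover have "eigenvalue (1\<^sub>m p :: real mat) 1"
    unfolding eigenvalue_def eigenvector_def
    using p by (intro exI[of _ "unit_vec p 0"]) (auto simp: vec_eq_iff unit_vec_def)
  ultimately show ?thesis by (auto simp: spectrum_def)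
qed

lemma Theta_identity:
  assumes "\<beta> \<in> carrier_vec p" "l0 \<beta> \<le> k" "0 < p" "1 < M1" "0 < M2"
  shows "(\<beta>, 1\<^sub>m p, M2) \<in> Theta M1 M2 p k"
  using assms by (simp add: Theta_def lambda_min_def lambda_max_def spectrum_one_mat)

text \<open>The alternative has at most one nonzero coefficient, so it belongs to the class for
  every \<open>k >= 1\<close>. Each null of the mixture equals it minus one \<open>delta d\<close>,
  whose functional is exactly the separation \<tau>.\<close>

theorem le_tau_adap:
  fixes M1 M2 \<alpha> \<eta> a :: real
  assumes M1: "1 < M1" and M2: "0 < M2" and l: "loading p \<xi>" and fits: "triangle ku \<le> p"
    and ku: "0 < ku" and k: "1 \<le> k" and kn: "ku\<^sup>2 \<le> n"
    and small: "0 < a" "20 * a\<^sup>2 \<le> 1" "\<alpha> + 7 * a < 1 - \<eta>"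
  shows "ereal (M2 * a / 3 * (H ((real ku)\<^sup>2) \<xi> / sqrt (real n))) \<le> tau_adap M1 M2 \<alpha> \<eta> n p ku k \<xi> t0"
proof -
  have n0: "0 < n" using kn ku by (metis gr0I le_zero_eq power_eq_0_iff less_irrefl)
  have Ma: "0 < M2 * a" using M2 small by simp
  interpret blocks p ku \<xi> "M2 * a" n by unfold_locales (use l fits ku n0 Ma in auto)
  have first: "0 < p" "\<xi> $ 0 \<noteq> 0" using loading_first[OF l] by auto
  define \<tau> where "\<tau> = M2 * a * sqrt V / sqrt (real n)"
  have \<tau>0: "0 < \<tau>" using Ma V_pos n0 by (simp add: \<tau>_def)
  \<comment> \<open>Supported on coordinate \<open>0\<close>, which is the whole of block
    \<open>0\<close>: every prior draw perturbs it as well, so the difference has at most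
    \<open>ku\<close> nonzero coefficients and not \<open>ku + 1\<close>.\<close>
  define \<beta> where "\<beta> = vec p (\<lambda>j. if j = 0 then (t0 + \<tau>) / \<xi> $ 0 else 0)"
  have \<beta>: "\<beta> \<in> carrier_vec p" by (simp add: \<beta>_def)
  have xb: "ip p (($) \<xi>) (($) \<beta>) = t0 + \<tau>"
  proof -
    have "ip p (($) \<xi>) (($) \<beta>) = (\<Sum>j<p. if j = 0 then t0 + \<tau> else 0)"
      unfolding ip_def using first by (intro sum.cong) (auto simp: \<beta>_def)
    then show ?thesis using first by simp
  qed
  have l0b: "l0 \<beta> \<le> 1"
  proof -
    have "l0 \<beta> \<le> card {0::nat}"
      unfolding l0_eq[OF \<beta>] by (rule card_mono) (auto simp: \<beta>_def split: if_splits)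
    then show ?thesis by simp
  qed
  have th1: "(\<beta>, 1\<^sub>m p, M2) \<in> Theta M1 M2 p k"
    using \<beta> l0b k first M1 M2 by (intro Theta_identity) auto
  interpret model p \<beta> "1\<^sub>m p" M2 by (rule model_of_Theta[OF th1 first(1) M1])
  define \<beta>' where "\<beta>' d = vec p (\<lambda>j. \<beta> $ j - delta d j)" for d
  have b': "\<beta>' d \<in> carrier_vec p" for d by (simp add: \<beta>'_def)
  have b'j: "\<beta>' d $ j = \<beta> $ j - delta d j" if "j < p" for d j using that by (simp add: \<beta>'_def)
  have shift: "data_law n p (\<beta>' d, 1\<^sub>m p, M2) = density (data_law n p (\<beta>, 1\<^sub>m p, M2)) (LR n (delta d))" for d
    by (rule data_law_shift[OF b']) (rule b'j)
  have null: "(\<beta>' d, 1\<^sub>m p, M2) \<in> Theta_null M1 M2 p ku \<xi> t0" if d: "d \<in> D" for d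
  proof -
    have "\<xi> \<bullet> \<beta>' d = ip p (($) \<xi>) (\<lambda>j. \<beta> $ j - delta d j)"
      by (subst scalar_prod_ip[of _ p]) (auto simp: \<beta>'_def intro!: ip_cong)
    also have "\<dots> = t0" using xb ip_xi_delta[OF d] by (simp add: ip_diff_right \<tau>_def)
    finally have x: "\<xi> \<bullet> \<beta>' d = t0" .
    have "l0 (\<beta>' d) \<le> card ((\<lambda>b. triangle b + d b) ` B)"
      unfolding l0_eq[OF b']
    proof (rule card_mono)
      show "{j. j < p \<and> \<beta>' d $ j \<noteq> 0} \<subseteq> (\<lambda>b. triangle b + d b) ` B"
      proof
        fix j assume "j \<in> {j. j < p \<and> \<beta>' d $ j \<noteq> 0}"
        then have j: "j < p" "\<beta> $ j \<noteq> delta d j" by (auto simp: b'j)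
        show "j \<in> (\<lambda>b. triangle b + d b) ` B"
        proof (cases "j = 0")
          case True
          have "d 0 = 0" using D_le[OF d zero_in_B] by simp
          then show ?thesis using True zero_in_B by (auto intro!: image_eqI[of _ _ 0])
        next
          case False
          then have "delta d j \<noteq> 0" using j by (simp add: \<beta>_def)
          then obtain b where "b \<in> B" "(if j = triangle b + d b then amp b / \<xi> $ j else 0) \<noteq> 0"
            unfolding delta_def by (rule sum.not_neutral_contains_not_neutral)
          then have "b \<in> B" "j = triangle b + d b" by (auto split: if_splits)
          then show ?thesis by blast
        qed
      qed
    qed simp
    also have "\<dots> \<le> card B" by (rule card_image_le) simp
    also have "\<dots> \<le> ku" using card_mono[of "{..<ku}" B] by (auto simp: B_def)
    finally have "l0 (\<beta>' d) \<le> ku" .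
    then have "(\<beta>' d, 1\<^sub>m p, M2) \<in> Theta M1 M2 p ku"
      using b' first M1 M2 by (intro Theta_identity) auto
    then show ?thesis using x by (simp add: Theta_null_def)
  qed
  \<comment> \<open>Two squared norms of at most \<open>2 * (M2 * a)^2 * ku / n\<close> each,
    divided by the noise variance \<open>M2^2\<close>.\<close>
  define S where "S = 4 * a\<^sup>2 * real ku / real n"
  have kn': "(real ku)\<^sup>2 \<le> real n" using kn by (metis of_nat_le_iff of_nat_power)
  have S0: "0 \<le> S" using n0 by (simp add: S_def)
  have kun: "real ku \<le> real n"
  proof -
    have "ku \<le> n" using kn le_square[of ku] unfolding power2_eq_square by linarith
    then show ?thesis by simp
  qed
  have S12: "S \<le> 1 / 2"
  proof -
    have "S = 4 * a\<^sup>2 * (real ku / real n)" by (simp add: S_def)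
    also have "\<dots> \<le> 4 * a\<^sup>2 * 1" using kun n0 by (intro mult_left_mono) auto
    finally show ?thesis using small by simp
  qed
  \<comment> \<open>Here \<open>ku^2 <= n\<close> enters: the norms contribute only a bounded factor
    to the second moment.\<close>
  have nS: "real n * S\<^sup>2 \<le> 16 * a\<^sup>2"
  proof -
    have "real n * S\<^sup>2 = 16 * (a\<^sup>2 * a\<^sup>2) * ((real ku)\<^sup>2 / real n)"
      using n0 by (simp add: S_def power2_eq_square field_simps)
    also have "\<dots> \<le> 16 * (a\<^sup>2 * a\<^sup>2) * 1" using kn' n0 by (intro mult_left_mono) auto
    also have "a\<^sup>2 * a\<^sup>2 \<le> a\<^sup>2 * 1" using small by (intro mult_left_mono) auto
    finally show ?thesis by simp
  qed
  define rho where "rho d d' = a\<^sup>2 * (\<Sum>b\<in>B. if d b = d' b then y b else 0)" for d d' :: "nat \<Rightarrow> nat"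
  define c where "c d d' = exp (real n * (2 * rho d d' + S\<^sup>2))" for d d'
  have m2: "(\<integral>\<^sup>+ z. ennreal (LR n (delta d) z * LR n (delta d') z) \<partial>data_law n p (\<beta>, 1\<^sub>m p, M2))
      \<le> ennreal (c d d')" if d: "d \<in> D" "d' \<in> D" for d d'
    unfolding c_def
  proof (rule LR_second_moment[OF refl _ S12])
    have "ip p (delta d) (delta d) + ip p (delta d') (delta d') \<le> 4 * (M2 * a)\<^sup>2 * real ku / real n"
      using ip_delta_self[OF d(1)] ip_delta_self[OF d(2)] by simp
    then show "(ip p (delta d) (delta d) + ip p (delta d') (delta d')) / M2\<^sup>2 \<le> S"
      using M2 by (simp add: S_def power_mult_distrib field_simps)
    show "0 \<le> ip p (delta d) (delta d')" by (rule ip_delta_delta[OF d])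
    show "ip p (delta d) (delta d') / M2\<^sup>2 \<le> rho d d'"
      using ip_delta_delta(2)[OF d] M2 by (simp add: rho_def power_mult_distrib field_simps)
  qed
  \<comment> \<open>The exponents \<open>16 * a^2\<close> from the norms and \<open>4 * a^2\<close>
    from the overlaps add up to \<open>20 * a^2\<close>; then \<open>exp x <= 1 + 2 * x\<close> on
    \<open>[0, 1]\<close> gives \<open>1 + 40 * a^2\<close>, below
    \<open>1 + (7 * a)^2\<close>.\<close>
  have total: "w\<^sup>2 * (\<Sum>d\<in>D. \<Sum>d'\<in>D. c d d') \<le> 1 + (7 * a)\<^sup>2"
  proof -
    let ?X = "\<lambda>b. 2 * real n * a\<^sup>2 * y b"
    have X: "0 \<le> ?X b \<and> ?X b \<le> 1" if "b \<in> B" for b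
    proof
      show "0 \<le> ?X b" using y_nonneg by simp
      have "?X b \<le> 2 * real n * a\<^sup>2 * (2 / real n)"
        using that by (intro mult_left_mono y_le) (auto simp: B_def)
      also have "\<dots> = 4 * a\<^sup>2" using n0 by simp
      also have "\<dots> \<le> 1" using small by simp
      finally show "?X b \<le> 1" .
    qed
    have "c d d' = exp (real n * S\<^sup>2) * exp (\<Sum>b\<in>B. if d b = d' b then ?X b else 0)" for d d'
    proof -
      have "(\<Sum>b\<in>B. if d b = d' b then ?X b else 0) = 2 * real n * rho d d'"
        unfolding rho_def sum_distrib_left by (intro sum.cong) auto
      then show ?thesis unfolding c_def exp_add[symmetric] by (simp add: algebra_simps)
    qed
    then have "w\<^sup>2 * (\<Sum>d\<in>D. \<Sum>d'\<in>D. c d d')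
        = exp (real n * S\<^sup>2) * (w\<^sup>2 * (\<Sum>d\<in>D. \<Sum>d'\<in>D. exp (\<Sum>b\<in>B. if d b = d' b then ?X b else 0)))"
      by (simp add: sum_distrib_left mult_ac)
    also have "\<dots> \<le> exp (real n * S\<^sup>2) * exp (\<Sum>b\<in>B. 2 * ?X b / real (b + 1))"
      by (intro mult_left_mono prior_sum X) auto
    also have "(\<Sum>b\<in>B. 2 * ?X b / real (b + 1)) = 4 * real n * a\<^sup>2 * (\<Sum>b\<in>B. y b / real (b + 1))"
      unfolding sum_distrib_left by (intro sum.cong) auto
    also have "\<dots> = 4 * a\<^sup>2" using n0 by (simp only: sum_y) simp
    also have "exp (real n * S\<^sup>2) * exp (4 * a\<^sup>2) \<le> exp (20 * a\<^sup>2)"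
      unfolding exp_add[symmetric] using nS by simp
    also have "\<dots> \<le> 1 + 20 * a\<^sup>2 + (20 * a\<^sup>2)\<^sup>2" using small by (intro exp_bound) auto
    also have "(20 * a\<^sup>2)\<^sup>2 \<le> 20 * a\<^sup>2"
      using small mult_left_mono[of "20 * a\<^sup>2" 1 "20 * a\<^sup>2"] by (simp add: power2_eq_square)
    also have "1 + 20 * a\<^sup>2 + 20 * a\<^sup>2 \<le> 1 + (7 * a)\<^sup>2" by (simp add: power_mult_distrib)
    finally show ?thesis by simp
  qed
  have power: "expect n p (\<beta>, 1\<^sub>m p, M2) \<psi> \<le> \<alpha> + 7 * a"
    if \<psi>: "\<psi> \<in> Tests n p \<alpha> (Theta_null M1 M2 p ku \<xi> t0)" for \<psi>
  proof -
    have pm [measurable]: "\<psi> \<in> borel_measurable (data_space n p)"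
      and p01: "\<And>z. z \<in> space (data_space n p) \<Longrightarrow> 0 \<le> \<psi> z \<and> \<psi> z \<le> 1"
      and size: "(SUP \<theta>\<in>Theta_null M1 M2 p ku \<xi> t0. ereal (expect n p \<theta> \<psi>)) \<le> ereal \<alpha>"
      using \<psi> by (auto simp: Tests_def)
    have "(\<integral>z. \<psi> z \<partial>data_law n p (\<beta>, 1\<^sub>m p, M2))
        \<le> w * (\<Sum>d\<in>D. \<integral>z. LR n (delta d) z * \<psi> z \<partial>data_law n p (\<beta>, 1\<^sub>m p, M2)) + 7 * a"
    proof (rule data.mixture_testing[OF finite_D w _ LR_nonneg _ m2 _ total])
      fix d assume d: "d \<in> D"
      interpret m': model p "\<beta>' d" "1\<^sub>m p" M2 by unfold_locales (use b' pd M2 in auto)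
      have "1 = emeasure (data_law n p (\<beta>' d, 1\<^sub>m p, M2)) (space (data_law n p (\<beta>' d, 1\<^sub>m p, M2)))"
        by (simp add: m'.data.emeasure_space_1)
      also have "\<dots> = (\<integral>\<^sup>+ z. ennreal (LR n (delta d) z) \<partial>data_law n p (\<beta>, 1\<^sub>m p, M2))"
        unfolding shift
        by (subst emeasure_density) (auto simp: space_data_law intro!: nn_integral_cong)
      finally show "(\<integral>\<^sup>+ z. ennreal (LR n (delta d) z) \<partial>data_law n p (\<beta>, 1\<^sub>m p, M2)) = 1" by simp
    qed (use small p01 in \<open>auto simp: c_def space_data_law\<close>)
    also have "(\<Sum>d\<in>D. \<integral>z. LR n (delta d) z * \<psi> z \<partial>data_law n p (\<beta>, 1\<^sub>m p, M2)) \<le> (\<Sum>d\<in>D. \<alpha>)"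
    proof (rule sum_mono)
      fix d assume d: "d \<in> D"
      have "(\<integral>z. LR n (delta d) z * \<psi> z \<partial>data_law n p (\<beta>, 1\<^sub>m p, M2)) = expect n p (\<beta>' d, 1\<^sub>m p, M2) \<psi>"
        unfolding expect_def shift
        by (subst integral_density) (auto simp: LR_nonneg)
      moreover have "ereal (expect n p (\<beta>' d, 1\<^sub>m p, M2) \<psi>) \<le> ereal \<alpha>"
        by (rule order_trans[OF SUP_upper size]) (rule null[OF d])
      ultimately show "(\<integral>z. LR n (delta d) z * \<psi> z \<partial>data_law n p (\<beta>, 1\<^sub>m p, M2)) \<le> \<alpha>" by simp
    qed
    also have "w * (\<Sum>d\<in>D. \<alpha>) = \<alpha>" using w(2) by (simp add: mult.assoc[symmetric])
    finally show ?thesis using w(1) by (simp add: expect_def mult_left_mono)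
  qed
  have "ereal \<tau> \<le> tau_adap M1 M2 \<alpha> \<eta> n p ku k \<xi> t0"
    unfolding tau_adap_def
  proof (rule Inf_greatest)
    fix e assume "e \<in> {ereal \<tau> | \<tau>. \<tau> > 0 \<and>
      (SUP \<psi> \<in> Tests n p \<alpha> (Theta_null M1 M2 p ku \<xi> t0).
        INF \<theta> \<in> Theta_alt M1 M2 p k \<xi> t0 \<tau>. ereal (expect n p \<theta> \<psi>)) \<ge> ereal (1 - \<eta>)}"
    then obtain \<tau>' where e: "e = ereal \<tau>'" and
      s: "(SUP \<psi> \<in> Tests n p \<alpha> (Theta_null M1 M2 p ku \<xi> t0).
        INF \<theta> \<in> Theta_alt M1 M2 p k \<xi> t0 \<tau>'. ereal (expect n p \<theta> \<psi>)) \<ge> ereal (1 - \<eta>)" by blast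
    show "ereal \<tau> \<le> e"
    proof (rule ccontr)
      assume "\<not> ereal \<tau> \<le> e"
      then have lt: "\<tau>' < \<tau>" by (simp add: e)
      have "\<xi> \<bullet> \<beta> = t0 + \<tau>" using xb \<beta> by (simp add: scalar_prod_ip)
      then have alt: "(\<beta>, 1\<^sub>m p, M2) \<in> Theta_alt M1 M2 p k \<xi> t0 \<tau>'"
        using th1 lt \<tau>0 by (simp add: Theta_alt_def)
      have "(SUP \<psi> \<in> Tests n p \<alpha> (Theta_null M1 M2 p ku \<xi> t0).
        INF \<theta> \<in> Theta_alt M1 M2 p k \<xi> t0 \<tau>'. ereal (expect n p \<theta> \<psi>)) \<le> ereal (\<alpha> + 7 * a)"
      proof (rule SUP_least)
        fix \<psi> assume \<psi>: "\<psi> \<in> Tests n p \<alpha> (Theta_null M1 M2 p ku \<xi> t0)"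
        have "(INF \<theta> \<in> Theta_alt M1 M2 p k \<xi> t0 \<tau>'. ereal (expect n p \<theta> \<psi>))
            \<le> ereal (expect n p (\<beta>, 1\<^sub>m p, M2) \<psi>)" by (rule INF_lower[OF alt])
        also have "\<dots> \<le> ereal (\<alpha> + 7 * a)" using power[OF \<psi>] by simp
        finally show "(INF \<theta> \<in> Theta_alt M1 M2 p k \<xi> t0 \<tau>'. ereal (expect n p \<theta> \<psi>)) \<le> ereal (\<alpha> + 7 * a)" .
      qed
      with s have "ereal (1 - \<eta>) \<le> ereal (\<alpha> + 7 * a)" by (rule order_trans)
      then show False using small by simp
    qed
  qed
  moreover have "M2 * a / 3 * (H ((real ku)\<^sup>2) \<xi> / sqrt (real n)) \<le> \<tau>"
  proof -
    have "(H ((real ku)\<^sup>2) \<xi>)\<^sup>2 \<le> (3 * sqrt V)\<^sup>2"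
      using H_le_V V_pos by (simp add: power_mult_distrib)
    then have "H ((real ku)\<^sup>2) \<xi> \<le> 3 * sqrt V" by (rule power2_le_imp_le) (use V_pos in simp)
    then have "M2 * a * H ((real ku)\<^sup>2) \<xi> \<le> M2 * a * (3 * sqrt V)" using Ma by (intro mult_left_mono) auto
    then show ?thesis using n0 by (simp add: \<tau>_def field_simps)
  qed
  ultimately show ?thesis by (meson ereal_less_eq(3) order_trans)
qed

subsection \<open>The rate \<open>\<nu>\<^sub>1\<close>\<close>

lemma loading_support:
  assumes "loading p \<xi>"
  shows "{j. j < p \<and> \<xi> $ j \<noteq> 0} = {..<l0 \<xi>}"
proof -
  have c: "\<xi> \<in> carrier_vec p" using assms by (simp add: loading_def)
  let ?S = "{j. j < p \<and> \<xi> $ j \<noteq> 0}"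
  have fin: "finite ?S" by simp
  have down: "i \<in> ?S" if "j \<in> ?S" "i \<le> j" for i j
    using loading_mono[OF assms that(2)] that by auto
  have "?S = {..<card ?S}"
  proof (cases "?S = {}")
    case True then show ?thesis unfolding True by simp
  next
    case False
    define m where "m = Max ?S"
    have m: "m \<in> ?S" unfolding m_def by (rule Max_in[OF fin False])
    have "?S = {..m}"
    proof
      show "?S \<subseteq> {..m}" unfolding m_def using Max_ge[OF fin] by blast
      show "{..m} \<subseteq> ?S" using down[OF m] by blast
    qed
    then show ?thesis by (simp add: lessThan_Suc_atMost)
  qed
  then show ?thesis by (simp add: l0_eq[OF c])
qed

text \<open>Here \<open>a\<close> stands for the absolute nonzero loadings; \<open>N\<close> and
  \<open>sqrt D\<close> are numerator and denominator in the equation for \<open>zeta\<close>, which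
  is studied in squared form to avoid the root.\<close>

locale weights =
  fixes m :: nat and a :: "nat \<Rightarrow> real"
  assumes m: "0 < m" and pos: "\<And>j. j < m \<Longrightarrow> 0 < a j" and first: "\<And>j. j < m \<Longrightarrow> a j \<le> a 0"
begin

definition "N z = (\<Sum>j<m. a j * exp (- z / (a j)\<^sup>2))"
definition "D z = (\<Sum>j<m. (a j)\<^sup>2 * exp (- z / (a j)\<^sup>2))"

lemma N_pos: "0 < N z" and D_pos: "0 < D z"
proof -
  have ne: "{..<m} \<noteq> {}" using m by auto
  show "0 < N z" unfolding N_def using pos by (intro sum_pos ne) auto
  have "0 < (a j)\<^sup>2" if "j < m" for j using pos[OF that] by simp
  then show "0 < D z" unfolding D_def by (intro sum_pos ne) auto
qed

lemma cauchy: "(N z)\<^sup>2 \<le> (\<Sum>j<m. exp (- z / (a j)\<^sup>2)) * D z"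
proof -
  let ?e = "\<lambda>j. exp (- z / (a j)\<^sup>2 / 2)"
  have e: "?e j * ?e j = exp (- z / (a j)\<^sup>2)" for j unfolding exp_add[symmetric] by simp
  have "(\<Sum>j<m. ?e j * (a j * ?e j))\<^sup>2 \<le> (\<Sum>j<m. (?e j)\<^sup>2) * (\<Sum>j<m. (a j * ?e j)\<^sup>2)"
    by (rule Cauchy_Schwarz_ineq_sum)
  moreover have "(\<Sum>j<m. ?e j * (a j * ?e j)) = N z"
    unfolding N_def by (intro sum.cong refl) (simp only: mult.left_commute[of "?e _"] e)
  moreover have "(?e j)\<^sup>2 = exp (- z / (a j)\<^sup>2)" for j by (simp only: power2_eq_square[of "?e j"] e)
  ultimately show ?thesis by (simp add: D_def power_mult_distrib)
qed

text \<open>The derivative of \<open>N\<^sup>2 / D\<close> is negative because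
  \<open>a\<^sub>j\<^sup>2 / a\<^sub>i + a\<^sub>i\<^sup>2 / a\<^sub>j \<ge> a\<^sub>i + a\<^sub>j\<close>.\<close>

lemma ratio_decreasing:
  assumes "x < y" shows "(N y)\<^sup>2 / D y < (N x)\<^sup>2 / D x"
proof (rule DERIV_neg_imp_decreasing[OF assms], intro exI conjI)
  fix z :: real
  define w where "w j = exp (- z / (a j)\<^sup>2)" for j
  define N' where "N' = (\<Sum>j<m. w j / a j)"
  define W where "W = (\<Sum>j<m. w j)"
  have w: "0 < w j" for j by (simp add: w_def)
  have d: "((\<lambda>z. k * exp (- z / c)) has_real_derivative - (k * exp (- z / c) / c)) (at z)"
    if "c \<noteq> 0" for k c :: real
    using that by (auto intro!: derivative_eq_intros)
  have ne: "a j \<noteq> 0" if "j < m" for j using pos[OF that] by simp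
  have dN: "(N has_real_derivative - N') (at z)"
    unfolding N_def N'_def w_def sum_negf[symmetric]
    by (intro DERIV_sum DERIV_cong[OF d]) (auto simp: ne power2_eq_square)
  have dD: "(D has_real_derivative - W) (at z)"
    unfolding D_def W_def w_def sum_negf[symmetric]
    by (intro DERIV_sum DERIV_cong[OF d]) (auto simp: ne)
  show "((\<lambda>z. (N z)\<^sup>2 / D z) has_real_derivative
      (2 * N z * (- N') * D z - (N z)\<^sup>2 * (- W)) / (D z * D z)) (at z)"
    using D_pos[of z] by (auto intro!: derivative_eq_intros dN dD simp: power2_eq_square)
  have ineq: "N z * W \<le> N' * D z"
  proof -
    have NW: "N z * W = (\<Sum>i<m. \<Sum>j<m. w i * w j * a i)"
      unfolding N_def W_def w_def sum_product by (intro sum.cong refl) (simp add: mult_ac)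
    also have "\<dots> = (\<Sum>i<m. \<Sum>j<m. w i * w j * a j)"
      by (subst sum.swap) (simp add: mult_ac)
    finally have NW': "N z * W = (\<Sum>i<m. \<Sum>j<m. w i * w j * a j)" .
    have ND: "N' * D z = (\<Sum>i<m. \<Sum>j<m. w i * w j * ((a j)\<^sup>2 / a i))"
      by (simp add: N'_def D_def w_def sum_product mult_ac)
    also have "\<dots> = (\<Sum>i<m. \<Sum>j<m. w i * w j * ((a i)\<^sup>2 / a j))"
      by (subst sum.swap) (simp add: mult_ac)
    finally have ND': "N' * D z = (\<Sum>i<m. \<Sum>j<m. w i * w j * ((a i)\<^sup>2 / a j))" .
    have "N z * W + N z * W = (\<Sum>i<m. \<Sum>j<m. w i * w j * (a i + a j))"
      by (subst (1) NW, subst NW') (simp add: sum.distrib distrib_left)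
    also have "\<dots> \<le> (\<Sum>i<m. \<Sum>j<m. w i * w j * ((a j)\<^sup>2 / a i + (a i)\<^sup>2 / a j))"
    proof (intro sum_mono mult_left_mono)
      fix i j assume "i \<in> {..<m}" "j \<in> {..<m}"
      then have p: "0 < a i" "0 < a j" using pos by auto
      have "0 \<le> (a i + a j) * (a i - a j)\<^sup>2" using p by simp
      then have "(a i + a j) * (a i * a j) \<le> (a j)\<^sup>2 * a j + (a i)\<^sup>2 * a i"
        by (simp add: power2_eq_square algebra_simps)
      then have "a i + a j \<le> ((a j)\<^sup>2 * a j + (a i)\<^sup>2 * a i) / (a i * a j)"
        using p by (simp add: pos_le_divide_eq)
      also have "\<dots> = (a j)\<^sup>2 / a i + (a i)\<^sup>2 / a j" using p by (simp add: add_divide_distrib)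
      finally show "a i + a j \<le> (a j)\<^sup>2 / a i + (a i)\<^sup>2 / a j" .
      show "0 \<le> w i * w j" using w[of i] w[of j] by simp
    qed
    also have "\<dots> = N' * D z + N' * D z"
      by (subst (2) ND', subst ND) (simp add: sum.distrib distrib_left)
    finally show ?thesis by linarith
  qed
  have "0 < N z * W"
  proof -
    have "0 < W" unfolding W_def using w m by (intro sum_pos) auto
    then show ?thesis using N_pos[of z] by simp
  qed
  \<comment> \<open>Squaring \<open>N\<close> doubles its derivative, which makes the sign strict
    even if all loadings are equal.\<close>
  then have "N z * W < 2 * (N' * D z)" using ineq by linarith
  then have "N z * (N z * W) < N z * (2 * (N' * D z))" using N_pos[of z] by simp
  then have "2 * N z * (- N') * D z - (N z)\<^sup>2 * (- W) < 0" by (simp add: power2_eq_square algebra_simps)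
  then show "(2 * N z * (- N') * D z - (N z)\<^sup>2 * (- W)) / (D z * D z) < 0"
    using D_pos[of z] by (intro divide_neg_pos) auto
qed

lemma ratio_ex1:
  assumes k: "0 < k" shows "\<exists>!z. (N z)\<^sup>2 / D z = k"
proof -
  have a0: "0 < a 0" using pos m by simp
  have cont: "continuous_on A (\<lambda>z. (N z)\<^sup>2 / D z)" for A
  proof -
    have "continuous_on A N" "continuous_on A D"
      unfolding N_def D_def using pos by (auto intro!: continuous_intros simp: less_imp_neq[symmetric])
    then show ?thesis using D_pos by (intro continuous_intros) (auto simp: less_imp_neq[symmetric])
  qed
  \<comment> \<open>Here the leading weight is \<open>exp k\<close>; \<open>D <= a 0 * N\<close> and
    \<open>N >= a 0 * exp k\<close> make the ratio at least \<open>exp k >= k\<close>.\<close>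
  define x where "x = - (a 0)\<^sup>2 * k"
  \<comment> \<open>Here all weights are at most \<open>exp (- m / k)\<close>, so by
    \<open>cauchy\<close> the ratio is at most \<open>m * exp (- m / k) <= k\<close>.\<close>
  define y where "y = (a 0)\<^sup>2 * (real m / k)"
  have "k \<le> exp k" using exp_ge_add_one_self[of k] by linarith
  also have "\<dots> = exp (- x / (a 0)\<^sup>2)" using a0 by (simp add: x_def)
  also have "\<dots> \<le> (N x)\<^sup>2 / D x"
  proof -
    have "D x \<le> (\<Sum>j<m. a 0 * (a j * exp (- x / (a j)\<^sup>2)))"
      unfolding D_def using first pos
      by (intro sum_mono) (auto simp: power2_eq_square mult.assoc[symmetric] intro!: mult_right_mono less_imp_le)
    then have "D x \<le> a 0 * N x" by (simp add: N_def sum_distrib_left)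
    moreover have "a 0 * exp (- x / (a 0)\<^sup>2) \<le> N x"
      unfolding N_def using m pos by (intro member_le_sum) (auto intro: less_imp_le)
    ultimately have "exp (- x / (a 0)\<^sup>2) * D x \<le> N x * N x"
    proof -
      assume 1: "D x \<le> a 0 * N x" and 2: "a 0 * exp (- x / (a 0)\<^sup>2) \<le> N x"
      have "exp (- x / (a 0)\<^sup>2) * D x \<le> exp (- x / (a 0)\<^sup>2) * (a 0 * N x)"
        using 1 by (intro mult_left_mono) auto
      also have "\<dots> = (a 0 * exp (- x / (a 0)\<^sup>2)) * N x" by simp
      also have "\<dots> \<le> N x * N x" using 2 N_pos[of x] by (intro mult_right_mono) auto
      finally show ?thesis .
    qed
    then show ?thesis using D_pos[of x] by (simp add: pos_le_divide_eq power2_eq_square)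
  qed
  finally have hi: "k \<le> (N x)\<^sup>2 / D x" .
  have "(N y)\<^sup>2 / D y \<le> (\<Sum>j<m. exp (- y / (a j)\<^sup>2))"
    using cauchy[of y] D_pos[of y] by (simp add: pos_divide_le_eq)
  also have "\<dots> \<le> (\<Sum>j<m. exp (- (real m / k)))"
  proof (intro sum_mono)
    fix j assume j: "j \<in> {..<m}"
    have "(a j)\<^sup>2 \<le> (a 0)\<^sup>2" using j first pos by (intro power_mono) (auto intro: less_imp_le)
    then have "y / (a 0)\<^sup>2 \<le> y / (a j)\<^sup>2"
    proof (rule divide_left_mono)
      show "0 < (a 0)\<^sup>2 * (a j)\<^sup>2" using pos[of j] j a0 by (simp add: zero_less_mult_iff)
    qed (use k in \<open>auto simp: y_def\<close>)
    then show "exp (- y / (a j)\<^sup>2) \<le> exp (- (real m / k))" using a0 by (simp add: y_def)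
  qed
  also have "\<dots> = real m / exp (real m / k)" by (simp add: exp_minus field_simps)
  also have "\<dots> \<le> real m / (real m / k)"
  proof (rule divide_left_mono)
    show "real m / k \<le> exp (real m / k)" using exp_ge_add_one_self[of "real m / k"] by linarith
  qed (use m k in auto)
  also have "\<dots> = k" using m by simp
  finally have lo: "(N y)\<^sup>2 / D y \<le> k" .
  have "x \<le> y" using k by (simp add: x_def y_def order_trans[of _ 0])
  then have "\<exists>z. x \<le> z \<and> z \<le> y \<and> (N z)\<^sup>2 / D z = k"
    using IVT2'[of "\<lambda>z. (N z)\<^sup>2 / D z" y k x] lo hi cont by blast
  moreover have "z = z'" if "(N z)\<^sup>2 / D z = k" "(N z')\<^sup>2 / D z' = k" for z z'
    using that ratio_decreasing[of z z'] ratio_decreasing[of z' z] by (cases z z' rule: linorder_cases) auto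
  ultimately show ?thesis by blast
qed

end

section \<open>Comparing \<open>lam\<close>, \<open>nu1\<close> and the partial norms
  \<open>H\<close>\<close>

locale rate =
  fixes p ku :: nat and \<xi> :: "real vec"
  assumes l: "loading p \<xi>" and ku: "0 < ku"
begin

definition "m = l0 \<xi>"
definition "lm = lam ku \<xi>"
definition "wt j = exp (- lm\<^sup>2 / (\<xi> $ j)\<^sup>2)"
definition "S1 = (\<Sum>j<m. \<bar>\<xi> $ j\<bar> * wt j)"
definition "S2 = (\<Sum>j<m. (\<xi> $ j)\<^sup>2 * wt j)"
definition "h = H ((real ku)\<^sup>2) \<xi>"

lemma carrier: "\<xi> \<in> carrier_vec p" using l by (simp add: loading_def)

lemma less_m: "j < m \<longleftrightarrow> j < p \<and> \<xi> $ j \<noteq> 0"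
  using loading_support[OF l] unfolding m_def by (simp add: set_eq_iff)

lemma nu1_eq: "nu1 ku \<xi> = lm * real ku + sqrt S2"
  by (simp add: nu1_def S2_def wt_def lm_def m_def)

sublocale weights m "\<lambda>j. \<bar>\<xi> $ j\<bar>"
proof
  show "0 < m" using loading_first[OF l] by (simp add: less_m)
  show "0 < \<bar>\<xi> $ j\<bar>" if "j < m" for j using that by (simp add: less_m)
  show "\<bar>\<xi> $ j\<bar> \<le> \<bar>\<xi> $ 0\<bar>" if "j < m" for j using that loading_mono[OF l, of 0 j] by (simp add: less_m)
qed

text \<open>By \<open>ratio_ex1\<close> the definite description in \<open>zeta\<close> denotes;
  both sides of its equation are nonnegative, so squaring loses nothing.\<close>

lemma zeta: "(N (zeta ku \<xi>))\<^sup>2 / D (zeta ku \<xi>) = (real ku / 2)\<^sup>2"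
proof -
  have e: "N z / sqrt (D z) = real ku / 2 \<longleftrightarrow> (N z)\<^sup>2 / D z = (real ku / 2)\<^sup>2" for z
  proof -
    have "(N z / sqrt (D z))\<^sup>2 = (N z)\<^sup>2 / D z" using D_pos[of z] by (simp add: power_divide)
    moreover have "N z / sqrt (D z) = real ku / 2 \<longleftrightarrow> (N z / sqrt (D z))\<^sup>2 = (real ku / 2)\<^sup>2"
      using N_pos[of z] D_pos[of z] by (intro power2_eq_iff_nonneg[symmetric]) auto
    ultimately show ?thesis by simp
  qed
  have "zeta ku \<xi> = (THE z. N z / sqrt (D z) = real ku / 2)"
    unfolding zeta_def N_def D_def power2_abs unfolding m_def by (rule refl)
  then show ?thesis unfolding e using theI'[OF ratio_ex1[of "(real ku / 2)\<^sup>2"]] ku by simp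
qed

lemma lm_nonneg: "0 \<le> lm" by (simp add: lm_def lam_def)

lemma lm_sq: "lm\<^sup>2 = max (zeta ku \<xi>) 0" by (simp add: lm_def lam_def)

lemma S1_eq: "S1 = N (lm\<^sup>2)" and S2_eq: "S2 = D (lm\<^sup>2)"
  by (simp_all add: S1_def S2_def N_def D_def wt_def)

lemma S2_pos: "0 < S2" unfolding S2_eq by (rule D_pos)

text \<open>The equation holds at \<open>zeta\<close>, while the sums are taken at
  \<open>lm^2\<close>. The two points agree if \<open>lm > 0\<close>; if \<open>zeta < 0\<close>,
  then \<open>lm^2 = 0\<close> lies to the right, where the ratio is smaller.\<close>

lemma S1_le: "S1 \<le> real ku / 2 * sqrt S2" and S1_ge: "0 < lm \<Longrightarrow> S1 = real ku / 2 * sqrt S2"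
proof -
  have R: "(N (lm\<^sup>2))\<^sup>2 / D (lm\<^sup>2) \<le> (real ku / 2)\<^sup>2"
    using zeta ratio_decreasing[of "zeta ku \<xi>" 0] by (cases "zeta ku \<xi> < 0") (auto simp: lm_sq max_def)
  have "S1\<^sup>2 \<le> (real ku / 2 * sqrt S2)\<^sup>2"
  proof -
    have "S1\<^sup>2 \<le> (real ku / 2)\<^sup>2 * S2"
      using R S2_pos unfolding S1_eq[symmetric] S2_eq[symmetric] by (simp add: pos_divide_le_eq)
    then show ?thesis using S2_pos by (simp only: power_mult_distrib[of "real ku / 2"]) simp
  qed
  then show "S1 \<le> real ku / 2 * sqrt S2" by (rule power2_le_imp_le) (use S2_pos in simp)
  assume "0 < lm"
  then have "lm\<^sup>2 = zeta ku \<xi>" using lm_sq by (simp add: max_def split: if_splits)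
  then have "S1\<^sup>2 / S2 = (real ku / 2)\<^sup>2" using zeta by (simp add: S1_eq S2_eq)
  then have "S1\<^sup>2 = (real ku / 2 * sqrt S2)\<^sup>2" using S2_pos by (simp add: field_simps power_mult_distrib)
  then show "S1 = real ku / 2 * sqrt S2"
    using N_pos[of "lm\<^sup>2"] S2_pos by (subst (asm) power2_eq_iff_nonneg) (auto simp: S1_eq[symmetric])
qed

lemma nat_ceiling_ku: "nat \<lceil>(real ku)\<^sup>2\<rceil> = ku\<^sup>2" by (simp flip: of_nat_power)

lemma h_nonneg: "0 \<le> h" unfolding h_def by (rule H_nonneg)

lemma h_sq: "h\<^sup>2 = (\<Sum>j<ku\<^sup>2. sq0 \<xi> j)"
  using carrier unfolding h_def by (simp add: H_sq[OF carrier] nat_ceiling_ku sum_sq0)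

text \<open>Entries past \<open>ku^2\<close> are at most \<open>h / ku\<close>, so their part of
  \<open>S2\<close> is at most \<open>(h / ku) * S1 <= h * sqrt S2 / 2\<close>. The inequality
  \<open>x^2 <= h^2 + h * x / 2\<close> then bounds \<open>x = sqrt S2\<close>.\<close>

lemma sqrt_S2_le: "sqrt S2 \<le> 2 * h"
proof -
  define x where "x = sqrt S2"
  have x: "0 < x" "x\<^sup>2 = S2" using S2_pos by (auto simp: x_def)
  have "S2 \<le> (\<Sum>j<m. (if j < ku\<^sup>2 then sq0 \<xi> j else 0) + h / real ku * (\<bar>\<xi> $ j\<bar> * wt j))"
    unfolding S2_def
  proof (rule sum_mono)
    fix j assume "j \<in> {..<m}"
    then have j: "j < p" by (simp add: less_m)
    have w: "0 < wt j" "wt j \<le> 1" by (auto simp: wt_def)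
    show "(\<xi> $ j)\<^sup>2 * wt j \<le> (if j < ku\<^sup>2 then sq0 \<xi> j else 0) + h / real ku * (\<bar>\<xi> $ j\<bar> * wt j)"
    proof (cases "j < ku\<^sup>2")
      case True
      have "(\<xi> $ j)\<^sup>2 * wt j \<le> (\<xi> $ j)\<^sup>2 * 1" using w by (intro mult_left_mono) auto
      moreover have "0 \<le> h / real ku * (\<bar>\<xi> $ j\<bar> * wt j)" using w h_nonneg by simp
      ultimately show ?thesis using True j carrier by (simp add: sq0_def)
    next
      case False
      then have "real ku * \<bar>\<xi> $ j\<bar> \<le> h"
        using H_tail[OF l, of "real ku" j] j by (simp only: nat_ceiling_ku h_def)
      then have "\<bar>\<xi> $ j\<bar> \<le> h / real ku" using ku by (simp add: field_simps)
      then have "\<bar>\<xi> $ j\<bar> * (\<bar>\<xi> $ j\<bar> * wt j) \<le> h / real ku * (\<bar>\<xi> $ j\<bar> * wt j)"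
        using w by (intro mult_right_mono) auto
      moreover have "\<bar>\<xi> $ j\<bar> * (\<bar>\<xi> $ j\<bar> * wt j) = (\<xi> $ j)\<^sup>2 * wt j"
        by (simp add: power2_eq_square flip: mult.assoc)
      ultimately show ?thesis using False by simp
    qed
  qed
  also have "\<dots> = (\<Sum>j<m. if j < ku\<^sup>2 then sq0 \<xi> j else 0) + h / real ku * S1"
    by (simp add: sum.distrib S1_def sum_distrib_left)
  also have "(\<Sum>j<m. if j < ku\<^sup>2 then sq0 \<xi> j else 0) = (\<Sum>j<min m (ku\<^sup>2). sq0 \<xi> j)"
    by (rule sum.mono_neutral_cong_right) auto
  also have "\<dots> \<le> h\<^sup>2" unfolding h_sq by (intro sum_mono2) (auto simp: sq0_def)
  also have "h / real ku * S1 \<le> h / real ku * (real ku / 2 * x)"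
    using S1_le h_nonneg by (intro mult_left_mono) (auto simp: x_def)
  also have "\<dots> = h * x / 2" using ku by simp
  finally have q: "x\<^sup>2 \<le> h\<^sup>2 + h * x / 2" using x by simp
  show ?thesis
  proof (rule ccontr)
    assume "\<not> ?thesis"
    then have lt: "2 * h < x" by (simp add: x_def)
    have "h * h \<le> (x / 2) * (x / 2)" using lt h_nonneg by (intro mult_mono) auto
    moreover have "h * x \<le> (x / 2) * x" using lt x by (intro mult_right_mono) auto
    moreover have "0 < x * x" using x by simp
    ultimately show False using q by (simp add: power2_eq_square)
  qed
qed

text \<open>Such an entry, if nonzero, has weight at least
  \<open>exp (- 1) >= 1 / 3\<close>.\<close>

lemma large_sq_le:
  assumes "j < p" "lm \<le> \<bar>\<xi> $ j\<bar>" shows "(\<xi> $ j)\<^sup>2 \<le> 3 * ((\<xi> $ j)\<^sup>2 * wt j)"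
proof (cases "\<xi> $ j = 0")
  case False
  have "lm\<^sup>2 \<le> (\<xi> $ j)\<^sup>2" using assms lm_nonneg by (simp add: abs_le_square_iff[symmetric])
  then have "lm\<^sup>2 / (\<xi> $ j)\<^sup>2 \<le> 1" using False by simp
  then have "exp (- 1) \<le> wt j" by (simp add: wt_def)
  moreover have "1 \<le> 3 * exp (- 1 :: real)" using exp_le by (simp add: exp_minus field_simps)
  ultimately have "1 \<le> 3 * wt j" by linarith
  then have "(\<xi> $ j)\<^sup>2 * 1 \<le> (\<xi> $ j)\<^sup>2 * (3 * wt j)" by (intro mult_left_mono) auto
  then show ?thesis by simp
qed simp

text \<open>Among the first \<open>ku^2\<close> entries, those of size at least \<open>lm\<close>
  are visible in \<open>S2\<close> up to a factor \<open>3\<close>, and the smaller ones contribute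
  at most \<open>ku^2 * lm^2\<close> in total.\<close>

lemma h_le: "h \<le> 2 * nu1 ku \<xi>"
proof -
  have "h\<^sup>2 \<le> (\<Sum>j<ku\<^sup>2. (if j < m then 3 * ((\<xi> $ j)\<^sup>2 * wt j) else 0) + lm\<^sup>2)"
    unfolding h_sq
  proof (rule sum_mono)
    fix j
    show "sq0 \<xi> j \<le> (if j < m then 3 * ((\<xi> $ j)\<^sup>2 * wt j) else 0) + lm\<^sup>2"
    proof (cases "j < m")
      case True
      then have j: "j < p" by (simp add: less_m)
      have w: "0 \<le> 3 * ((\<xi> $ j)\<^sup>2 * wt j)" by (simp add: wt_def)
      show ?thesis
      proof (cases "lm \<le> \<bar>\<xi> $ j\<bar>")
        case True
        then show ?thesis using large_sq_le[OF j True] j carrier \<open>j < m\<close> by (simp add: sq0_def add_increasing2)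
      next
        case False
        then have "(\<xi> $ j)\<^sup>2 \<le> lm\<^sup>2" using lm_nonneg by (simp add: abs_le_square_iff[symmetric])
        moreover have "sq0 \<xi> j = (\<xi> $ j)\<^sup>2" using j carrier by (simp add: sq0_def)
        ultimately have "sq0 \<xi> j \<le> 3 * ((\<xi> $ j)\<^sup>2 * wt j) + lm\<^sup>2" using w by linarith
        then show ?thesis using \<open>j < m\<close> by (simp only: if_True)
      qed
    next
      case False
      then have "sq0 \<xi> j = 0" using carrier by (auto simp: sq0_def less_m)
      then show ?thesis using False by simp
    qed
  qed
  also have "\<dots> = (\<Sum>j<ku\<^sup>2. if j < m then 3 * ((\<xi> $ j)\<^sup>2 * wt j) else 0) + (real ku * lm)\<^sup>2"
    by (simp add: sum.distrib power_mult_distrib)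
  also have "(\<Sum>j<ku\<^sup>2. if j < m then 3 * ((\<xi> $ j)\<^sup>2 * wt j) else 0)
      = (\<Sum>j<min (ku\<^sup>2) m. 3 * ((\<xi> $ j)\<^sup>2 * wt j))"
    by (rule sum.mono_neutral_cong_right) auto
  also have "\<dots> \<le> (\<Sum>j<m. 3 * ((\<xi> $ j)\<^sup>2 * wt j))" by (intro sum_mono2) (auto simp: wt_def)
  also have "\<dots> = 3 * S2" by (simp add: S2_def sum_distrib_left)
  also have "3 * S2 + (real ku * lm)\<^sup>2 \<le> (2 * sqrt S2 + real ku * lm)\<^sup>2"
    using S2_pos lm_nonneg by (simp add: power2_sum power_mult_distrib)
  finally have "h \<le> 2 * sqrt S2 + real ku * lm"
    by (rule power2_le_imp_le) (use S2_pos lm_nonneg in auto)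
  moreover have "0 \<le> lm * real ku" using lm_nonneg by simp
  ultimately show ?thesis unfolding nu1_eq by (simp add: mult.commute)
qed

lemma position_le_h:
  assumes "T < ku\<^sup>2" "T < p" "x \<le> \<bar>\<xi> $ T\<bar>" "0 \<le> x"
  shows "real (Suc T) * x\<^sup>2 \<le> h\<^sup>2"
proof -
  have "real (Suc T) * x\<^sup>2 = (\<Sum>j<Suc T. x\<^sup>2)" by simp
  also have "\<dots> \<le> (\<Sum>j<Suc T. sq0 \<xi> j)"
  proof (rule sum_mono)
    fix j assume "j \<in> {..<Suc T}"
    then have "sq0 \<xi> T \<le> sq0 \<xi> j" by (intro sq0_antitone[OF l]) simp
    moreover have "x\<^sup>2 \<le> sq0 \<xi> T"
      using assms carrier by (simp add: sq0_def abs_le_square_iff[symmetric])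
    ultimately show "x\<^sup>2 \<le> sq0 \<xi> j" by simp
  qed
  also have "\<dots> \<le> h\<^sup>2" unfolding h_sq using assms by (intro sum_mono2) (auto simp: sq0_def)
  finally show ?thesis .
qed

text \<open>By Cauchy-Schwarz the first \<open>ku^2 / 16\<close> terms supply at most half of
  \<open>S1 = ku / 2 * sqrt S2\<close>. The other half forces the weights from \<open>T\<close> on
  to sum to at least \<open>(ku / 4)^2 >= 1\<close>. There are at most \<open>p\<close> of them,
  none above \<open>wt T\<close>, so \<open>wt T >= 1 / p\<close>, that is
  \<open>lm <= sqrt (ln p) * |\<xi> $ T|\<close>; and \<open>|\<xi> $ T|\<close> is at most
  \<open>4 * h / ku\<close>.\<close>

lemma lm_le:
  assumes ku4: "4 \<le> ku" and p: "1 \<le> ln (real p)"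
  shows "lm * real ku \<le> 4 * sqrt (ln (real p)) * h"
proof (cases "lm = 0")
  case False
  then have lm0: "0 < lm" using lm_nonneg by simp
  \<comment> \<open>\<open>sqrt T\<close> is at most \<open>ku / 4\<close>, half of the coefficient
    \<open>ku / 2\<close> in \<open>S1\<close>.\<close>
  define T where "T = ku\<^sup>2 div 16"
  have w: "0 < wt j" "wt j \<le> 1" for j by (auto simp: wt_def)
  have ww: "(wt j)\<^sup>2 \<le> wt j" for j
    using mult_left_mono[OF w(2), of "wt j" j] w(1)[of j] by (simp add: power2_eq_square)
  have head: "(\<Sum>j<min T m. \<bar>\<xi> $ j\<bar> * wt j) \<le> real ku / 4 * sqrt S2"
  proof -
    have "(\<Sum>j<min T m. \<bar>\<xi> $ j\<bar> * wt j)\<^sup>2 \<le> (\<Sum>j<min T m. 1\<^sup>2) * (\<Sum>j<min T m. (\<bar>\<xi> $ j\<bar> * wt j)\<^sup>2)"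
      using Cauchy_Schwarz_ineq_sum[of "\<lambda>_. 1" "\<lambda>j. \<bar>\<xi> $ j\<bar> * wt j" "{..<min T m}"] by simp
    also have "(\<Sum>j<min T m. (\<bar>\<xi> $ j\<bar> * wt j)\<^sup>2) \<le> (\<Sum>j<min T m. (\<xi> $ j)\<^sup>2 * wt j)"
      using ww by (intro sum_mono) (auto simp: power_mult_distrib intro!: mult_left_mono)
    also have "\<dots> \<le> S2"
      unfolding S2_def by (intro sum_mono2) (auto intro!: mult_nonneg_nonneg less_imp_le[OF w(1)])
    also have "(\<Sum>j<min T m. (1::real)\<^sup>2) \<le> (real ku / 4)\<^sup>2"
    proof -
      have "real (16 * T) \<le> real (ku\<^sup>2)" unfolding T_def of_nat_le_iff by simp
      then show ?thesis by (simp add: power_divide)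
    qed
    finally have "(\<Sum>j<min T m. \<bar>\<xi> $ j\<bar> * wt j)\<^sup>2 \<le> (real ku / 4)\<^sup>2 * S2"
      using S2_pos by (simp add: mult_left_mono mult_right_mono)
    then have "(\<Sum>j<min T m. \<bar>\<xi> $ j\<bar> * wt j)\<^sup>2 \<le> (real ku / 4 * sqrt S2)\<^sup>2"
      using S2_pos by (simp only: power_mult_distrib[of "real ku / 4"]) simp
    then show ?thesis by (rule power2_le_imp_le) (use S2_pos in simp)
  qed
  have split: "S1 = (\<Sum>j<min T m. \<bar>\<xi> $ j\<bar> * wt j) + (\<Sum>j\<in>{min T m..<m}. \<bar>\<xi> $ j\<bar> * wt j)"
    unfolding S1_def lessThan_atLeast0 by (rule sum.atLeastLessThan_concat[symmetric]) auto
  then have tail: "real ku / 4 * sqrt S2 \<le> (\<Sum>j\<in>{min T m..<m}. \<bar>\<xi> $ j\<bar> * wt j)"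
    using head S1_ge[OF lm0] by simp
  have "0 < real ku / 4 * sqrt S2" using ku S2_pos by simp
  then have Tm: "T < m" using tail by (cases "T < m") auto
  have Tp: "T < p" using Tm by (simp add: less_m)
  let ?s = "\<lambda>j. sqrt (wt j)"
  have "(real ku / 4)\<^sup>2 * S2 = (real ku / 4 * sqrt S2)\<^sup>2"
    using S2_pos by (simp only: power_mult_distrib[of "real ku / 4"]) simp
  also have "\<dots> \<le> (\<Sum>j\<in>{T..<m}. ?s j * (\<bar>\<xi> $ j\<bar> * ?s j))\<^sup>2"
  proof (rule power_mono)
    have "?s j * (\<bar>\<xi> $ j\<bar> * ?s j) = \<bar>\<xi> $ j\<bar> * wt j" for j
      using w(1)[of j] by (simp add: mult.left_commute)
    then show "real ku / 4 * sqrt S2 \<le> (\<Sum>j\<in>{T..<m}. ?s j * (\<bar>\<xi> $ j\<bar> * ?s j))"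
      using tail Tm by (simp only: min_absorb1 less_imp_le)
  qed (use S2_pos in simp)
  also have "\<dots> \<le> (\<Sum>j\<in>{T..<m}. (?s j)\<^sup>2) * (\<Sum>j\<in>{T..<m}. (\<bar>\<xi> $ j\<bar> * ?s j)\<^sup>2)"
    by (rule Cauchy_Schwarz_ineq_sum)
  also have "(\<Sum>j\<in>{T..<m}. (\<bar>\<xi> $ j\<bar> * ?s j)\<^sup>2) = (\<Sum>j\<in>{T..<m}. (\<xi> $ j)\<^sup>2 * wt j)"
    using w(1) by (simp add: power_mult_distrib less_imp_le)
  also have "(\<Sum>j\<in>{T..<m}. (?s j)\<^sup>2) * \<dots> \<le> (\<Sum>j\<in>{T..<m}. (?s j)\<^sup>2) * S2"
    unfolding S2_def
    by (intro mult_left_mono sum_mono2 sum_nonneg) (auto intro!: mult_nonneg_nonneg less_imp_le[OF w(1)])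
  finally have "(real ku / 4)\<^sup>2 \<le> (\<Sum>j\<in>{T..<m}. (?s j)\<^sup>2)"
    using S2_pos by simp
  also have "\<dots> = (\<Sum>j\<in>{T..<m}. wt j)" using w(1) by (simp add: less_imp_le)
  also have "\<dots> \<le> real (card {T..<m}) * wt T"
  proof (rule sum_bounded_above)
    fix j assume "j \<in> {T..<m}"
    then have j: "T \<le> j" "j < p" "\<xi> $ j \<noteq> 0" by (auto simp: less_m)
    then have "(\<xi> $ j)\<^sup>2 \<le> (\<xi> $ T)\<^sup>2" using loading_mono[OF l j(1,2)] by (simp add: abs_le_square_iff)
    then have "lm\<^sup>2 / (\<xi> $ T)\<^sup>2 \<le> lm\<^sup>2 / (\<xi> $ j)\<^sup>2"
      using j Tm by (intro divide_left_mono) (auto simp: less_m)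
    then show "wt j \<le> wt T" by (simp add: wt_def)
  qed
  also have "\<dots> \<le> real p * wt T"
  proof (rule mult_right_mono)
    have "m \<le> p" using less_m[of p] by (simp add: not_less)
    then show "real (card {T..<m}) \<le> real p" by simp
  qed (use w(1)[of T] in simp)
  finally have "(real ku / 4)\<^sup>2 \<le> real p * wt T" .
  moreover have "1 \<le> (real ku / 4)\<^sup>2" using ku4 by simp
  ultimately have "1 \<le> real p * exp (- lm\<^sup>2 / (\<xi> $ T)\<^sup>2)" by (simp add: wt_def)
  then have "exp (lm\<^sup>2 / (\<xi> $ T)\<^sup>2) \<le> real p" by (simp add: exp_minus field_simps)
  then have "lm\<^sup>2 / (\<xi> $ T)\<^sup>2 \<le> ln (real p)" using Tp by (subst ln_ge_iff) auto
  then have le: "lm\<^sup>2 \<le> ln (real p) * (\<xi> $ T)\<^sup>2" using Tm by (simp add: less_m pos_divide_le_eq)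
  have "T < ku\<^sup>2" using ku by (simp add: T_def)
  then have hT: "real (Suc T) * (\<xi> $ T)\<^sup>2 \<le> h\<^sup>2"
    using position_le_h[of T "\<bar>\<xi> $ T\<bar>"] Tp by simp
  have "real (ku\<^sup>2) \<le> real (16 * Suc T)" unfolding T_def of_nat_le_iff by simp
  then have "(real ku)\<^sup>2 \<le> 16 * real (Suc T)" by simp
  then have "(real ku)\<^sup>2 * (\<xi> $ T)\<^sup>2 \<le> 16 * real (Suc T) * (\<xi> $ T)\<^sup>2" by (intro mult_right_mono) auto
  then have "(real ku)\<^sup>2 * (\<xi> $ T)\<^sup>2 \<le> 16 * h\<^sup>2" using hT by linarith
  then have "ln (real p) * ((real ku)\<^sup>2 * (\<xi> $ T)\<^sup>2) \<le> ln (real p) * (16 * h\<^sup>2)"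
    using p by (intro mult_left_mono) auto
  moreover have "lm\<^sup>2 * (real ku)\<^sup>2 \<le> ln (real p) * (\<xi> $ T)\<^sup>2 * (real ku)\<^sup>2"
    using le by (intro mult_right_mono) auto
  moreover have "(4 * sqrt (ln (real p)) * h)\<^sup>2 = ln (real p) * (16 * h\<^sup>2)"
    using p by (simp add: power_mult_distrib)
  moreover have "(lm * real ku)\<^sup>2 = lm\<^sup>2 * (real ku)\<^sup>2" by (simp add: power_mult_distrib)
  moreover have "ln (real p) * (\<xi> $ T)\<^sup>2 * (real ku)\<^sup>2 = ln (real p) * ((real ku)\<^sup>2 * (\<xi> $ T)\<^sup>2)" by simp
  ultimately have "(lm * real ku)\<^sup>2 \<le> (4 * sqrt (ln (real p)) * h)\<^sup>2" by linarith
  then show ?thesis by (rule power2_le_imp_le) (use p h_nonneg in simp)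
qed (use h_nonneg p in simp)

text \<open>The root of the logarithm is enlarged to the logarithm, since
  \<open>same_order_log\<close> has natural exponents.\<close>

lemma nu1_le:
  assumes "4 \<le> ku" "1 \<le> ln (real p)" shows "nu1 ku \<xi> \<le> 6 * ln (real p) * h"
proof -
  have "sqrt (ln (real p)) \<le> ln (real p)" using assms by (intro real_le_lsqrt) (auto simp: power2_eq_square)
  then have "4 * sqrt (ln (real p)) * h \<le> 4 * ln (real p) * h" using h_nonneg by (intro mult_right_mono) auto
  moreover have "2 * h \<le> 2 * ln (real p) * h" using assms h_nonneg mult_right_mono[of 1 "ln (real p)" h] by simp
  ultimately show ?thesis using lm_le[OF assms] sqrt_S2_le unfolding nu1_eq by linarith
qed

lemma j1_facts:
  assumes "0 < j1 ku \<xi>" shows "j1 ku \<xi> \<le> p" "lm \<le> \<bar>\<xi> $ (j1 ku \<xi> - 1)\<bar>"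
proof -
  have "j1 ku \<xi> \<in> insert 0 {j \<in> {1..p}. \<bar>\<xi> $ (j - 1)\<bar> \<ge> lm}"
    unfolding j1_def lm_def carrier_vecD[OF carrier] by (intro Max_in) auto
  then show "j1 ku \<xi> \<le> p" "lm \<le> \<bar>\<xi> $ (j1 ku \<xi> - 1)\<bar>" using assms by auto
qed

text \<open>The first \<open>ku^2\<close> entries all reach \<open>lm\<close>, so
  \<open>ku^2 * lm^2 <= h^2\<close> directly, and the logarithm of \<open>lm_le\<close> is
  avoided.\<close>

lemma nu1_le_dense:
  assumes "ku\<^sup>2 \<le> j1 ku \<xi>" shows "nu1 ku \<xi> \<le> 3 * h"
proof -
  have k2: "0 < ku\<^sup>2" using ku by simp
  have J: "0 < j1 ku \<xi>" using assms k2 by linarith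
  have "lm \<le> \<bar>\<xi> $ (j1 ku \<xi> - 1)\<bar>" by (rule j1_facts[OF J])
  also have "\<dots> \<le> \<bar>\<xi> $ (ku\<^sup>2 - 1)\<bar>" using assms J j1_facts[OF J] by (intro loading_mono[OF l]) auto
  finally have "real (Suc (ku\<^sup>2 - 1)) * lm\<^sup>2 \<le> h\<^sup>2"
    using assms k2 J j1_facts[OF J] lm_nonneg by (intro position_le_h) linarith+
  then have "(lm * real ku)\<^sup>2 \<le> h\<^sup>2" using k2 by (simp add: power_mult_distrib mult.commute)
  then have "lm * real ku \<le> h" using h_nonneg by (rule power2_le_imp_le)
  then show ?thesis using sqrt_S2_le unfolding nu1_eq by linarith
qed

text \<open>The first \<open>j1\<close> entries all reach \<open>lm\<close>, so by
  \<open>large_sq_le\<close> their squares sum to at most \<open>3 * S2\<close>; a longer cutoff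
  costs the number \<open>Q\<close> of chunks.\<close>

lemma H_le_nu1_dense:
  assumes "t \<le> real Q * real (j1 ku \<xi>)" shows "H t \<xi> \<le> sqrt (3 * real Q) * nu1 ku \<xi>"
proof -
  have "nat \<lceil>t\<rceil> \<le> Q * j1 ku \<xi>"
  proof -
    have "t \<le> real_of_int (int (Q * j1 ku \<xi>))" using assms by simp
    then have "\<lceil>t\<rceil> \<le> int (Q * j1 ku \<xi>)" by (rule ceiling_le)
    then show ?thesis by (simp only: nat_le_iff)
  qed
  then have "(H t \<xi>)\<^sup>2 \<le> (\<Sum>j<Q * j1 ku \<xi>. sq0 \<xi> j)"
    using carrier unfolding H_sq[OF carrier] sum_sq0[of \<xi> "nat \<lceil>t\<rceil>", symmetric, simplified carrier_vecD[OF carrier]]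
    by (intro sum_mono2) (auto simp: sq0_def)
  also have "\<dots> \<le> real Q * (\<Sum>j<j1 ku \<xi>. sq0 \<xi> j)"
    by (rule sum_antitone_chunks) (rule sq0_antitone[OF l])
  also have "(\<Sum>j<j1 ku \<xi>. sq0 \<xi> j) \<le> (\<Sum>j<j1 ku \<xi>. if j < m then 3 * ((\<xi> $ j)\<^sup>2 * wt j) else 0)"
  proof (rule sum_mono)
    fix j assume j: "j \<in> {..<j1 ku \<xi>}"
    then have J: "0 < j1 ku \<xi>" by auto
    have jp: "j < p" using j j1_facts[OF J] by simp
    have "lm \<le> \<bar>\<xi> $ (j1 ku \<xi> - 1)\<bar>" by (rule j1_facts[OF J])
    also have "\<dots> \<le> \<bar>\<xi> $ j\<bar>" using j J j1_facts[OF J] by (intro loading_mono[OF l]) auto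
    finally have "(\<xi> $ j)\<^sup>2 \<le> 3 * ((\<xi> $ j)\<^sup>2 * wt j)" by (rule large_sq_le[OF jp])
    then show "sq0 \<xi> j \<le> (if j < m then 3 * ((\<xi> $ j)\<^sup>2 * wt j) else 0)"
      using jp carrier by (auto simp: sq0_def less_m)
  qed
  also have "\<dots> = (\<Sum>j<min (j1 ku \<xi>) m. 3 * ((\<xi> $ j)\<^sup>2 * wt j))"
    by (rule sum.mono_neutral_cong_right) auto
  also have "\<dots> \<le> (\<Sum>j<m. 3 * ((\<xi> $ j)\<^sup>2 * wt j))" by (intro sum_mono2) (auto simp: wt_def)
  also have "\<dots> = 3 * S2" by (simp add: S2_def sum_distrib_left)
  finally have "(H t \<xi>)\<^sup>2 \<le> real Q * (3 * S2)" by (simp add: mult_left_mono)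
  also have "\<dots> = (sqrt (3 * real Q) * sqrt S2)\<^sup>2" using S2_pos by (simp add: power_mult_distrib)
  finally have "H t \<xi> \<le> sqrt (3 * real Q) * sqrt S2" by (rule power2_le_imp_le) (use S2_pos in simp)
  also have "\<dots> \<le> sqrt (3 * real Q) * nu1 ku \<xi>"
    using lm_nonneg unfolding nu1_eq by (intro mult_left_mono) auto
  finally show ?thesis .
qed

text \<open>The cutoff \<open>ku^2 lp\<close> is covered by at most \<open>2 * lp\<close> chunks of
  length \<open>ku^2\<close>.\<close>

lemma H_le_h:
  assumes lp: "1 \<le> lp" shows "H ((real ku)\<^sup>2 * lp) \<xi> \<le> 2 * lp * h"
proof -
  define q where "q = nat \<lceil>lp\<rceil>"
  have q: "real q \<le> 2 * lp" unfolding q_def using lp by linarith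
  have "nat \<lceil>(real ku)\<^sup>2 * lp\<rceil> \<le> q * ku\<^sup>2"
  proof -
    have "(real ku)\<^sup>2 * lp \<le> (real ku)\<^sup>2 * real q"
      unfolding q_def by (intro mult_left_mono real_nat_ceiling_ge) auto
    also have "\<dots> = real_of_int (int (q * ku\<^sup>2))" by simp
    finally have "\<lceil>(real ku)\<^sup>2 * lp\<rceil> \<le> int (q * ku\<^sup>2)" by (rule ceiling_le)
    then show ?thesis by (simp only: nat_le_iff)
  qed
  then have "(H ((real ku)\<^sup>2 * lp) \<xi>)\<^sup>2 \<le> (\<Sum>j<q * ku\<^sup>2. sq0 \<xi> j)"
    using carrier unfolding H_sq[OF carrier] sum_sq0[of \<xi> "nat \<lceil>(real ku)\<^sup>2 * lp\<rceil>", symmetric, simplified carrier_vecD[OF carrier]]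
    by (intro sum_mono2) (auto simp: sq0_def)
  also have "\<dots> \<le> real q * h\<^sup>2"
    unfolding h_sq by (rule sum_antitone_chunks) (rule sq0_antitone[OF l])
  also have "\<dots> \<le> (2 * lp) * h\<^sup>2" using q by (intro mult_right_mono) auto
  also have "\<dots> \<le> (2 * lp) * (2 * lp) * h\<^sup>2"
    using lp by (intro mult_right_mono) (auto simp: mult_le_cancel_left1)
  also have "\<dots> = (2 * lp * h)\<^sup>2" by (simp add: power2_eq_square)
  finally show ?thesis by (rule power2_le_imp_le) (use lp h_nonneg in simp)
qed

lemma h_le_H:
  assumes lp: "1 \<le> lp" shows "h \<le> H ((real ku)\<^sup>2 * lp) \<xi>"
proof -
  have "(real ku)\<^sup>2 * 1 \<le> (real ku)\<^sup>2 * lp" using lp by (intro mult_left_mono) auto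
  define A where "A = nat \<lceil>(real ku)\<^sup>2\<rceil>"
  define B where "B = nat \<lceil>(real ku)\<^sup>2 * lp\<rceil>"
  have "A \<le> B" unfolding A_def B_def using \<open>(real ku)\<^sup>2 * 1 \<le> (real ku)\<^sup>2 * lp\<close>
    by (intro nat_mono ceiling_mono) simp
  then show ?thesis
    unfolding h_def H_def A_def[symmetric] B_def[symmetric]
    by (intro real_sqrt_le_mono sum_mono2) auto
qed

lemma nu1_nonneg: "0 \<le> nu1 ku \<xi>" using h_le h_nonneg by linarith

end

subsection \<open>Asymptotics\<close>

lemma lesssim_real: "lesssim (\<lambda>m. ereal (f m)) (\<lambda>m. ereal (g m))
    \<longleftrightarrow> (\<exists>C>0. \<forall>\<^sub>F m in sequentially. f m \<le> C * g m)"
  by (simp add: lesssim_def)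

lemma triangle_le_square: "triangle k \<le> k\<^sup>2"
proof (cases k)
  case (Suc j)
  then have "k * Suc k \<le> k * (2 * k)" by (intro mult_le_mono2) simp
  then show ?thesis unfolding triangle_def power2_eq_square by linarith
qed simp

lemma ereal_scale_mono:
  assumes "0 \<le> C" "ereal x \<le> t" shows "ereal (C * x) \<le> ereal C * t"
  using ereal_mult_left_mono[OF assms(2), of "ereal C"] assms(1) by simp

text \<open>The side conditions of both bounds hold eventually. A bound
  \<open>ku <= C1 p^\<gamma>\<close> with \<gamma> < 1/2 gives \<open>ku^2 <= p\<close>, the room
  for the blocks. From \<open>ku lp <= C2 sqrt n\<close> follow \<open>ku^2 <= n\<close> as soon as
  \<open>lp >= C2\<close>, and \<open>ku sqrt (lp / n) <= C2 / sqrt lp\<close>, which is eventually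
  below any constant.\<close>

lemma tau_adap_bounds:
  fixes M1 M2 \<alpha> \<eta> \<gamma> :: real
  assumes M1: "1 < M1" and M2: "0 < M2" and al: "0 < \<alpha>" and et: "0 < \<eta>" and sum: "\<alpha> + \<eta> < 1"
    and ga: "\<gamma> < 1 / 2"
    and n: "filterlim n at_top sequentially" and p: "filterlim p at_top sequentially"
    and ku: "filterlim ku at_top sequentially"
    and k: "\<And>m. 1 \<le> k m \<and> k m \<le> ku m" and l: "\<And>m. loading (p m) (\<xi> m)"
    and s1: "lesssim (\<lambda>m. ereal (real (ku m))) (\<lambda>m. ereal (real (p m) powr \<gamma>))"
    and s2: "lesssim (\<lambda>m. ereal (real (ku m))) (\<lambda>m. ereal (sqrt (real (n m)) / ln (real (p m))))"
  obtains c C where "0 < c" "0 < C"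
    "\<forall>\<^sub>F m in sequentially.
      ereal (c * (H ((real (ku m))\<^sup>2) (\<xi> m) / sqrt (real (n m)))) \<le> tau_adap M1 M2 \<alpha> \<eta> (n m) (p m) (ku m) (k m) (\<xi> m) (t0 m)
      \<and> tau_adap M1 M2 \<alpha> \<eta> (n m) (p m) (ku m) (k m) (\<xi> m) (t0 m)
        \<le> ereal (C * (H ((real (ku m))\<^sup>2 * ln (real (p m))) (\<xi> m) / sqrt (real (n m))))"
proof -
  define \<epsilon> where "\<epsilon> = min \<alpha> \<eta>"
  have eps: "0 < \<epsilon>" "\<epsilon> \<le> \<alpha>" "\<epsilon> \<le> \<eta>" using al et by (auto simp: \<epsilon>_def)
  \<comment> \<open>Chosen for \<open>2 * exp (- B) <= \<epsilon> / 2\<close>; the maximum with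
    \<open>1\<close> keeps \<open>K'\<close> positive.\<close>
  define B where "B = max 1 (ln (4 / \<epsilon>))"
  define K' where "K' = sqrt (4 * M1 * M2\<^sup>2 * B)"
  have K': "0 < K'" "2 * exp (- (K'\<^sup>2 / (4 * M1 * M2\<^sup>2))) \<le> \<epsilon> / 2"
  proof -
    have B: "0 < B" by (simp add: B_def less_max_iff_disj)
    show "0 < K'" using B M1 M2 by (simp add: K'_def)
    have "K'\<^sup>2 / (4 * M1 * M2\<^sup>2) = B" using B M1 M2 by (simp add: K'_def)
    moreover have "exp (- B) \<le> exp (- ln (4 / \<epsilon>))" by (simp add: B_def)
    moreover have "exp (- ln (4 / \<epsilon>)) = \<epsilon> / 4" using eps by (simp add: exp_minus)
    ultimately show "2 * exp (- (K'\<^sup>2 / (4 * M1 * M2\<^sup>2))) \<le> \<epsilon> / 2" by simp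
  qed
  \<comment> \<open>The first bound gives \<open>20 * a^2 <= 1\<close>; the second spends at most
    half of the gap \<open>1 - \<alpha> - \<eta>\<close> on \<open>7 * a\<close>.\<close>
  define a where "a = min (1 / 5) ((1 - \<alpha> - \<eta>) / 14)"
  have a: "0 < a" "20 * a\<^sup>2 \<le> 1" "\<alpha> + 7 * a < 1 - \<eta>"
  proof -
    show a0: "0 < a" using sum by (simp add: a_def)
    have "a\<^sup>2 \<le> (1 / 5)\<^sup>2" using a0 by (intro power_mono) (auto simp: a_def)
    then show "20 * a\<^sup>2 \<le> 1" by (simp add: power2_eq_square)
    have "a \<le> (1 - \<alpha> - \<eta>) / 14" unfolding a_def by (rule min.cobounded2)
    then have "a * 14 \<le> 1 - \<alpha> - \<eta>" by (simp add: pos_le_divide_eq)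
    then show "\<alpha> + 7 * a < 1 - \<eta>" using sum by linarith
  qed
  obtain C1 where C1: "0 < C1" "\<forall>\<^sub>F m in sequentially. real (ku m) \<le> C1 * real (p m) powr \<gamma>"
    using s1 unfolding lesssim_real by blast
  obtain C2 where C2: "0 < C2"
    "\<forall>\<^sub>F m in sequentially. real (ku m) \<le> C2 * (sqrt (real (n m)) / ln (real (p m)))"
    using s2 unfolding lesssim_real by blast
  define K where "K = sqrt (8 * M1) * M2"
  define C where "C = 8 * M1 * K + 128 * M1\<^sup>2 * K * C2 + 2 * K' + 2"
  have K0: "0 < K" using M1 M2 by (simp add: K_def)
  have C0: "0 < C" using M1 K0 C2 K' unfolding C_def by (intro add_pos_pos mult_pos_pos) auto
  have preal: "filterlim (\<lambda>m. real (p m)) at_top sequentially"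
    by (rule filterlim_compose[OF filterlim_real_sequentially p])
  have plog: "filterlim (\<lambda>m. ln (real (p m))) at_top sequentially"
    by (rule filterlim_compose[OF ln_at_top preal])
  have ppow: "filterlim (\<lambda>m. real (p m) powr (1 / 2 - \<gamma>)) at_top sequentially"
  proof -
    have "filterlim (\<lambda>m. exp ((1 / 2 - \<gamma>) * ln (real (p m)))) at_top sequentially"
      using ga by (intro filterlim_compose[OF exp_at_top] filterlim_tendsto_pos_mult_at_top[OF tendsto_const _ plog]) simp
    moreover have "\<forall>\<^sub>F m in sequentially. exp ((1 / 2 - \<gamma>) * ln (real (p m))) = real (p m) powr (1 / 2 - \<gamma>)"
    proof -
      have "\<forall>\<^sub>F m in sequentially. 1 \<le> p m" using p by (simp add: filterlim_at_top)
      then show ?thesis by eventually_elim (simp add: powr_def)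
    qed
    ultimately show ?thesis by (rule filterlim_mono_eventually[OF _ order_refl order_refl])
  qed
  have "\<forall>\<^sub>F m in sequentially. 1 \<le> ku m" using ku by (simp add: filterlim_at_top)
  moreover have "\<forall>\<^sub>F m in sequentially. 1 \<le> n m" using n by (simp add: filterlim_at_top)
  moreover have "\<forall>\<^sub>F m in sequentially. 2 \<le> p m" using p by (simp add: filterlim_at_top)
  moreover have "\<forall>\<^sub>F m in sequentially. 24 / \<epsilon> \<le> real (p m)" using preal by (simp add: filterlim_at_top)
  moreover have "\<forall>\<^sub>F m in sequentially. C2 \<le> ln (real (p m))" using plog by (simp add: filterlim_at_top)
  moreover have "\<forall>\<^sub>F m in sequentially. (64 * M1\<^sup>2 * C2)\<^sup>2 \<le> ln (real (p m))"
    using plog by (simp add: filterlim_at_top)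
  moreover have "\<forall>\<^sub>F m in sequentially. C1 \<le> real (p m) powr (1 / 2 - \<gamma>)"
    using ppow by (simp add: filterlim_at_top)
  ultimately have "\<forall>\<^sub>F m in sequentially.
      ereal (M2 * a / 3 * (H ((real (ku m))\<^sup>2) (\<xi> m) / sqrt (real (n m)))) \<le> tau_adap M1 M2 \<alpha> \<eta> (n m) (p m) (ku m) (k m) (\<xi> m) (t0 m)
      \<and> tau_adap M1 M2 \<alpha> \<eta> (n m) (p m) (ku m) (k m) (\<xi> m) (t0 m)
        \<le> ereal (C * (H ((real (ku m))\<^sup>2 * ln (real (p m))) (\<xi> m) / sqrt (real (n m))))"
    using C1(2) C2(2)
  proof eventually_elim
    case (elim m)
    define lp where "lp = ln (real (p m))"
    have lp0: "0 < lp" using elim by (simp add: lp_def)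
    have n0: "0 < real (n m)" using elim by simp
    have "real (ku m) \<le> real (p m) powr (1 / 2 - \<gamma>) * real (p m) powr \<gamma>"
      using elim by (meson mult_right_mono order_trans powr_ge_zero)
    also have "\<dots> = sqrt (real (p m))" using elim by (simp add: powr_add[symmetric] powr_half_sqrt)
    finally have "(real (ku m))\<^sup>2 \<le> (sqrt (real (p m)))\<^sup>2" by (intro power_mono) auto
    then have "real ((ku m)\<^sup>2) \<le> real (p m)" by simp
    then have kp: "triangle (ku m) \<le> p m" using triangle_le_square[of "ku m"] by linarith
    have sparse: "real (ku m) * lp \<le> C2 * sqrt (real (n m))"
      using elim lp0 by (simp add: lp_def pos_le_divide_eq)
    have "real (ku m) * C2 \<le> real (ku m) * lp" using elim by (intro mult_left_mono) (auto simp: lp_def)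
    then have "C2 * real (ku m) \<le> C2 * sqrt (real (n m))" using sparse by (simp add: mult.commute)
    then have "real (ku m) \<le> sqrt (real (n m))" using C2 by simp
    then have "(real (ku m))\<^sup>2 \<le> (sqrt (real (n m)))\<^sup>2" by (intro power_mono) auto
    then have kn: "(ku m)\<^sup>2 \<le> n m" by (simp flip: of_nat_power)
    have small: "64 * M1\<^sup>2 * real (ku m) * sqrt (lp / real (n m)) \<le> 1"
    proof -
      have "64 * M1\<^sup>2 * C2 \<le> sqrt lp" using elim(6) unfolding lp_def by (rule real_le_rsqrt)
      then have "64 * M1\<^sup>2 * C2 * sqrt (real (n m)) \<le> sqrt lp * sqrt (real (n m))"
        by (intro mult_right_mono) auto
      moreover have "64 * M1\<^sup>2 * (real (ku m) * lp) \<le> 64 * M1\<^sup>2 * (C2 * sqrt (real (n m)))"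
        using sparse by (intro mult_left_mono) auto
      ultimately have "64 * M1\<^sup>2 * real (ku m) * lp \<le> sqrt lp * sqrt (real (n m))"
        by (simp add: mult.assoc)
      then have "(64 * M1\<^sup>2 * real (ku m) * sqrt lp) * sqrt lp \<le> sqrt (real (n m)) * sqrt lp"
      proof -
        assume i: "64 * M1\<^sup>2 * real (ku m) * lp \<le> sqrt lp * sqrt (real (n m))"
        have "(64 * M1\<^sup>2 * real (ku m) * sqrt lp) * sqrt lp = 64 * M1\<^sup>2 * real (ku m) * lp"
          using lp0 by simp
        then show ?thesis using i by (simp only: mult.commute)
      qed
      then have "64 * M1\<^sup>2 * real (ku m) * sqrt lp \<le> sqrt (real (n m))"
        using lp0 by (simp only: mult_le_cancel_right_pos real_sqrt_gt_0_iff)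
      then show ?thesis using n0 by (simp add: real_sqrt_divide)
    qed
    have L_small: "32 * sqrt (lp / real (n m)) \<le> 1"
    proof -
      have "1 \<le> M1\<^sup>2" using M1 by (simp add: one_le_power)
      then have "1 * 1 \<le> M1\<^sup>2 * real (ku m)" using elim(1) by (intro mult_mono) auto
      then have "32 \<le> 64 * (M1\<^sup>2 * real (ku m))" by linarith
      then have "32 * sqrt (lp / real (n m)) \<le> 64 * (M1\<^sup>2 * real (ku m)) * sqrt (lp / real (n m))"
        using lp0 n0 by (intro mult_right_mono) auto
      also have "\<dots> = 64 * M1\<^sup>2 * real (ku m) * sqrt (lp / real (n m))" by simp
      also have "\<dots> \<le> 1" by (rule small)
      finally show ?thesis .
    qed
    show ?case
    proof
      show "ereal (M2 * a / 3 * (H ((real (ku m))\<^sup>2) (\<xi> m) / sqrt (real (n m))))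
          \<le> tau_adap M1 M2 \<alpha> \<eta> (n m) (p m) (ku m) (k m) (\<xi> m) (t0 m)"
        by (rule le_tau_adap[OF M1 M2 l kp _ _ kn a]) (use elim k in auto)
      show "tau_adap M1 M2 \<alpha> \<eta> (n m) (p m) (ku m) (k m) (\<xi> m) (t0 m)
        \<le> ereal (C * (H ((real (ku m))\<^sup>2 * ln (real (p m))) (\<xi> m) / sqrt (real (n m))))"
        unfolding C_def K_def
        by (rule tau_adap_le[OF M1 M2 eps _ _ _ _ l K'])
          (use elim k L_small small sparse C2 in \<open>auto simp: lp_def\<close>)
    qed
  qed
  then show ?thesis by (intro that[of "M2 * a / 3" C]) (use M2 a C0 in auto)
qed

theorem corollary1:
  fixes M1 M2 \<alpha> \<eta> \<gamma> :: real
  assumes "M1 > 1" and "M2 > 0"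
    and "0 < \<alpha>" and "\<alpha> < 1" and "0 < \<eta>" and "\<eta> < 1" and "\<alpha> + \<eta> < 1"
    and "0 \<le> \<gamma>" and "\<gamma> < 1 / 2"
  shows "\<exists>c>0. \<forall>(n::nat \<Rightarrow> nat) (p::nat \<Rightarrow> nat) (ku::nat \<Rightarrow> nat) (k::nat \<Rightarrow> nat)
            (\<xi>::nat \<Rightarrow> real vec) (t0::nat \<Rightarrow> real).
      filterlim n at_top sequentially \<longrightarrow>
      filterlim p at_top sequentially \<longrightarrow>
      filterlim ku at_top sequentially \<longrightarrow>
      (\<forall>m. 1 \<le> k m \<and> k m \<le> ku m) \<longrightarrow>
      (\<forall>m. loading (p m) (\<xi> m)) \<longrightarrow>
      lesssim (\<lambda>m. ereal (real (ku m))) (\<lambda>m. ereal (real (p m) powr \<gamma>)) \<longrightarrow>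
      (\<forall>\<^sub>F m in sequentially. real (n m) \<ge> c * real (ku m) * ln (real (p m))) \<longrightarrow>
      lesssim (\<lambda>m. ereal (real (ku m))) (\<lambda>m. ereal (sqrt (real (n m)) / ln (real (p m)))) \<longrightarrow>
      (same_order_log p
         (\<lambda>m. tau_adap M1 M2 \<alpha> \<eta> (n m) (p m) (ku m) (k m) (\<xi> m) (t0 m))
         (\<lambda>m. ereal (nu1 (ku m) (\<xi> m) / sqrt (real (n m)))) \<and>
       same_order_log p
         (\<lambda>m. ereal (nu1 (ku m) (\<xi> m) / sqrt (real (n m))))
         (\<lambda>m. ereal (H ((real (ku m))\<^sup>2 * ln (real (p m))) (\<xi> m) / sqrt (real (n m))))) \<and>
      (lesssim (\<lambda>m. ereal ((real (ku m))\<^sup>2 * ln (real (p m))))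
               (\<lambda>m. ereal (real (j1 (ku m) (\<xi> m)))) \<longrightarrow>
       same_order
         (\<lambda>m. tau_adap M1 M2 \<alpha> \<eta> (n m) (p m) (ku m) (k m) (\<xi> m) (t0 m))
         (\<lambda>m. ereal (nu1 (ku m) (\<xi> m) / sqrt (real (n m)))))"
proof (intro exI[of _ 1] conjI allI impI)
  show "0 < (1::real)" by simp
next
  fix n p ku k :: "nat \<Rightarrow> nat" and \<xi> :: "nat \<Rightarrow> real vec" and t0 :: "nat \<Rightarrow> real"
  assume n: "filterlim n at_top sequentially" and p: "filterlim p at_top sequentially"
    and ku: "filterlim ku at_top sequentially"
    and k: "\<forall>m. 1 \<le> k m \<and> k m \<le> ku m" and l: "\<forall>m. loading (p m) (\<xi> m)"
    and s1: "lesssim (\<lambda>m. ereal (real (ku m))) (\<lambda>m. ereal (real (p m) powr \<gamma>))"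
    and s2: "lesssim (\<lambda>m. ereal (real (ku m))) (\<lambda>m. ereal (sqrt (real (n m)) / ln (real (p m))))"
  let ?tau = "\<lambda>m. tau_adap M1 M2 \<alpha> \<eta> (n m) (p m) (ku m) (k m) (\<xi> m) (t0 m)"
  let ?nu = "\<lambda>m. nu1 (ku m) (\<xi> m)" and ?lp = "\<lambda>m. ln (real (p m))" and ?r = "\<lambda>m. sqrt (real (n m))"
  let ?h = "\<lambda>m. H ((real (ku m))\<^sup>2) (\<xi> m)" and ?H = "\<lambda>m. H ((real (ku m))\<^sup>2 * ?lp m) (\<xi> m)"
  obtain c C where c: "0 < c" and C: "0 < C"
    and bounds: "\<forall>\<^sub>F m in sequentially. ereal (c * (?h m / ?r m)) \<le> ?tau m \<and> ?tau m \<le> ereal (C * (?H m / ?r m))"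
    by (rule tau_adap_bounds[of M1 M2 \<alpha> \<eta> \<gamma> n p ku k \<xi> t0]) (use assms n p ku k l s1 s2 in auto)
  have plog: "filterlim (\<lambda>m. ?lp m) at_top sequentially"
    by (rule filterlim_compose[OF ln_at_top filterlim_compose[OF filterlim_real_sequentially p]])
  have ev: "\<forall>\<^sub>F m in sequentially. 4 \<le> ku m \<and> 1 \<le> ?lp m"
    using ku plog by (intro eventually_conj) (simp_all add: filterlim_at_top)
  have rate: "rate (p m) (ku m) (\<xi> m)" if "4 \<le> ku m" for m
    using l that by unfold_locales auto
  \<comment> \<open>Passing from \<open>nu1\<close> to \<open>h\<close> or from \<open>H\<close> to
    \<open>nu1\<close> costs one logarithm, and \<open>h <= H\<close> costs none, so the exponent
    \<open>1\<close> serves in every logarithmic comparison below.\<close>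
  have det: "\<forall>\<^sub>F m in sequentially. 0 \<le> ?nu m / ?r m
      \<and> ?nu m / ?r m \<le> 6 * (?lp m * (?h m / ?r m)) \<and> ?h m / ?r m \<le> ?H m / ?r m
      \<and> ?H m / ?r m \<le> 4 * (?lp m * (?nu m / ?r m)) \<and> 0 < ?lp m"
    using ev
  proof eventually_elim
    case (elim m)
    then interpret rate "p m" "ku m" "\<xi> m" by (intro rate) simp
    have "?nu m \<le> 6 * ?lp m * ?h m" using nu1_le elim by (simp add: h_def)
    moreover have "?h m \<le> ?H m" using h_le_H elim by (simp add: h_def)
    moreover have "?H m \<le> 4 * ?lp m * ?nu m"
    proof -
      have "?H m \<le> 2 * ?lp m * ?h m" using H_le_h[of "?lp m"] elim by (simp add: h_def)
      also have "\<dots> \<le> 2 * ?lp m * (2 * ?nu m)"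
        using h_le elim by (intro mult_left_mono) (auto simp: h_def)
      finally show ?thesis by simp
    qed
    ultimately show ?case
      using nu1_nonneg elim divide_right_mono[of _ _ "?r m"] by (simp add: mult.assoc)
  qed
  show "same_order_log p (\<lambda>m. ?tau m) (\<lambda>m. ereal (?nu m / ?r m))"
    unfolding same_order_log_def
  proof (intro exI[of _ 1] conjI)
    show "lesssim (\<lambda>m. ?tau m) (\<lambda>m. ereal (?lp m ^ 1) * ereal (?nu m / ?r m))"
      unfolding lesssim_def
    proof (intro exI[of _ "4 * C"] conjI)
      show "\<forall>\<^sub>F m in sequentially. ?tau m \<le> ereal (4 * C) * (ereal (?lp m ^ 1) * ereal (?nu m / ?r m))"
        using bounds det
      proof eventually_elim
        case (elim m)
        have "C * (?H m / ?r m) \<le> C * (4 * (?lp m * (?nu m / ?r m)))"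
          using elim C by (intro mult_left_mono) auto
        then have "ereal (C * (?H m / ?r m)) \<le> ereal (4 * C) * (ereal (?lp m ^ 1) * ereal (?nu m / ?r m))"
          by (simp add: mult_ac)
        then show ?case using elim by (meson order_trans)
      qed
    qed (use C in simp)
    show "lesssim (\<lambda>m. ereal (?nu m / ?r m)) (\<lambda>m. ereal (?lp m ^ 1) * ?tau m)"
      unfolding lesssim_def
    proof (intro exI[of _ "6 / c"] conjI)
      show "\<forall>\<^sub>F m in sequentially. ereal (?nu m / ?r m) \<le> ereal (6 / c) * (ereal (?lp m ^ 1) * ?tau m)"
        using bounds det
      proof eventually_elim
        case (elim m)
        have "ereal (?nu m / ?r m) \<le> ereal (6 / c * (?lp m ^ 1 * (c * (?h m / ?r m))))"
          using elim c by simp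
        also have "\<dots> \<le> ereal (6 / c) * (ereal (?lp m ^ 1) * ?tau m)"
          using elim c by (intro ereal_scale_mono) auto
        finally show ?case .
      qed
    qed (use c in simp)
  qed
  show "same_order_log p (\<lambda>m. ereal (?nu m / ?r m)) (\<lambda>m. ereal (?H m / ?r m))"
    unfolding same_order_log_def
  proof (intro exI[of _ 1] conjI)
    show "lesssim (\<lambda>m. ereal (?nu m / ?r m)) (\<lambda>m. ereal (?lp m ^ 1) * ereal (?H m / ?r m))"
      unfolding lesssim_def
    proof (intro exI[of _ 6] conjI)
      show "\<forall>\<^sub>F m in sequentially. ereal (?nu m / ?r m) \<le> ereal 6 * (ereal (?lp m ^ 1) * ereal (?H m / ?r m))"
        using det
      proof eventually_elim
        case (elim m)
        have "?lp m * (?h m / ?r m) \<le> ?lp m * (?H m / ?r m)" using elim by (intro mult_left_mono) auto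
        then have "?nu m / ?r m \<le> 6 * (?lp m * (?H m / ?r m))" using elim by linarith
        then show ?case by simp
      qed
    qed simp
    show "lesssim (\<lambda>m. ereal (?H m / ?r m)) (\<lambda>m. ereal (?lp m ^ 1) * ereal (?nu m / ?r m))"
      unfolding lesssim_def
      by (intro exI[of _ 4] conjI eventually_mono[OF det]) auto
  qed
  assume dense: "lesssim (\<lambda>m. ereal ((real (ku m))\<^sup>2 * ?lp m)) (\<lambda>m. ereal (real (j1 (ku m) (\<xi> m))))"
  then obtain C3 where C3: "0 < C3"
    "\<forall>\<^sub>F m in sequentially. (real (ku m))\<^sup>2 * ?lp m \<le> C3 * real (j1 (ku m) (\<xi> m))"
    unfolding lesssim_real by blast
  define Q where "Q = nat \<lceil>C3\<rceil>"
  have Q: "C3 \<le> real Q" unfolding Q_def by (rule real_nat_ceiling_ge)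
  have Q0: "0 < real Q" using Q C3 by linarith
  \<comment> \<open>Once \<open>lp >= C3\<close>, the bound \<open>ku^2 lp <= C3 j1\<close> gives
    \<open>ku^2 <= j1\<close>, so \<open>nu1_le_dense\<close> applies.\<close>
  have "\<forall>\<^sub>F m in sequentially. C3 \<le> ?lp m" using plog by (simp add: filterlim_at_top)
  then have "\<forall>\<^sub>F m in sequentially. ?nu m / ?r m \<le> 3 * (?h m / ?r m)
      \<and> ?H m / ?r m \<le> sqrt (3 * real Q) * (?nu m / ?r m)"
    using C3(2) ev
  proof eventually_elim
    case (elim m)
    then interpret rate "p m" "ku m" "\<xi> m" by (intro rate) simp
    have "(real (ku m))\<^sup>2 * ?lp m \<le> ?lp m * real (j1 (ku m) (\<xi> m))"
      using elim by (meson mult_right_mono of_nat_0_le_iff order_trans)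
    then have "real ((ku m)\<^sup>2) \<le> real (j1 (ku m) (\<xi> m))" using elim by (simp add: mult.commute)
    then have "(ku m)\<^sup>2 \<le> j1 (ku m) (\<xi> m)" by (simp only: of_nat_le_iff)
    then have 1: "?nu m \<le> 3 * ?h m" using nu1_le_dense by (simp add: h_def)
    have "C3 * real (j1 (ku m) (\<xi> m)) \<le> real Q * real (j1 (ku m) (\<xi> m))"
      using Q by (intro mult_right_mono) auto
    then have 2: "?H m \<le> sqrt (3 * real Q) * ?nu m"
      using elim by (intro H_le_nu1_dense) linarith
    show ?case
      using divide_right_mono[OF 1, of "?r m"] divide_right_mono[OF 2, of "?r m"] by simp
  qed
  note dns = this
  show "same_order (\<lambda>m. ?tau m) (\<lambda>m. ereal (?nu m / ?r m))"
    unfolding same_order_def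
  proof
    show "lesssim (\<lambda>m. ?tau m) (\<lambda>m. ereal (?nu m / ?r m))"
      unfolding lesssim_def
    proof (intro exI[of _ "C * sqrt (3 * real Q)"] conjI)
      show "\<forall>\<^sub>F m in sequentially. ?tau m \<le> ereal (C * sqrt (3 * real Q)) * ereal (?nu m / ?r m)"
        using bounds dns
      proof eventually_elim
        case (elim m)
        have "C * (?H m / ?r m) \<le> C * (sqrt (3 * real Q) * (?nu m / ?r m))"
          using elim C by (intro mult_left_mono) auto
        then have "ereal (C * (?H m / ?r m)) \<le> ereal (C * sqrt (3 * real Q)) * ereal (?nu m / ?r m)"
          by (simp add: mult_ac)
        then show ?case using elim by (meson order_trans)
      qed
    qed (use C Q0 in simp)
    show "lesssim (\<lambda>m. ereal (?nu m / ?r m)) (\<lambda>m. ?tau m)"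
      unfolding lesssim_def
    proof (intro exI[of _ "3 / c"] conjI)
      show "\<forall>\<^sub>F m in sequentially. ereal (?nu m / ?r m) \<le> ereal (3 / c) * ?tau m"
        using bounds dns
      proof eventually_elim
        case (elim m)
        have "ereal (?nu m / ?r m) \<le> ereal (3 / c * (c * (?h m / ?r m)))" using elim c by simp
        also have "\<dots> \<le> ereal (3 / c) * ?tau m" using elim c by (intro ereal_scale_mono) auto
        finally show ?case .
      qed
    qed (use c in simp)
  qed
qed

end
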